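(* Let $(X_n)_{n\ge 0}$ be the RDE-chain with associated random vector $(M,Q)$ in $\mathbb{R}_+^2$. Suppose that $\mathbb{P}(M=0)=0$, $\mathbb{P}(Q=0)<1$, that $\liminf_{n\to\infty}\Pi_n=0$ and $\limsup_{n\to\infty}\Pi_n=+\infty$ a.s., that $\mathbb{E}\log\sigma<\infty$, where $\sigma=\inf\{k\ge1:S_k<0\}$, and that $$Q\le aM+b\quad\text{for some } a,b>0 .$$ Then the chain is null-recurrent and possesses an essentially unique (i.e. unique up to a positive multiplicative constant) invariant Radon measure.
   Context: $\mathbb{R}_+=[0,\infty)$. Let $(M_1,Q_1),(M_2,Q_2),\ldots$ be i.i.d. $\mathbb{R}_+^2$-valued random vectors with generic copy $(M,Q)$. The RDE-chain with associated random vector $(M,Q)$ is the Markov chain $X_n=M_nX_{n-1}+Q_n$, $n\ge1$, with $X_0$ independent of the $(M_n,Q_n)$; write $X_n^x$ when $X_0=x$. Put $\Pi_0=1$, $\Pi_n=\prod_{k=1}^nM_k$, $S_0=0$, $S_n=\log\Pi_n=\sum_{k=1}^n\log M_k$. The chain is called recurrent if there exists a nonempty closed set $L\subset\mathbb{R}$ such that $\mathbb{P}(X_n^x\in U\text{ infinitely often})=1$ for every $x\in L$ and every open set $U$ intersecting $L$. The chain is locally contractive if for every compact $K$ and all $x,y\in\mathbb{R}$, $|X_n^x-X_n^y|\mathbf{1}_{\{X_n^x\in K\}}\to0$ a.s.; a locally contractive recurrent chain has an invariant Radon measure $\nu$, unique up to a multiplicative constant, and is called positive recurrent if $\nu(L)<\infty$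 and null-recurrent otherwise. *)

theory Defs
  imports "HOL-Probability.Probability"
begin

(* The random vectors (M n, Q n) are used for n >= 1 only; X0 is the initial variable. *)
fun rde_chain :: "(nat \<Rightarrow> 'a \<Rightarrow> real) \<Rightarrow> (nat \<Rightarrow> 'a \<Rightarrow> real) \<Rightarrow> ('a \<Rightarrow> real) \<Rightarrow> nat \<Rightarrow> 'a \<Rightarrow> real" where
  "rde_chain M Q X0 0 \<omega> = X0 \<omega>"
| "rde_chain M Q X0 (Suc n) \<omega> = M (Suc n) \<omega> * rde_chain M Q X0 n \<omega> + Q (Suc n) \<omega>"

definition Pi_rde :: "(nat \<Rightarrow> 'a \<Rightarrow> real) \<Rightarrow> nat \<Rightarrow> 'a \<Rightarrow> real" where
  "Pi_rde M n \<omega> = (\<Prod>k=1..n. M k \<omega>)"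

(* Intended for M k \<omega> > 0; where M k \<omega> = 0 the library convention ln 0 = 0 applies. *)
definition S_rde :: "(nat \<Rightarrow> 'a \<Rightarrow> real) \<Rightarrow> nat \<Rightarrow> 'a \<Rightarrow> real" where
  "S_rde M n \<omega> = (\<Sum>k=1..n. ln (M k \<omega>))"

(* The infimum is taken in enat, so the value is \<infinity> if S never becomes negative. *)
definition sigma_rde :: "(nat \<Rightarrow> 'a \<Rightarrow> real) \<Rightarrow> 'a \<Rightarrow> enat" where
  "sigma_rde M \<omega> = Inf (enat ` {k. k \<ge> 1 \<and> S_rde M k \<omega> < 0})"

(* Used for arguments >= 1 only, where the logarithm is nonnegative. *)
definition ln_enat :: "enat \<Rightarrow> ennreal" where
  "ln_enat k = (case k of enat n \<Rightarrow> ennreal (ln (real n)) | \<infinity> \<Rightarrow> \<infinity>)"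

(* Below, X x n is the n-th variable of the chain started at x. *)

definition recurrence_set :: "'a measure \<Rightarrow> (real \<Rightarrow> nat \<Rightarrow> 'a \<Rightarrow> real) \<Rightarrow> real set \<Rightarrow> bool" where
  "recurrence_set P X L \<longleftrightarrow> L \<noteq> {} \<and> closed L \<and>
     (\<forall>x\<in>L. \<forall>U. open U \<and> U \<inter> L \<noteq> {} \<longrightarrow> (AE \<omega> in P. infinite {n. X x n \<omega> \<in> U}))"

definition recurrent :: "'a measure \<Rightarrow> (real \<Rightarrow> nat \<Rightarrow> 'a \<Rightarrow> real) \<Rightarrow> bool" where
  "recurrent P X \<longleftrightarrow> (\<exists>L. recurrence_set P X L)"

definition locally_contractive :: "'a measure \<Rightarrow> (real \<Rightarrow> nat \<Rightarrow> 'a \<Rightarrow> real) \<Rightarrow> bool" where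
  "locally_contractive P X \<longleftrightarrow> (\<forall>K x y. compact K \<longrightarrow>
     (AE \<omega> in P. (\<lambda>n. \<bar>X x n \<omega> - X y n \<omega>\<bar> * indicator K (X x n \<omega>)) \<longlonglongrightarrow> 0))"

(* Recurrence sets are not unique: {x} is one for each point x of a recurrence set L.
   The set L whose mass separates positive from null recurrence is the largest one; for a
   locally contractive recurrent chain it exists and is limit_set (see the lemmas below). *)
definition limit_set :: "'a measure \<Rightarrow> (real \<Rightarrow> nat \<Rightarrow> 'a \<Rightarrow> real) \<Rightarrow> real set" where
  "limit_set P X = closure (\<Union>{L. recurrence_set P X L})"

lemma recurrence_set_subset_limit_set:
  "recurrence_set P X L \<Longrightarrow> L \<subseteq> limit_set P X"
  unfolding limit_set_def by (rule order_trans[OF Union_upper closure_subset]) simp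

lemma recurrence_set_limit_set:
  assumes lc: "locally_contractive P X" and rec: "recurrent P X"
  shows "recurrence_set P X (limit_set P X)"
  unfolding recurrence_set_def
proof (intro conjI ballI allI impI)
  show "limit_set P X \<noteq> {}"
  proof -
    obtain L where L: "recurrence_set P X L" using rec unfolding recurrent_def by blast
    then have "L \<noteq> {}" unfolding recurrence_set_def by simp
    with recurrence_set_subset_limit_set[OF L] show ?thesis by blast
  qed
  show "closed (limit_set P X)" by (simp add: limit_set_def)
next
  fix x U assume U: "open U \<and> U \<inter> limit_set P X \<noteq> {}"
  then have "U \<inter> \<Union>{L. recurrence_set P X L} \<noteq> {}"
    unfolding limit_set_def using open_Int_closure_eq_empty[of U] by simp
  then obtain L z where L: "recurrence_set P X L" and z: "z \<in> L" "z \<in> U" by blast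
  obtain r where r: "r > 0" "ball z r \<subseteq> U" using U z openE by blast
  have "AE \<omega> in P. infinite {n. X z n \<omega> \<in> ball z (r/2)}"
  proof -
    have "z \<in> ball z (r/2) \<inter> L" using z r by simp
    then have "ball z (r/2) \<inter> L \<noteq> {}" by blast
    then show ?thesis using L z open_ball unfolding recurrence_set_def by blast
  qed
  moreover have "AE \<omega> in P. (\<lambda>n. \<bar>X z n \<omega> - X x n \<omega>\<bar> * indicator (cball z (r/2)) (X z n \<omega>)) \<longlonglongrightarrow> 0"
    using lc unfolding locally_contractive_def by simp
  ultimately show "AE \<omega> in P. infinite {n. X x n \<omega> \<in> U}"
  proof eventually_elim
    case (elim \<omega>)
    have "\<forall>\<^sub>F n in sequentially. \<bar>X z n \<omega> - X x n \<omega>\<bar> * indicator (cball z (r/2)) (X z n \<omega>) < r/2"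
      by (rule order_tendstoD(2)[OF elim(2)]) (use r in simp)
    then obtain N where N: "\<And>n. n \<ge> N \<Longrightarrow>
        \<bar>X z n \<omega> - X x n \<omega>\<bar> * indicator (cball z (r/2)) (X z n \<omega>) < r/2"
      unfolding eventually_sequentially by blast
    have "{n. X z n \<omega> \<in> ball z (r/2)} - {..<N} \<subseteq> {n. X x n \<omega> \<in> U}"
    proof
      fix n assume n: "n \<in> {n. X z n \<omega> \<in> ball z (r/2)} - {..<N}"
      then have a: "\<bar>z - X z n \<omega>\<bar> < r/2" and "n \<ge> N" by (auto simp: dist_real_def)
      with N[of n] have "\<bar>X z n \<omega> - X x n \<omega>\<bar> < r/2" by (simp add: dist_real_def)
      with a have "X x n \<omega> \<in> ball z r" unfolding mem_ball dist_real_def by linarith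
      then show "n \<in> {n. X x n \<omega> \<in> U}" using r by auto
    qed
    moreover have "infinite ({n. X z n \<omega> \<in> ball z (r/2)} - {..<N})"
      using elim(1) by (simp add: Diff_infinite_finite)
    ultimately show ?case by (rule infinite_super)
  qed
qed

(* Here (M, Q) is the generic random vector, so the transition kernel is
   (x, A) \<mapsto> P(M x + Q \<in> A). The zero measure is excluded. A Borel measure on the reals
   that is finite on compact sets is automatically regular, hence Radon. *)
definition invariant_radon ::
    "'a measure \<Rightarrow> ('a \<Rightarrow> real) \<Rightarrow> ('a \<Rightarrow> real) \<Rightarrow> real measure \<Rightarrow> bool" where
  "invariant_radon P M Q \<nu> \<longleftrightarrow>
     sets \<nu> = sets borel \<and> emeasure \<nu> UNIV \<noteq> 0 \<and>
     (\<forall>K. compact K \<longrightarrow> emeasure \<nu> K < \<infinity>) \<and>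
     (\<forall>A\<in>sets borel. emeasure \<nu> A =
        (\<integral>\<^sup>+ x. emeasure P {\<omega> \<in> space P. M \<omega> * x + Q \<omega> \<in> A} \<partial>\<nu>))"

(* Since the invariant measure is unique up to a factor for locally contractive recurrent
   chains, it does not matter which one is used here. *)
definition null_recurrent ::
    "'a measure \<Rightarrow> ('a \<Rightarrow> real) \<Rightarrow> ('a \<Rightarrow> real) \<Rightarrow> (real \<Rightarrow> nat \<Rightarrow> 'a \<Rightarrow> real) \<Rightarrow> bool" where
  "null_recurrent P M Q X \<longleftrightarrow> locally_contractive P X \<and> recurrent P X \<and>
     (\<exists>\<nu>. invariant_radon P M Q \<nu> \<and> emeasure \<nu> (limit_set P X) = \<infinity>)"

end

theory Submission
  imports Defs
begin

text \<open>
  Everything is done on the space of i.i.d. streams with letters distributed like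
  \<open>(M, Q)\<close>. Write \<open>\<Pi>\<^sub>n\<close> for the product of the first \<open>n\<close> multipliers. Unfolding the recursion gives
  \<open>X\<^sub>n = \<Pi>\<^sub>n (x + D\<^sub>n)\<close> with \<open>D\<^sub>n = \<Sum>k\<le>n. Q\<^sub>k / \<Pi>\<^sub>k\<close>, and reversing the order of the first \<open>n\<close> letters
  turns \<open>(\<Pi>\<^sub>n, X\<^sub>n)\<close>, started at \<open>0\<close>, into \<open>(\<Pi>\<^sub>n, B\<^sub>n)\<close> with the increasing sums
  \<open>B\<^sub>n = \<Sum>k\<le>n. \<Pi>\<^sub>k\<^sub>-\<^sub>1 Q\<^sub>k\<close>.

  The key estimate (\<open>green_bound_finite\<close>) is that the expected number of times \<open>n\<close> with \<open>B\<^sub>n \<le> R\<close> and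
  \<open>\<Pi>\<^sub>n \<ge> 1\<close> is finite: from each such time \<open>B\<close> exceeds \<open>R\<close> within the next \<open>N\<close> steps with a fixed
  positive probability, while \<open>B\<^sub>n \<le> R < B\<^sub>n\<^sub>+\<^sub>N\<close> holds for at most \<open>N\<close> values of \<open>n\<close>. Since \<open>\<Pi>\<close> is unbounded,
  \<open>B\<^sub>n\<close> tends to infinity. The sums \<open>D\<^sub>n\<close> are the sums \<open>B\<^sub>n\<close> for the letters \<open>(1/M, Q/M)\<close>, so \<open>D\<^sub>n\<close>
  tends to infinity as well. Two copies of the chain differ by \<open>\<Pi>\<^sub>n |x - y| = |X\<^sub>n| |x - y| / |x + D\<^sub>n|\<close>,
  which is small whenever \<open>X\<^sub>n\<close> is bounded: this is local contraction, on one event for all \<open>x, y\<close>.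

  Cut the stream at the strictly descending ladder times of \<open>\<Pi>\<close>. The chain seen at these times is
  again an affine recursion, with multipliers less than 1 and with additive terms at most
  \<open>(a + b) \<sigma>\<close>; this is where \<open>Q \<le> a M + b\<close> enters. As \<open>log \<sigma>\<close> is integrable, its perpetuity
  converges and its law \<open>\<pi>\<close> is stationary for the ladder chain. Hence the chain keeps returning to
  some bounded interval, and the occupation measure \<open>\<nu>\<close> of one ladder excursion started from \<open>\<pi>\<close> is
  invariant. Before the ladder time \<open>\<Pi>\<^sub>n \<ge> 1\<close>, so reversal and the key estimate show that \<open>\<nu>\<close> is
  finite on compact sets. It is infinite in total: under a finite invariant measure
  \<open>X\<^sub>n\<close>, which dominates in law the diverging \<open>B\<^sub>n\<close>, would escape to infinity.

  Uniqueness does not go through a ratio ergodic theorem. Hopf's maximal inequality on the product of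
  an invariant measure with the stream space (\<open>hopf_comparison\<close>), local contraction, and the
  zero-one law for the shift show: if \<open>\<nu>(f) < \<nu>(g)\<close> for one invariant Radon measure and for Lipschitz
  \<open>f, g\<close> with compact support, then \<open>\<Sum>k<n. (g - f)(X\<^sub>k)\<close> tends to infinity almost surely from every
  starting point (\<open>sums_diverge\<close>). As this conclusion does not mention the measure, no other
  invariant Radon measure can order \<open>f\<close> and \<open>g\<close> strictly the other way, so all of them are
  proportional. With \<open>f = 0\<close> the same statement shows that each point of the support of \<open>\<nu>\<close> is
  recurrent, so that \<open>\<nu>\<close> is carried by the limit set.
\<close>

section \<open>Splitting and zero-one laws for i.i.d. streams\<close>

lemma snth_stake_shift:
  "(stake n s @- t) !! k = (if k < n then s !! k else t !! (k - n))"
  by (cases "k < n") (auto simp: shift_snth_less shift_snth_ge)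

lemma sdrop_stake_shift [simp]: "sdrop n (stake n s @- t) = t"
  by (simp add: sdrop_shift)

context prob_space
begin

text \<open>The Markov property in its simplest form: the letters from position \<open>n\<close> on can be
  replaced by an independent fresh stream.\<close>
lemma nn_integral_stream_split:
  assumes [measurable]: "F \<in> borel_measurable (stream_space M)"
  shows "(\<integral>\<^sup>+s. F s \<partial>stream_space M) =
    (\<integral>\<^sup>+s. (\<integral>\<^sup>+t. F (stake n s @- t) \<partial>stream_space M) \<partial>stream_space M)"
  using assms
proof (induction n arbitrary: F)
  case 0
  interpret S: prob_space "stream_space M" by (rule prob_space_stream_space)
  show ?case by (simp add: S.emeasure_space_1)
next
  case (Suc n)
  note [measurable] = Suc.prems
  interpret S: prob_space "stream_space M" by (rule prob_space_stream_space)
  have "(\<integral>\<^sup>+s. F s \<partial>stream_space M) = (\<integral>\<^sup>+x. \<integral>\<^sup>+s. F (x ## s) \<partial>stream_space M \<partial>M)"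
    by (rule nn_integral_stream_space) measurable
  also have "\<dots> = (\<integral>\<^sup>+x. \<integral>\<^sup>+s. \<integral>\<^sup>+t. F (x ## (stake n s @- t)) \<partial>stream_space M \<partial>stream_space M \<partial>M)"
    by (intro nn_integral_cong Suc.IH) measurable
  also have "\<dots> = (\<integral>\<^sup>+x. \<integral>\<^sup>+s. \<integral>\<^sup>+t. F (stake (Suc n) (x ## s) @- t) \<partial>stream_space M \<partial>stream_space M \<partial>M)"
    by simp
  also have "\<dots> = (\<integral>\<^sup>+s. \<integral>\<^sup>+t. F (stake (Suc n) s @- t) \<partial>stream_space M \<partial>stream_space M)"
    by (rule nn_integral_stream_space[symmetric]) measurable
  finally show ?case .
qed

lemma nn_integral_stream_sdrop:
  assumes [measurable]: "F \<in> borel_measurable (stream_space M)"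
  shows "(\<integral>\<^sup>+s. F (sdrop n s) \<partial>stream_space M) = (\<integral>\<^sup>+s. F s \<partial>stream_space M)"
proof -
  interpret S: prob_space "stream_space M" by (rule prob_space_stream_space)
  have "(\<integral>\<^sup>+s. F (sdrop n s) \<partial>stream_space M) =
     (\<integral>\<^sup>+s. (\<integral>\<^sup>+t. F (sdrop n (stake n s @- t)) \<partial>stream_space M) \<partial>stream_space M)"
    by (rule nn_integral_stream_split) measurable
  then show ?thesis by (simp add: S.emeasure_space_1)
qed

lemma AE_stream_sdrop:
  assumes "AE s in stream_space M. R s"
  shows "AE s in stream_space M. R (sdrop n s)"
proof -
  from assms obtain N where N: "{s\<in>space (stream_space M). \<not> R s} \<subseteq> N"
    "emeasure (stream_space M) N = 0" and [measurable]: "N \<in> sets (stream_space M)"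
    by (rule AE_E) auto
  have "(\<integral>\<^sup>+s. indicator N (sdrop n s) \<partial>stream_space M) = 0"
    using N by (subst nn_integral_stream_sdrop) auto
  then have "AE s in stream_space M. indicator N (sdrop n s) = (0::ennreal)"
    by (subst (asm) nn_integral_0_iff_AE) auto
  then show ?thesis
  proof (rule AE_mp, intro AE_I2 impI)
    fix s assume s: "s \<in> space (stream_space M)" "indicator N (sdrop n s) = (0::ennreal)"
    then have "sdrop n s \<notin> N" by (auto simp: indicator_def split: if_splits)
    moreover have "sdrop n s \<in> space (stream_space M)"
      using measurable_space[OF measurable_sdrop s(1)] .
    ultimately show "R (sdrop n s)" using N by auto
  qed
qed

text \<open>Conditioning on a shift-invariant event leaves the probability of every cylinder
  unchanged, because prepending a letter does not affect the event. So the conditioned measure is the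
  stream measure itself, which gives the complement mass zero.\<close>
lemma stream_zero_one:
  assumes [measurable]: "Measurable.pred (stream_space M) I"
    and inv: "\<And>s. s \<in> space (stream_space M) \<Longrightarrow> I (stl s) \<longleftrightarrow> I s"
    and ne: "\<not> (AE s in stream_space M. \<not> I s)"
  shows "AE s in stream_space M. I s"
proof -
  let ?S = "stream_space M"
  interpret S: prob_space ?S by (rule prob_space_stream_space)
  define J where "J = {s\<in>space ?S. I s}"
  have J [measurable]: "J \<in> sets ?S" by (simp add: J_def)
  have "emeasure ?S J \<noteq> 0" using ne unfolding J_def by (subst (asm) AE_iff_measurable[OF _ refl]) auto
  have fin: "emeasure ?S J \<noteq> \<infinity>" by simp
  \<comment> \<open>The stream measure conditioned on the event.\<close>
  define N where "N = scale_measure (1 / emeasure ?S J) (density ?S (indicator J))"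
  have [simp, measurable_cong]: "sets N = sets ?S" by (simp add: N_def)
  have Nm: "emeasure N A = emeasure ?S (J \<inter> A) / emeasure ?S J" if "A \<in> sets ?S" for A
    using that unfolding N_def
    by (simp add: emeasure_density divide_ennreal_def mult.commute Int_commute
        flip: indicator_inter_arith)
  have cyl: "emeasure ?S (J \<inter> scylinder (space M) xs) = emeasure ?S J * emeasure ?S (scylinder (space M) xs)"
    if "xs \<in> lists (sets M)" for xs
    using that
  proof (induction xs)
    case Nil
    then show ?case using sets.sets_into_space[OF J] S.emeasure_space_1
      by (simp add: space_stream_space[symmetric] Int_absorb2)
  next
    case (Cons A xs)
    then have [measurable]: "A \<in> sets M" and xs: "xs \<in> lists (sets M)" by auto
    let ?C = "scylinder (space M) xs"
    have "\<forall>x\<in>set xs. x \<in> sets M" using xs by (rule in_listsD)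
    moreover from this have "\<forall>x\<in>set (A # xs). x \<in> sets M" using \<open>A \<in> sets M\<close> by simp
    ultimately have C [measurable]: "?C \<in> sets ?S" "scylinder (space M) (A # xs) \<in> sets ?S"
      using sets_scylinder[of xs M] sets_scylinder[of "A # xs" M] by (simp_all only: HOL.simp_thms)
    have "emeasure ?S (J \<inter> scylinder (space M) (A # xs)) =
       (\<integral>\<^sup>+x. emeasure ?S {s\<in>space ?S. x ## s \<in> J \<inter> scylinder (space M) (A # xs)} \<partial>M)"
      by (rule emeasure_stream_space) (simp del: scylinder.simps)
    also have "\<dots> = (\<integral>\<^sup>+x. indicator A x * emeasure ?S (J \<inter> ?C) \<partial>M)"
      using scylinder_streams[of "space M" xs] inv
      by (intro nn_integral_cong, auto simp: indicator_def J_def space_stream_space streams_Stream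
          intro!: arg_cong[where f="emeasure ?S"] split: if_splits)
        (metis inv space_stream_space stream.sel(2) streams_Stream)+
    also have "\<dots> = emeasure M A * (emeasure ?S J * emeasure ?S ?C)"
      using Cons.IH by (subst nn_integral_multc) auto
    finally have 1: "emeasure ?S (J \<inter> scylinder (space M) (A # xs)) = emeasure M A * (emeasure ?S J * emeasure ?S ?C)" .
    have "emeasure ?S (scylinder (space M) (A # xs)) =
       (\<integral>\<^sup>+x. emeasure ?S {s\<in>space ?S. x ## s \<in> scylinder (space M) (A # xs)} \<partial>M)"
      by (rule emeasure_stream_space) (simp del: scylinder.simps)
    also have "\<dots> = (\<integral>\<^sup>+x. indicator A x * emeasure ?S ?C \<partial>M)"
      using scylinder_streams[of "space M" xs]
      by (intro nn_integral_cong) (auto simp: indicator_def space_stream_space streams_Stream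
          intro!: arg_cong[where f="emeasure ?S"] split: if_splits)
    also have "\<dots> = emeasure M A * emeasure ?S ?C"
      by (subst nn_integral_multc) auto
    finally show ?case using 1 by (simp add: mult_ac)
  qed
  have "prob_space N"
  proof
    show "emeasure N (space N) = 1"
      using Nm[of "space ?S"] sets.sets_into_space[OF J] \<open>emeasure ?S J \<noteq> 0\<close> fin
      by (simp add: Int_absorb2 sets_eq_imp_space_eq[of N ?S] ennreal_divide_self S.emeasure_eq_measure)
  qed
  have "N = ?S"
  proof (rule stream_space_eq_scylinder[where S=M and G="sets M" and C="{space M}"])
    show "sets M = sets (sigma (space M) (sets M))" by simp
    show "sets M \<subseteq> Pow (space M)" by (rule sets.space_closed)
    fix xs assume xs: "xs \<in> lists (sets M)"
    then have "scylinder (space M) xs \<in> sets ?S" by (auto intro: sets_scylinder)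
    from Nm[OF this] show "emeasure N (scylinder (space M) xs) = emeasure ?S (scylinder (space M) xs)"
      using cyl[OF xs] \<open>emeasure ?S J \<noteq> 0\<close> fin
      by (simp add: ennreal_mult_divide_eq mult.commute[of "emeasure ?S J"])
  qed (auto simp: Int_stable_def S.prob_space_axioms \<open>prob_space N\<close>)
  then have "emeasure ?S (space ?S - J) = 0"
    using Nm[of "space ?S - J"] by simp
  then show ?thesis
    by (subst AE_iff_measurable[OF _ refl]) (auto simp: J_def set_diff_eq cong: conj_cong)
qed

text \<open>A form that avoids proving exact shift invariance: it suffices that \<open>A\<close> has positive
  probability and forces \<open>B\<close> for all shifts of the stream. Then the shift-invariant event that
  \<open>B\<close> holds for all late shifts has probability one, and by stationarity so does \<open>B\<close>.\<close>
lemma stream_zero_one_hereditary: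
  assumes [measurable]: "Measurable.pred (stream_space M) B"
    and imp: "AE s in stream_space M. A s \<longrightarrow> (\<forall>n. B (sdrop n s))"
    and ne: "\<not> (AE s in stream_space M. \<not> A s)"
  shows "AE s in stream_space M. B s"
proof -
  let ?S = "stream_space M"
  interpret S: prob_space ?S by (rule prob_space_stream_space)
  define I where "I s \<longleftrightarrow> (\<exists>N. \<forall>n\<ge>N. B (sdrop n s))" for s
  have [measurable]: "Measurable.pred ?S I" unfolding I_def by measurable
  have "AE s in ?S. I s"
  proof (rule stream_zero_one)
    fix s show "I (stl s) \<longleftrightarrow> I s"
    proof
      assume "I (stl s)"
      then obtain N where N: "\<And>n. n \<ge> N \<Longrightarrow> B (sdrop n (stl s))" unfolding I_def by blast
      have "B (sdrop n s)" if "n \<ge> Suc N" for n using N[of "n-1"] that by (cases n) auto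
      then show "I s" unfolding I_def by blast
    next
      assume "I s"
      then obtain N where N: "\<And>n. n \<ge> N \<Longrightarrow> B (sdrop n s)" unfolding I_def by blast
      have "B (sdrop n (stl s))" if "n \<ge> N" for n using N[of "Suc n"] that by auto
      then show "I (stl s)" unfolding I_def by blast
    qed
  next
    show "\<not> (AE s in ?S. \<not> I s)"
    proof
      assume "AE s in ?S. \<not> I s"
      then have "AE s in ?S. \<not> A s" using imp by eventually_elim (auto simp: I_def)
      with ne show False by simp
    qed
  qed measurable
  have pb: "S.prob {s\<in>space ?S. B (sdrop n s)} = S.prob {s\<in>space ?S. B s}" for n
  proof -
    have "emeasure ?S {s\<in>space ?S. B (sdrop n s)} = (\<integral>\<^sup>+s. indicator {s\<in>space ?S. B s} (sdrop n s) \<partial>?S)"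
      using measurable_space[OF measurable_sdrop, of _ M n]
      by (subst nn_integral_indicator[symmetric], measurable)
        (intro nn_integral_cong, simp add: indicator_def)
    also have "\<dots> = emeasure ?S {s\<in>space ?S. B s}"
      by (subst nn_integral_stream_sdrop) auto
    finally show ?thesis by (simp add: measure_def)
  qed
  have "(\<lambda>N. S.prob {s\<in>space ?S. \<forall>n\<ge>N. B (sdrop n s)}) \<longlonglongrightarrow> S.prob (\<Union>N. {s\<in>space ?S. \<forall>n\<ge>N. B (sdrop n s)})"
    by (rule S.finite_Lim_measure_incseq) (auto simp: incseq_def)
  also have "(\<Union>N. {s\<in>space ?S. \<forall>n\<ge>N. B (sdrop n s)}) = {s\<in>space ?S. I s}"
    by (auto simp: I_def)
  also have "S.prob {s\<in>space ?S. I s} = 1"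
    using \<open>AE s in ?S. I s\<close> by (simp add: S.prob_Collect_eq_1)
  finally have lim: "(\<lambda>N. S.prob {s\<in>space ?S. \<forall>n\<ge>N. B (sdrop n s)}) \<longlonglongrightarrow> 1" .
  have "S.prob {s\<in>space ?S. \<forall>n\<ge>N. B (sdrop n s)} \<le> S.prob {s\<in>space ?S. B s}" for N
    unfolding pb[of N, symmetric] by (rule S.finite_measure_mono) auto
  then have "1 \<le> S.prob {s\<in>space ?S. B s}"
    by (intro LIMSEQ_le_const2[OF lim]) auto
  then show ?thesis by (simp add: S.prob_Collect_eq_1[symmetric] antisym)
qed

end

section \<open>Affine recursions driven by a stream\<close>

definition prodm :: "('b \<Rightarrow> real) \<Rightarrow> nat \<Rightarrow> 'b stream \<Rightarrow> real" where
  "prodm m n s = (\<Prod>k<n. m (s !! k))"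

primrec chain :: "('b \<Rightarrow> real) \<Rightarrow> ('b \<Rightarrow> real) \<Rightarrow> real \<Rightarrow> nat \<Rightarrow> 'b stream \<Rightarrow> real" where
  "chain m q x 0 s = x"
| "chain m q x (Suc n) s = m (s !! n) * chain m q x n s + q (s !! n)"

text \<open>The value at \<open>0\<close> of the composition of the first \<open>n\<close> affine maps in reversed order; in contrast
  to the chain it is increasing in \<open>n\<close>.\<close>
definition bsum :: "('b \<Rightarrow> real) \<Rightarrow> ('b \<Rightarrow> real) \<Rightarrow> nat \<Rightarrow> 'b stream \<Rightarrow> real" where
  "bsum m q n s = (\<Sum>j<n. prodm m j s * q (s !! j))"

lemma prodm_0 [simp]: "prodm m 0 s = 1"
  by (simp add: prodm_def)

lemma prodm_Suc: "prodm m (Suc n) s = prodm m n s * m (s !! n)"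
  by (simp add: prodm_def)

lemma prodm_add: "prodm m (n + k) s = prodm m n s * prodm m k (sdrop n s)"
  by (induction k) (simp_all add: prodm_Suc sdrop_snth mult.assoc)

lemma prodm_Suc_stl: "prodm m (Suc n) s = m (shd s) * prodm m n (stl s)"
  using prodm_add[of m 1 n s] by (simp add: prodm_Suc)

lemma chain_add: "chain m q x (n + k) s = chain m q (chain m q x n s) k (sdrop n s)"
  by (induction k) (simp_all add: sdrop_snth)

lemma chain_Suc_stl: "chain m q x (Suc n) s = chain m q (m (shd s) * x + q (shd s)) n (stl s)"
  using chain_add[of m q x 1 n s] by simp

lemma chain_affine: "chain m q x n s = chain m q y n s + prodm m n s * (x - y)"
proof (induction n)
  case (Suc n)
  show ?case unfolding chain.simps(2) Suc prodm_Suc by (simp add: algebra_simps)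
qed simp

lemma bsum_0 [simp]: "bsum m q 0 s = 0"
  by (simp add: bsum_def)

lemma bsum_Suc: "bsum m q (Suc n) s = bsum m q n s + prodm m n s * q (s !! n)"
  by (simp add: bsum_def)

lemma bsum_add: "bsum m q (n + k) s = bsum m q n s + prodm m n s * bsum m q k (sdrop n s)"
proof (induction k)
  case (Suc k)
  then show ?case
    by (simp only: bsum_Suc add_Suc_right prodm_add sdrop_snth distrib_left mult.assoc add.assoc)
qed simp

lemma prodm_stake_shift: "k \<le> n \<Longrightarrow> prodm m k (stake n s @- t) = prodm m k s"
  by (simp add: prodm_def snth_stake_shift)

lemma chain_stake_shift: "k \<le> n \<Longrightarrow> chain m q x k (stake n s @- t) = chain m q x k s"
  by (induction k) (simp_all add: snth_stake_shift)

lemma bsum_stake_shift: "k \<le> n \<Longrightarrow> bsum m q k (stake n s @- t) = bsum m q k s"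
  by (induction k) (simp_all add: bsum_Suc snth_stake_shift prodm_stake_shift)

text \<open>Dividing the recursion by the running product turns it into a sum, and this sum is a
  \<^const>\<open>bsum\<close> for the inverse multipliers. This duality transfers divergence results between both.\<close>
lemma chain_eq_prodm_bsum:
  assumes "\<And>p. m p > 0"
  shows "chain m q x n s = prodm m n s * (x + bsum (\<lambda>p. 1 / m p) (\<lambda>p. q p / m p) n s)"
proof (induction n)
  case (Suc n)
  have "prodm (\<lambda>p. 1 / m p) n s = 1 / prodm m n s"
    by (simp add: prodm_def prod_dividef)
  moreover have "prodm m n s > 0" using assms by (auto simp: prodm_def intro!: prod_pos)
  ultimately show ?case using Suc assms[of "s !! n"]
    by (simp add: bsum_Suc prodm_Suc field_simps)
qed (simp)

text \<open>The letters are abstract because the locale is used three times: for the given vectors, for their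
  dual \<open>(1/m, q/m)\<close>, and for ladder blocks, where a letter is itself a stream. Positivity is
  required of every letter, at the price of a change on a null set; it makes all affine maps invertible.\<close>
locale affine_stream = prob_space \<mu>
  for \<mu> :: "'b measure" and m q :: "'b \<Rightarrow> real" +
  assumes space_UNIV: "space \<mu> = UNIV"
    and m_measurable [measurable]: "m \<in> borel_measurable \<mu>"
    and q_measurable [measurable]: "q \<in> borel_measurable \<mu>"
    and m_pos: "\<And>p. 0 < m p"
    and q_nonneg: "\<And>p. 0 \<le> q p"
begin

abbreviation "S \<equiv> stream_space \<mu>"

sublocale S: prob_space S
  by (rule prob_space_stream_space)

lemma space_S [simp]: "space S = UNIV"
  by (simp add: space_stream_space space_UNIV streams_UNIV)

lemma sets_Collect_S [measurable (raw)]: "Measurable.pred S R \<Longrightarrow> {s. R s} \<in> sets S"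
  by (simp add: pred_def)

lemma sets_Collect_mu [measurable (raw)]: "Measurable.pred \<mu> R \<Longrightarrow> {p. R p} \<in> sets \<mu>"
  by (simp add: pred_def space_UNIV)

lemma measurable_prodm [measurable]: "prodm m n \<in> borel_measurable S"
  unfolding prodm_def[abs_def] by measurable

lemma measurable_chain_pair:
  assumes f: "f \<in> borel_measurable N" and g: "g \<in> measurable N S"
  shows "(\<lambda>w. chain m q (f w) n (g w)) \<in> borel_measurable N"
proof (induction n)
  case (Suc n)
  note [measurable] = Suc f g
  show ?case by simp
qed (simp add: f)

lemmas [measurable (raw)] = measurable_chain_pair

lemma measurable_bsum [measurable]: "bsum m q n \<in> borel_measurable S"
  unfolding bsum_def[abs_def] by measurable

lemma prodm_pos: "0 < prodm m n s"
  using m_pos by (auto simp: prodm_def intro!: prod_pos)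

lemma bsum_nonneg: "0 \<le> bsum m q n s"
  using q_nonneg less_imp_le[OF prodm_pos] by (auto simp: bsum_def intro!: sum_nonneg mult_nonneg_nonneg)

lemma bsum_mono: "n \<le> k \<Longrightarrow> bsum m q n s \<le> bsum m q k s"
  using less_imp_le[OF prodm_pos] q_nonneg unfolding bsum_def
  by (intro sum_mono2) (auto intro!: mult_nonneg_nonneg)

lemma chain_nonneg: "0 \<le> x \<Longrightarrow> 0 \<le> chain m q x n s"
  using less_imp_le[OF m_pos] q_nonneg by (induction n) (auto intro!: add_nonneg_nonneg mult_nonneg_nonneg)

lemma nn_integral_shd:
  assumes [measurable]: "f \<in> borel_measurable \<mu>"
  shows "(\<integral>\<^sup>+s. f (shd s) \<partial>S) = (\<integral>\<^sup>+p. f p \<partial>\<mu>)"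
proof -
  have "(\<integral>\<^sup>+s. f (shd s) \<partial>S) = (\<integral>\<^sup>+p. \<integral>\<^sup>+s. f (shd (p ## s)) \<partial>S \<partial>\<mu>)"
    by (rule nn_integral_stream_space) measurable
  then show ?thesis using S.emeasure_space_1 by simp
qed

text \<open>The first \<open>n\<close> letters are exchangeable, so their order may be reversed. The induction peels off
  the first letter on the side of the chain and the last letter on the side of the sums.\<close>
lemma nn_integral_reversal:
  assumes "F \<in> borel_measurable (borel \<Otimes>\<^sub>M borel)"
  shows "(\<integral>\<^sup>+s. F (prodm m n s, chain m q 0 n s) \<partial>S) = (\<integral>\<^sup>+s. F (prodm m n s, bsum m q n s) \<partial>S)"
  using assms
proof (induction n arbitrary: F)
  case (Suc n)
  note [measurable] = Suc.prems
  interpret P: pair_sigma_finite S \<mu> ..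
  have "(\<integral>\<^sup>+s. F (prodm m (Suc n) s, chain m q 0 (Suc n) s) \<partial>S) =
    (\<integral>\<^sup>+p. \<integral>\<^sup>+s. F (prodm m (Suc n) (p ## s), chain m q 0 (Suc n) (p ## s)) \<partial>S \<partial>\<mu>)"
    by (rule nn_integral_stream_space) measurable
  also have "\<dots> = (\<integral>\<^sup>+p. \<integral>\<^sup>+s. F (m p * prodm m n s, chain m q 0 n s + prodm m n s * q p) \<partial>S \<partial>\<mu>)"
    unfolding prodm_Suc_stl chain_Suc_stl
    by (simp add: chain_affine[of m q "q p" n s 0 for p s] del: chain.simps)
  also have "\<dots> = (\<integral>\<^sup>+p. \<integral>\<^sup>+s. F (m p * prodm m n s, bsum m q n s + prodm m n s * q p) \<partial>S \<partial>\<mu>)"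
    using Suc.IH[of "\<lambda>(a, b). F (m p * a, b + a * q p)" for p] by simp
  also have "\<dots> = (\<integral>\<^sup>+s. \<integral>\<^sup>+p. F (m p * prodm m n s, bsum m q n s + prodm m n s * q p) \<partial>\<mu> \<partial>S)"
    by (rule P.Fubini') measurable
  also have "\<dots> = (\<integral>\<^sup>+s. \<integral>\<^sup>+t. F (m (shd t) * prodm m n s, bsum m q n s + prodm m n s * q (shd t)) \<partial>S \<partial>S)"
    by (intro nn_integral_cong nn_integral_shd[symmetric]) measurable
  also have "\<dots> = (\<integral>\<^sup>+s. \<integral>\<^sup>+t. F (prodm m (Suc n) (stake n s @- t), bsum m q (Suc n) (stake n s @- t)) \<partial>S \<partial>S)"
    by (simp add: prodm_Suc bsum_Suc prodm_stake_shift bsum_stake_shift snth_stake_shift mult.commute)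
  also have "\<dots> = (\<integral>\<^sup>+s. F (prodm m (Suc n) s, bsum m q (Suc n) s) \<partial>S)"
    by (rule nn_integral_stream_split[symmetric]) measurable
  finally show ?case .
qed simp

lemma emeasure_reversal:
  assumes [measurable]: "Measurable.pred (borel \<Otimes>\<^sub>M borel) R"
  shows "emeasure S {s. R (prodm m n s, chain m q 0 n s)} = emeasure S {s. R (prodm m n s, bsum m q n s)}"
proof -
  have "{x. R x} \<in> sets (borel \<Otimes>\<^sub>M borel)"
    using assms unfolding pred_def by (simp add: space_pair_measure)
  then have eq: "(\<integral>\<^sup>+s. indicator {x. R x} (prodm m n s, chain m q 0 n s) \<partial>S) =
      (\<integral>\<^sup>+s. indicator {x. R x} (prodm m n s, bsum m q n s) \<partial>S)"
    by (intro nn_integral_reversal) auto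
  have "emeasure S {s. R (f s)} = (\<integral>\<^sup>+s. indicator {x. R x} (f s) \<partial>S)"
    if [measurable]: "f \<in> measurable S (borel \<Otimes>\<^sub>M borel)" for f
  proof -
    have "(\<integral>\<^sup>+s. indicator {x. R x} (f s) \<partial>S) = (\<integral>\<^sup>+s. indicator {s. R (f s)} s \<partial>S)"
      by (simp add: indicator_def)
    then show ?thesis by simp
  qed
  from this[of "\<lambda>s. (prodm m n s, chain m q 0 n s)"] this[of "\<lambda>s. (prodm m n s, bsum m q n s)"] eq
  show ?thesis by simp
qed

section \<open>The Green function bound\<close>

text \<open>When \<^term>\<open>1 \<le> prodm m n s\<close>, the increment of the sums over the next \<open>N\<close> steps is at least
  the sum over these steps for a fresh stream, hence exceeds \<open>R\<close> with a fixed probability. The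
  events that the level \<open>R\<close> is crossed between \<open>n\<close> and \<open>n + N\<close> overlap at most \<open>N\<close> times.\<close>
lemma green_bound_finite:
  assumes pos: "emeasure S {s. R < bsum m q N s} \<noteq> 0"
  shows "(\<Sum>n. emeasure S {s. bsum m q n s \<le> R \<and> 1 \<le> prodm m n s}) < \<infinity>"
proof -
  let ?d = "emeasure S {s. R < bsum m q N s}"
  let ?a = "\<lambda>n. emeasure S {s. bsum m q n s \<le> R \<and> 1 \<le> prodm m n s}"
  have step: "?d * ?a n \<le> emeasure S {s. bsum m q n s \<le> R \<and> R < bsum m q (n + N) s}" for n
  proof -
    have "?d * ?a n = (\<integral>\<^sup>+s. indicator {s. bsum m q n s \<le> R \<and> 1 \<le> prodm m n s} s * ?d \<partial>S)"
      by (subst nn_integral_multc) (auto simp: mult.commute)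
    also have "\<dots> = (\<integral>\<^sup>+s. \<integral>\<^sup>+t. indicator {s. bsum m q n s \<le> R \<and> 1 \<le> prodm m n s} s *
         indicator {s. R < bsum m q N s} t \<partial>S \<partial>S)"
      by (intro nn_integral_cong, subst nn_integral_cmult) auto
    also have "\<dots> \<le> (\<integral>\<^sup>+s. \<integral>\<^sup>+t. indicator {s. bsum m q n s \<le> R \<and> R < bsum m q (n + N) s} (stake n s @- t) \<partial>S \<partial>S)"
    proof (intro nn_integral_mono)
      fix s t
      have "R < bsum m q n s + prodm m n s * bsum m q N t"
        if "1 \<le> prodm m n s" "R < bsum m q N t"
      proof -
        have "bsum m q N t \<le> prodm m n s * bsum m q N t"
          using that(1) bsum_nonneg[of N t] by (simp add: mult_le_cancel_right1)
        then show ?thesis using that(2) bsum_nonneg[of n s] by linarith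
      qed
      then show "(indicator {s. bsum m q n s \<le> R \<and> 1 \<le> prodm m n s} s * indicator {s. R < bsum m q N s} t :: ennreal)
        \<le> indicator {s. bsum m q n s \<le> R \<and> R < bsum m q (n + N) s} (stake n s @- t)"
        by (auto simp: indicator_def bsum_add bsum_stake_shift prodm_stake_shift)
    qed
    also have "\<dots> = (\<integral>\<^sup>+s. indicator {s. bsum m q n s \<le> R \<and> R < bsum m q (n + N) s} s \<partial>S)"
      by (rule nn_integral_stream_split[symmetric]) measurable
    finally show ?thesis by simp
  qed
  have count: "(\<Sum>n. indicator {s. bsum m q n s \<le> R \<and> R < bsum m q (n + N) s} s) \<le> (of_nat N :: ennreal)" for s
  proof (cases "\<exists>n. R < bsum m q n s")
    case True
    \<comment> \<open>Only the \<open>N\<close> indices just before the first crossing of the level can contribute.\<close>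
    define n0 where "n0 = (LEAST n. R < bsum m q n s)"
    have n0: "R < bsum m q n0 s" unfolding n0_def using True by (rule LeastI_ex)
    have n0': "n0 \<le> n" if "R < bsum m q n s" for n unfolding n0_def using that by (rule Least_le)
    let ?A = "{n0 - N..<n0}"
    have "indicator {s. bsum m q n s \<le> R \<and> R < bsum m q (n + N) s} s \<le> (indicator ?A n :: ennreal)" for n
      using n0'[of "n + N"] n0 bsum_mono[of n0 n s] by (fastforce simp: indicator_def)
    then have "(\<Sum>n. indicator {s. bsum m q n s \<le> R \<and> R < bsum m q (n + N) s} s) \<le> (\<Sum>n. indicator ?A n :: ennreal)"
      by (intro suminf_le) auto
    also have "\<dots> = (\<Sum>n\<in>?A. indicator ?A n)"
      by (rule suminf_finite) auto
    also have "\<dots> = of_nat (card ?A)" by simp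
    also have "\<dots> \<le> of_nat N" by (intro of_nat_mono) auto
    finally show ?thesis .
  next
    case False
    then show ?thesis by (simp add: indicator_def)
  qed
  have "?d * (\<Sum>n. ?a n) = (\<Sum>n. ?d * ?a n)" by simp
  also have "\<dots> \<le> (\<Sum>n. emeasure S {s. bsum m q n s \<le> R \<and> R < bsum m q (n + N) s})"
    by (intro suminf_le step) auto
  also have "\<dots> = (\<Sum>n. \<integral>\<^sup>+s. indicator {s. bsum m q n s \<le> R \<and> R < bsum m q (n + N) s} s \<partial>S)"
    by simp
  also have "\<dots> = (\<integral>\<^sup>+s. (\<Sum>n. indicator {s. bsum m q n s \<le> R \<and> R < bsum m q (n + N) s} s) \<partial>S)"
    by (rule nn_integral_suminf[symmetric]) measurable
  also have "\<dots> \<le> (\<integral>\<^sup>+s. of_nat N \<partial>S)"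
    by (intro nn_integral_mono count)
  also have "\<dots> = of_nat N" by (simp add: S.emeasure_space_1[simplified])
  finally have "?d * (\<Sum>n. ?a n) < \<infinity>" by (simp add: le_less_trans ennreal_of_nat_eq_real_of_nat)
  with pos show ?thesis by (auto simp: ennreal_mult_less_top)
qed

text \<open>A large product followed by one letter with \<open>q > e\<close> pushes the sum over any level.\<close>
lemma bsum_exceeds_with_positive_prob:
  assumes q: "emeasure \<mu> {p. 0 < q p} \<noteq> 0"
    and unb: "AE s in S. \<forall>j::nat. \<exists>n. real j < prodm m n s"
  shows "\<exists>N. emeasure S {s. R < bsum m q N s} \<noteq> 0"
proof -
  have sets_Collect_UN: "(\<Union>j. {p. 1 / real (Suc j) < q p}) \<in> sets \<mu>"
    by measurable
  have "\<exists>j::nat. emeasure \<mu> {p. 1 / real (Suc j) < q p} \<noteq> 0"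
  proof (rule ccontr)
    assume "\<not> ?thesis"
    then have "emeasure \<mu> (\<Union>j. {p. 1 / real (Suc j) < q p}) = 0"
      by (intro emeasure_UN_eq_0) auto
    moreover have "{p. 0 < q p} \<subseteq> (\<Union>j. {p. 1 / real (Suc j) < q p})"
      using nat_approx_posE by blast
    ultimately show False using q by (metis (no_types, lifting) emeasure_mono le_zero_eq sets_Collect_UN)
  qed
  then obtain j0 :: nat where j0: "emeasure \<mu> {p. 1 / real (Suc j0) < q p} \<noteq> 0" ..
  define e where "e = 1 / real (Suc j0)"
  have e: "e > 0" "emeasure \<mu> {p. e < q p} \<noteq> 0" using j0 by (simp_all add: e_def)
  define j where "j = nat \<lceil>\<bar>R\<bar> / e\<rceil>"
  have "\<bar>R\<bar> / e \<le> real j" unfolding j_def by (rule real_nat_ceiling_ge)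
  then have j: "R \<le> real j * e" using e by (simp add: field_simps)
  have "\<exists>n. emeasure S {s. real j < prodm m n s} \<noteq> 0"
  proof (rule ccontr)
    assume "\<not> ?thesis"
    then have "AE s in S. \<not> real j < prodm m n s" for n
      by (subst AE_iff_measurable[OF _ refl]) auto
    then have "AE s in S. \<forall>n. \<not> real j < prodm m n s" by (simp add: AE_all_countable)
    with unb have "AE s in S. False" by eventually_elim auto
    then show False by simp
  qed
  then obtain n where n: "emeasure S {s. real j < prodm m n s} \<noteq> 0" by blast
  have "emeasure S {s. real j < prodm m n s} * emeasure \<mu> {p. e < q p} =
    (\<integral>\<^sup>+s. indicator {s. real j < prodm m n s} s * emeasure \<mu> {p. e < q p} \<partial>S)"
    by (subst nn_integral_multc) (auto simp: mult.commute)
  also have "\<dots> = (\<integral>\<^sup>+s. \<integral>\<^sup>+p. indicator {s. real j < prodm m n s} s * indicator {p. e < q p} p \<partial>\<mu> \<partial>S)"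
    using space_UNIV by (intro nn_integral_cong, subst nn_integral_cmult) (auto)
  also have "\<dots> = (\<integral>\<^sup>+s. \<integral>\<^sup>+t. indicator {s. real j < prodm m n s} s * indicator {p. e < q p} (shd t) \<partial>S \<partial>S)"
    by (intro nn_integral_cong nn_integral_shd[symmetric]) measurable
  also have "\<dots> \<le> (\<integral>\<^sup>+s. \<integral>\<^sup>+t. indicator {s. R < bsum m q (Suc n) s} (stake n s @- t) \<partial>S \<partial>S)"
  proof (intro nn_integral_mono)
    fix s t
    let ?p = "shd t :: 'b"
    have "R < bsum m q n s + prodm m n s * q ?p" if "real j < prodm m n s" "e < q ?p"
    proof -
      have "real j * e < prodm m n s * q ?p" using that e by (intro mult_strict_mono) auto
      then show ?thesis using j bsum_nonneg[of n s] by linarith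
    qed
    then show "(indicator {s. real j < prodm m n s} s * indicator {p. e < q p} ?p :: ennreal) \<le>
      indicator {s. R < bsum m q (Suc n) s} (stake n s @- t)"
      by (auto simp: indicator_def bsum_Suc bsum_stake_shift prodm_stake_shift snth_stake_shift)
  qed
  also have "\<dots> = (\<integral>\<^sup>+s. indicator {s. R < bsum m q (Suc n) s} s \<partial>S)"
    by (rule nn_integral_stream_split[symmetric]) measurable
  finally show ?thesis using n e by (intro exI[of _ "Suc n"]) auto
qed

end

lemma card_Int_lessThan_unbounded:
  assumes "infinite (K :: nat set)"
  shows "\<exists>N. \<forall>n\<ge>N. j \<le> card (K \<inter> {..<n})"
proof -
  obtain T where T: "T \<subseteq> K" "finite T" "card T = j"
    using infinite_arbitrarily_large[OF assms] by blast
  obtain N where N: "T \<subseteq> {..<N}"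
    using \<open>finite T\<close> by (metis finite_nat_iff_bounded)
  have "j \<le> card (K \<inter> {..<n})" if "n \<ge> N" for n
  proof -
    have "T \<subseteq> K \<inter> {..<n}" using T N that by auto
    then show ?thesis using T card_mono[of "K \<inter> {..<n}" T] by auto
  qed
  then show ?thesis by blast
qed

context affine_stream
begin

text \<open>If the sums stayed below \<open>R\<close>, the infinitely many times with product at least 1 would contradict
  the Green function bound.\<close>
lemma AE_bsum_unbounded:
  assumes q: "emeasure \<mu> {p. 0 < q p} \<noteq> 0"
    and unb: "AE s in S. \<forall>j::nat. \<exists>n. real j < prodm m n s"
  shows "AE s in S. \<forall>R::nat. \<exists>n. real R < bsum m q n s"
  unfolding AE_all_countable
proof
  fix R :: nat
  let ?I = "\<lambda>n. indicator {s. bsum m q n s \<le> real R \<and> 1 \<le> prodm m n s} :: _ \<Rightarrow> ennreal"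
  obtain N where "emeasure S {s. real R < bsum m q N s} \<noteq> 0"
    using bsum_exceeds_with_positive_prob[OF q unb] by blast
  then have "(\<Sum>n. emeasure S {s. bsum m q n s \<le> real R \<and> 1 \<le> prodm m n s}) < \<infinity>"
    by (rule green_bound_finite)
  also have "(\<Sum>n. emeasure S {s. bsum m q n s \<le> real R \<and> 1 \<le> prodm m n s}) = (\<integral>\<^sup>+s. (\<Sum>n. ?I n s) \<partial>S)"
    by (subst nn_integral_suminf) auto
  finally have "AE s in S. (\<Sum>n. ?I n s) \<noteq> \<infinity>"
    by (intro nn_integral_noteq_infinite) auto
  with unb show "AE s in S. \<exists>n. real R < bsum m q n s"
  proof eventually_elim
    case (elim s)
    show ?case
    proof (rule ccontr)
      assume "\<not> ?case"
      then have I: "?I n s = indicator {n. 1 \<le> prodm m n s} n" for n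
        by (auto simp: indicator_def not_less)
      have "infinite {n. 1 \<le> prodm m n s}"
      proof
        assume "finite {n. 1 \<le> prodm m n s}"
        then have fin: "finite ((\<lambda>n. prodm m n s) ` {n. 1 \<le> prodm m n s})" by simp
        define j where "j = nat \<lceil>Max (insert 1 ((\<lambda>n. prodm m n s) ` {n. 1 \<le> prodm m n s}))\<rceil>"
        have "x \<le> real j" if "x \<in> insert 1 ((\<lambda>n. prodm m n s) ` {n. 1 \<le> prodm m n s})" for x
          using Max_ge[OF finite.insertI[OF fin] that] real_nat_ceiling_ge unfolding j_def by (rule order_trans)
        moreover obtain n where "real j < prodm m n s" using elim by blast
        ultimately show False
          by (metis (mono_tags, lifting) image_eqI insertCI linorder_not_less mem_Collect_eq order_less_imp_le order_trans)
      qed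
      then have "(\<Sum>n. indicator {n. 1 \<le> prodm m n s} n :: ennreal) = \<infinity>"
        using nn_integral_count_space_nat[of "indicator {n. 1 \<le> prodm m n s}"]
        by (simp add: emeasure_count_space)
      then show False using elim(2) unfolding I by simp
    qed
  qed
qed

lemma emeasure_bsum_le_tendsto:
  assumes q: "emeasure \<mu> {p. 0 < q p} \<noteq> 0"
    and unb: "AE s in S. \<forall>j::nat. \<exists>n. real j < prodm m n s"
  shows "(\<lambda>n. emeasure S {s. bsum m q n s \<le> R}) \<longlonglongrightarrow> 0"
proof -
  have "(\<lambda>n. emeasure S {s. bsum m q n s \<le> R}) \<longlonglongrightarrow> emeasure S (\<Inter>n. {s. bsum m q n s \<le> R})"
    using bsum_mono by (intro Lim_emeasure_decseq) (auto simp: decseq_def intro: order_trans)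
  also have "emeasure S (\<Inter>n. {s. bsum m q n s \<le> R}) = 0"
  proof -
    have "AE s in S. \<not> (\<forall>n. bsum m q n s \<le> R)"
      using AE_bsum_unbounded[OF q unb]
    proof eventually_elim
      case (elim s)
      then obtain n where "real (nat \<lceil>R\<rceil>) < bsum m q n s" by blast
      then show ?case using real_nat_ceiling_ge[of R] by (meson le_less_trans not_less)
    qed
    then have "emeasure S {s. \<forall>n. bsum m q n s \<le> R} = 0"
      by (subst (asm) AE_iff_measurable[OF _ refl]) auto
    also have "{s. \<forall>n. bsum m q n s \<le> R} = (\<Inter>n. {s. bsum m q n s \<le> R})" by auto
    finally show ?thesis .
  qed
  finally show ?thesis .
qed

section \<open>Invariant measures and Hopf's maximal inequality\<close>

definition invariant :: "real measure \<Rightarrow> bool" where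
  "invariant \<nu> \<longleftrightarrow> sets \<nu> = sets borel \<and>
    (\<forall>A\<in>sets borel. emeasure \<nu> A = (\<integral>\<^sup>+x. emeasure \<mu> {p. m p * x + q p \<in> A} \<partial>\<nu>))"

lemma invariant_nn_integral:
  assumes \<nu>: "invariant \<nu>" and [measurable]: "F \<in> borel_measurable borel"
  shows "(\<integral>\<^sup>+x. F x \<partial>\<nu>) = (\<integral>\<^sup>+x. \<integral>\<^sup>+p. F (m p * x + q p) \<partial>\<mu> \<partial>\<nu>)"
proof -
  have [measurable_cong, simp]: "sets \<nu> = sets borel" and
    inv: "\<And>A. A \<in> sets borel \<Longrightarrow> emeasure \<nu> A = (\<integral>\<^sup>+x. emeasure \<mu> {p. m p * x + q p \<in> A} \<partial>\<nu>)"
    using \<nu> by (auto simp: invariant_def)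
  have step: "(\<lambda>(x, p). m p * x + q p) \<in> borel_measurable (\<nu> \<Otimes>\<^sub>M \<mu>)" by measurable
  have "\<nu> = distr (\<nu> \<Otimes>\<^sub>M \<mu>) borel (\<lambda>(x, p). m p * x + q p)"
  proof (rule measure_eqI)
    fix A assume "A \<in> sets \<nu>"
    then have [measurable]: "A \<in> sets borel" by simp
    have "emeasure (distr (\<nu> \<Otimes>\<^sub>M \<mu>) borel (\<lambda>(x, p). m p * x + q p)) A =
       (\<integral>\<^sup>+x. emeasure \<mu> (Pair x -` ((\<lambda>(x, p). m p * x + q p) -` A \<inter> space (\<nu> \<Otimes>\<^sub>M \<mu>))) \<partial>\<nu>)"
      by (subst emeasure_distr, measurable)
        (rule emeasure_pair_measure_alt, rule measurable_sets[OF step \<open>A \<in> sets borel\<close>])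
    also have "\<dots> = emeasure \<nu> A"
      unfolding inv[OF \<open>A \<in> sets borel\<close>]
      by (intro nn_integral_cong arg_cong[where f="emeasure \<mu>"]) (auto simp: space_pair_measure space_UNIV)
    finally show "emeasure \<nu> A = emeasure (distr (\<nu> \<Otimes>\<^sub>M \<mu>) borel (\<lambda>(x, p). m p * x + q p)) A" ..
  qed simp
  then have "(\<integral>\<^sup>+x. F x \<partial>\<nu>) = (\<integral>\<^sup>+x. F x \<partial>distr (\<nu> \<Otimes>\<^sub>M \<mu>) borel (\<lambda>(x, p). m p * x + q p))"
    by simp
  also have "\<dots> = (\<integral>\<^sup>+z. F (case z of (x, p) \<Rightarrow> m p * x + q p) \<partial>(\<nu> \<Otimes>\<^sub>M \<mu>))"
    by (subst nn_integral_distr) auto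
  also have "\<dots> = (\<integral>\<^sup>+x. \<integral>\<^sup>+p. F (m p * x + q p) \<partial>\<mu> \<partial>\<nu>)"
    by (subst nn_integral_fst[symmetric]) auto
  finally show ?thesis .
qed

text \<open>The product of an invariant measure with the stream space is preserved by the skew shift, which
  consumes one letter and moves the starting point accordingly.\<close>
lemma invariant_shift:
  assumes \<nu>: "invariant \<nu>" and [measurable]: "(\<lambda>(x, s). H x s) \<in> borel_measurable (borel \<Otimes>\<^sub>M S)"
  shows "(\<integral>\<^sup>+x. \<integral>\<^sup>+s. H (m (shd s) * x + q (shd s)) (stl s) \<partial>S \<partial>\<nu>) = (\<integral>\<^sup>+x. \<integral>\<^sup>+s. H x s \<partial>S \<partial>\<nu>)"
proof -
  have "(\<integral>\<^sup>+s. H (m (shd s) * x + q (shd s)) (stl s) \<partial>S) = (\<integral>\<^sup>+p. \<integral>\<^sup>+s. H (m p * x + q p) s \<partial>S \<partial>\<mu>)" for x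
  proof -
    have "(\<integral>\<^sup>+s. H (m (shd s) * x + q (shd s)) (stl s) \<partial>S) =
      (\<integral>\<^sup>+p. \<integral>\<^sup>+s. H (m (shd (p ## s)) * x + q (shd (p ## s))) (stl (p ## s)) \<partial>S \<partial>\<mu>)"
      by (rule nn_integral_stream_space) measurable
    then show ?thesis by simp
  qed
  then show ?thesis
    by (subst invariant_nn_integral[OF \<nu>, of "\<lambda>x. \<integral>\<^sup>+s. H x s \<partial>S"]) auto
qed

text \<open>Hopf's maximal function \<open>max 0 (max\<^bsub>n \<le> N\<^esub> \<Sum>k<n. h (X\<^sub>k))\<close>, defined by the recursion on which the
  proof of the maximal inequality rests.\<close>
fun maxsum :: "(real \<Rightarrow> real) \<Rightarrow> nat \<Rightarrow> real \<Rightarrow> 'b stream \<Rightarrow> real" where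
  "maxsum h 0 x s = 0"
| "maxsum h (Suc N) x s = max 0 (h x + maxsum h N (m (shd s) * x + q (shd s)) (stl s))"

lemma maxsum_nonneg: "0 \<le> maxsum h N x s"
  by (cases N) auto

lemma maxsum_mono: "maxsum h N x s \<le> maxsum h (Suc N) x s"
proof (induction N arbitrary: x s)
  case (Suc N)
  show ?case
    using Suc.IH[of "m (shd s) * x + q (shd s)" "stl s"]
    by (subst (1 2) maxsum.simps(2)) (intro max.mono add_left_mono order_refl)
qed simp

lemma sum_le_maxsum:
  "n \<le> N \<Longrightarrow> (\<Sum>k<n. h (chain m q x k s)) \<le> maxsum h N x s"
proof (induction N arbitrary: n x s)
  case (Suc N)
  show ?case
  proof (cases n)
    case (Suc n')
    have "(\<Sum>k<n. h (chain m q x k s)) = h x + (\<Sum>k<n'. h (chain m q (m (shd s) * x + q (shd s)) k (stl s)))"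
      unfolding Suc by (subst sum.lessThan_Suc_shift) (simp add: chain_Suc_stl del: chain.simps(2))
    also have "\<dots> \<le> h x + maxsum h N (m (shd s) * x + q (shd s)) (stl s)"
      using Suc.IH[of n'] Suc.prems Suc by (intro add_left_mono) auto
    finally show ?thesis by simp
  qed (simp add: maxsum_nonneg)
qed simp

lemma measurable_maxsum [measurable (raw)]:
  assumes [measurable]: "h \<in> borel_measurable borel" "f \<in> borel_measurable N" "g \<in> measurable N S"
  shows "(\<lambda>w. maxsum h n (f w) (g w)) \<in> borel_measurable N"
  using assms(2,3)
proof (induction n arbitrary: f g)
  case (Suc n)
  note [measurable] = Suc.prems
  have "(\<lambda>w. maxsum h n (m (shd (g w)) * f w + q (shd (g w))) (stl (g w))) \<in> borel_measurable N"
    by (rule Suc.IH) measurable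
  then show ?case by simp
qed simp

text \<open>Where \<open>G\<^sub>N > 0\<close>, the recursion gives \<open>G\<^sub>N + f \<le> g + G\<^sub>N \<circ> T\<close> for the skew shift \<open>T\<close>; elsewhere \<open>G\<^sub>N = 0\<close>.
  Integrating and cancelling the finite integral of \<open>G\<^sub>N\<close> leaves \<open>\<nu>(f; G\<^sub>N > 0) \<le> \<nu>(g)\<close>, and by
  hypothesis the sets \<open>G\<^sub>N > 0\<close> exhaust the whole space.\<close>
lemma hopf_comparison:
  assumes \<nu>: "invariant \<nu>"
    and [measurable]: "f \<in> borel_measurable borel" "g \<in> borel_measurable borel"
    and nonneg: "\<And>x. 0 \<le> f x" "\<And>x. 0 \<le> g x"
    and fin: "(\<integral>\<^sup>+x. ennreal (g x) \<partial>\<nu>) < \<infinity>"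
    and ex: "AE x in \<nu>. AE s in S. \<exists>n. (\<Sum>k<n. f (chain m q x k s)) < (\<Sum>k<n. g (chain m q x k s))"
  shows "(\<integral>\<^sup>+x. ennreal (f x) \<partial>\<nu>) \<le> (\<integral>\<^sup>+x. ennreal (g x) \<partial>\<nu>)"
proof -
  have [measurable_cong, simp]: "sets \<nu> = sets borel" using \<nu> by (simp add: invariant_def)
  define h where "h x = g x - f x" for x
  have [measurable]: "h \<in> borel_measurable borel" unfolding h_def by measurable
  define G where "G N x s = maxsum h N x s" for N x s
  have [measurable]: "(\<lambda>(x, s). G N x s) \<in> borel_measurable (borel \<Otimes>\<^sub>M S)" for N
    unfolding G_def by measurable
  define I where "I N = (\<integral>\<^sup>+x. \<integral>\<^sup>+s. ennreal (G N x s) \<partial>S \<partial>\<nu>)" for N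
  let ?T = "\<lambda>x s. m (shd s) * x + q (shd s)"
  have I_shift: "(\<integral>\<^sup>+x. \<integral>\<^sup>+s. ennreal (G N (?T x s) (stl s)) \<partial>S \<partial>\<nu>) = I N" for N
    unfolding I_def by (rule invariant_shift[OF \<nu>, of "\<lambda>x s. ennreal (G N x s)"]) measurable
  have I_le: "(\<integral>\<^sup>+x. \<integral>\<^sup>+s. ennreal (g x) + ennreal (G N (?T x s) (stl s)) \<partial>S \<partial>\<nu>) =
      (\<integral>\<^sup>+x. ennreal (g x) \<partial>\<nu>) + I N" for N
  proof -
    have "(\<integral>\<^sup>+x. \<integral>\<^sup>+s. ennreal (g x) + ennreal (G N (?T x s) (stl s)) \<partial>S \<partial>\<nu>) =
      (\<integral>\<^sup>+x. ennreal (g x) + (\<integral>\<^sup>+s. ennreal (G N (?T x s) (stl s)) \<partial>S) \<partial>\<nu>)"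
      using S.emeasure_space_1 by (intro nn_integral_cong) (subst nn_integral_add, auto)
    also have "\<dots> = (\<integral>\<^sup>+x. ennreal (g x) \<partial>\<nu>) + I N"
      by (subst nn_integral_add) (auto simp: I_shift)
    finally show ?thesis .
  qed
  have I_fin: "I N < \<infinity>" for N
  proof (induction N)
    case (Suc N)
    have "I (Suc N) \<le> (\<integral>\<^sup>+x. \<integral>\<^sup>+s. ennreal (g x) + ennreal (G N (?T x s) (stl s)) \<partial>S \<partial>\<nu>)"
      unfolding I_def
    proof (intro nn_integral_mono)
      fix x s
      have "G (Suc N) x s \<le> g x + G N (?T x s) (stl s)"
        using nonneg[of x] maxsum_nonneg[of h N "?T x s" "stl s"] by (simp add: G_def h_def)
      then show "ennreal (G (Suc N) x s) \<le> ennreal (g x) + ennreal (G N (?T x s) (stl s))"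
        using nonneg[of x] maxsum_nonneg[of h N "?T x s" "stl s"]
        by (subst ennreal_plus[symmetric], simp, simp add: G_def) (rule ennreal_leI)
    qed
    also have "\<dots> < \<infinity>" using Suc fin unfolding I_le by simp
    finally show ?case .
  qed (simp add: I_def G_def)
  have key: "(\<integral>\<^sup>+x. \<integral>\<^sup>+s. ennreal (f x) * indicator {s. 0 < G N x s} s \<partial>S \<partial>\<nu>) \<le> (\<integral>\<^sup>+x. ennreal (g x) \<partial>\<nu>)" for N
  proof -
    let ?L = "\<integral>\<^sup>+x. \<integral>\<^sup>+s. ennreal (f x) * indicator {s. 0 < G N x s} s \<partial>S \<partial>\<nu>"
    have "I N + ?L = (\<integral>\<^sup>+x. \<integral>\<^sup>+s. ennreal (G N x s) + ennreal (f x) * indicator {s. 0 < G N x s} s \<partial>S \<partial>\<nu>)"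
      unfolding I_def by (subst nn_integral_add[symmetric]) (auto intro!: nn_integral_cong nn_integral_add[symmetric])
    also have "\<dots> \<le> (\<integral>\<^sup>+x. \<integral>\<^sup>+s. ennreal (g x) + ennreal (G N (?T x s) (stl s)) \<partial>S \<partial>\<nu>)"
    proof (intro nn_integral_mono)
      fix x s
      show "ennreal (G N x s) + ennreal (f x) * indicator {s. 0 < G N x s} s
        \<le> ennreal (g x) + ennreal (G N (?T x s) (stl s))"
      proof (cases "0 < G N x s")
        case True
        then obtain N' where N: "N = Suc N'" by (cases N) (auto simp: G_def)
        have "G N x s = g x - f x + G N' (?T x s) (stl s)" using True by (auto simp: G_def N h_def)
        also have "G N' (?T x s) (stl s) \<le> G N (?T x s) (stl s)"
          unfolding G_def N by (rule maxsum_mono)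
        finally have "G N x s + f x \<le> g x + G N (?T x s) (stl s)" by simp
        then show ?thesis using True nonneg[of x] maxsum_nonneg[of h N "?T x s" "stl s"]
          by (simp add: G_def ennreal_plus[symmetric] ennreal_leI del: ennreal_plus)
      next
        case False
        then have "G N x s = 0" using maxsum_nonneg[of h N x s] by (auto simp: G_def)
        then show ?thesis by simp
      qed
    qed
    also have "\<dots> = (\<integral>\<^sup>+x. ennreal (g x) \<partial>\<nu>) + I N" by (rule I_le)
    finally have "I N + ?L \<le> I N + (\<integral>\<^sup>+x. ennreal (g x) \<partial>\<nu>)" by (simp add: add.commute)
    then show ?thesis using I_fin[of N] by (auto simp: ennreal_add_left_cancel_le)
  qed
  have "(\<integral>\<^sup>+x. ennreal (f x) \<partial>\<nu>) \<le>
    (\<integral>\<^sup>+x. (SUP N. \<integral>\<^sup>+s. ennreal (f x) * indicator {s. 0 < G N x s} s \<partial>S) \<partial>\<nu>)"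
  proof (rule nn_integral_mono_AE)
    show "AE x in \<nu>. ennreal (f x) \<le> (SUP N. \<integral>\<^sup>+s. ennreal (f x) * indicator {s. 0 < G N x s} s \<partial>S)"
      using ex
    proof eventually_elim
      case (elim x)
      have "ennreal (f x) = (\<integral>\<^sup>+s. ennreal (f x) \<partial>S)" using S.emeasure_space_1 by simp
      also have "\<dots> \<le> (\<integral>\<^sup>+s. (SUP N. ennreal (f x) * indicator {s. 0 < G N x s} s) \<partial>S)"
      proof (rule nn_integral_mono_AE)
        show "AE s in S. ennreal (f x) \<le> (SUP N. ennreal (f x) * indicator {s. 0 < G N x s} s)"
          using elim
        proof eventually_elim
          case (elim s)
          then obtain n where "(\<Sum>k<n. f (chain m q x k s)) < (\<Sum>k<n. g (chain m q x k s))" by blast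
          then have "0 < (\<Sum>k<n. h (chain m q x k s))" by (simp add: h_def sum_subtractf)
          also have "\<dots> \<le> G n x s" unfolding G_def by (rule sum_le_maxsum) simp
          finally show ?case by (intro SUP_upper2[of n]) auto
        qed
      qed
      also have "\<dots> = (SUP N. \<integral>\<^sup>+s. ennreal (f x) * indicator {s. 0 < G N x s} s \<partial>S)"
      proof (rule nn_integral_monotone_convergence_SUP)
        have "G N x s \<le> G (Suc N) x s" for N s unfolding G_def by (rule maxsum_mono)
        then show "incseq (\<lambda>N s. ennreal (f x) * indicator {s. 0 < G N x s} s)"
          by (intro incseq_SucI le_funI mult_left_mono) (auto simp: indicator_def intro: less_le_trans)
      qed measurable
      finally show ?case .
    qed
  qed
  also have "\<dots> = (SUP N. \<integral>\<^sup>+x. \<integral>\<^sup>+s. ennreal (f x) * indicator {s. 0 < G N x s} s \<partial>S \<partial>\<nu>)"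
  proof (rule nn_integral_monotone_convergence_SUP)
    have "G N x s \<le> G (Suc N) x s" for N x s unfolding G_def by (rule maxsum_mono)
    then show "incseq (\<lambda>N x. \<integral>\<^sup>+s. ennreal (f x) * indicator {s. 0 < G N x s} s \<partial>S)"
      by (intro incseq_SucI le_funI nn_integral_mono mult_left_mono) (auto simp: indicator_def intro: less_le_trans)
  qed measurable
  also have "\<dots> \<le> (\<integral>\<^sup>+x. ennreal (g x) \<partial>\<nu>)" by (intro SUP_least key)
  finally show ?thesis .
qed

end

section \<open>Local contraction\<close>

locale oscillating_affine_stream = affine_stream \<mu> m q
  for \<mu> :: "'b measure" and m q :: "'b \<Rightarrow> real" +
  assumes q_nontrivial: "emeasure \<mu> {p. 0 < q p} \<noteq> 0"
    and unbounded_above: "AE s in S. \<forall>j::nat. \<exists>n. real j < prodm m n s"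
    and unbounded_below: "AE s in S. \<forall>j::nat. \<exists>n. real j < prodm (\<lambda>p. 1 / m p) n s"
begin

sublocale dual: affine_stream \<mu> "\<lambda>p. 1 / m p" "\<lambda>p. q p / m p"
  using m_pos q_nonneg by unfold_locales (auto simp: space_UNIV intro: divide_nonneg_pos)

text \<open>The event on which contraction holds simultaneously for all starting points; with it
  no null set depends on a starting point that is itself chosen from the stream.\<close>
definition dual_divergent :: "'b stream \<Rightarrow> bool" where
  "dual_divergent s \<longleftrightarrow> (\<forall>R::nat. \<exists>n. real R < bsum (\<lambda>p. 1 / m p) (\<lambda>p. q p / m p) n s)"

lemma AE_dual_divergent: "AE s in S. dual_divergent s"
proof -
  have "{p. 0 < q p / m p} = {p. 0 < q p}"
    using m_pos by (auto simp: zero_less_divide_iff dest: less_asym)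
  then show ?thesis
    unfolding dual_divergent_def
    using q_nontrivial unbounded_below by (intro dual.AE_bsum_unbounded) simp_all
qed

text \<open>The product \<open>\<Pi>\<^sub>n = |X\<^sub>n| / |x + D\<^sub>n|\<close> has a bounded numerator and a diverging denominator.\<close>
lemma contraction:
  assumes s: "dual_divergent s" and \<eta>: "0 < \<eta>"
  shows "\<exists>n0. \<forall>n\<ge>n0. \<bar>chain m q x n s\<bar> \<le> R \<longrightarrow> \<bar>chain m q x n s - chain m q y n s\<bar> \<le> \<eta>"
proof -
  let ?b = "\<lambda>n. bsum (\<lambda>p. 1 / m p) (\<lambda>p. q p / m p) n s"
  \<comment> \<open>A bound \<open>|X| \<le> R\<close> and \<open>x + D \<ge> C + 1\<close> together make the distance at most \<open>\<eta>\<close>.\<close>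
  define C where "C = \<bar>R\<bar> * \<bar>x - y\<bar> / \<eta>"
  obtain n0 where n0: "real (nat \<lceil>\<bar>x\<bar> + C + 1\<rceil>) < ?b n0" using s unfolding dual_divergent_def by blast
  then have n0: "\<bar>x\<bar> + C + 1 < ?b n0" using real_nat_ceiling_ge by (rule le_less_trans[rotated])
  have "\<bar>chain m q x n s - chain m q y n s\<bar> \<le> \<eta>" if "n \<ge> n0" "\<bar>chain m q x n s\<bar> \<le> R" for n
  proof -
    have "?b n0 \<le> ?b n" using dual.bsum_mono[OF that(1)] .
    then have b: "C + 1 < x + ?b n" using n0 by linarith
    have C: "0 \<le> C" using \<eta> by (simp add: C_def)
    have pos: "0 < prodm m n s" by (rule prodm_pos)
    have "prodm m n s * (C + 1) \<le> prodm m n s * (x + ?b n)" using b pos by simp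
    also have "\<dots> \<le> \<bar>R\<bar>" using that(2) chain_eq_prodm_bsum[of m q x n s] m_pos by simp
    finally have "prodm m n s * (C + 1) * \<bar>x - y\<bar> \<le> \<bar>R\<bar> * \<bar>x - y\<bar>" by (rule mult_right_mono) simp
    also have "\<dots> = C * \<eta>" using \<eta> by (simp add: C_def)
    also have "\<dots> \<le> (C + 1) * \<eta>" using \<eta> by simp
    finally have "(C + 1) * (prodm m n s * \<bar>x - y\<bar>) \<le> (C + 1) * \<eta>" by (simp add: mult_ac)
    then have "prodm m n s * \<bar>x - y\<bar> \<le> \<eta>" using C by simp
    moreover have "chain m q x n s - chain m q y n s = prodm m n s * (x - y)"
      using chain_affine[of m q x n s y] by simp
    ultimately show ?thesis using pos by (simp add: abs_mult)
  qed
  then show ?thesis by blast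
qed

lemma visits_transfer:
  assumes s: "dual_divergent s" and inf: "infinite {n. \<bar>chain m q x n s\<bar> \<le> R}"
  shows "infinite {n. \<bar>chain m q y n s\<bar> \<le> R + 1}"
proof -
  obtain n0 where n0: "\<And>n. n \<ge> n0 \<Longrightarrow> \<bar>chain m q x n s\<bar> \<le> R \<Longrightarrow> \<bar>chain m q x n s - chain m q y n s\<bar> \<le> 1"
    using contraction[OF s, of 1 x R y] by auto
  have "{n. \<bar>chain m q x n s\<bar> \<le> R} - {..<n0} \<subseteq> {n. \<bar>chain m q y n s\<bar> \<le> R + 1}"
  proof
    fix n assume "n \<in> {n. \<bar>chain m q x n s\<bar> \<le> R} - {..<n0}"
    then show "n \<in> {n. \<bar>chain m q y n s\<bar> \<le> R + 1}" using n0[of n] by auto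
  qed
  moreover have "infinite ({n. \<bar>chain m q x n s\<bar> \<le> R} - {..<n0})"
    using inf by (simp add: Diff_infinite_finite)
  ultimately show ?thesis by (rule infinite_super)
qed

text \<open>All affine maps are invertible, so the chain that starts at \<open>0\<close> after dropping \<open>j\<close> letters is the
  chain of the whole stream from a suitable starting point \<open>y\<close>, to which contraction carries the
  visits over. Hence the hereditary zero-one law applies.\<close>
lemma AE_visits_from_zero:
  assumes "\<not> (AE s in S. \<not> infinite {n. \<bar>chain m q x n s\<bar> \<le> R})"
  shows "AE s in S. infinite {n. \<bar>chain m q 0 n s\<bar> \<le> R + 1}"
proof (rule stream_zero_one_hereditary)
  show "AE s in S. infinite {n. \<bar>chain m q x n s\<bar> \<le> R} \<longrightarrow>
      (\<forall>j. infinite {n. \<bar>chain m q 0 n (sdrop j s)\<bar> \<le> R + 1})"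
    using AE_dual_divergent
  proof eventually_elim
    case (elim s)
    show ?case
    proof (intro impI allI)
      fix j assume "infinite {n. \<bar>chain m q x n s\<bar> \<le> R}"
      define y where "y = - chain m q 0 j s / prodm m j s"
      have y: "chain m q y j s = 0"
        using chain_affine[of m q y j s 0] prodm_pos[of j s] by (simp add: y_def)
      have "infinite {n. \<bar>chain m q y n s\<bar> \<le> R + 1}" by (rule visits_transfer) fact+
      then have "infinite ({n. \<bar>chain m q y n s\<bar> \<le> R + 1} - {..<j})" by (simp add: Diff_infinite_finite)
      moreover have "{n. \<bar>chain m q y n s\<bar> \<le> R + 1} - {..<j} \<subseteq> (\<lambda>k. j + k) ` {k. \<bar>chain m q 0 k (sdrop j s)\<bar> \<le> R + 1}"
      proof
        fix n assume n: "n \<in> {n. \<bar>chain m q y n s\<bar> \<le> R + 1} - {..<j}"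
        then have "n = j + (n - j)" by simp
        moreover from this have "chain m q y n s = chain m q 0 (n - j) (sdrop j s)"
          using chain_add[of m q y j "n - j" s] y by simp
        ultimately show "n \<in> (\<lambda>k. j + k) ` {k. \<bar>chain m q 0 k (sdrop j s)\<bar> \<le> R + 1}" using n by auto
      qed
      ultimately show "infinite {k. \<bar>chain m q 0 k (sdrop j s)\<bar> \<le> R + 1}"
        using finite_surj by blast
    qed
  qed
  show "Measurable.pred S (\<lambda>s. infinite {n. \<bar>chain m q 0 n s\<bar> \<le> R + 1})"
    unfolding infinite_nat_iff_unbounded mem_Collect_eq by measurable
qed (fact assms)

section \<open>Comparing integrals along the chain\<close>

definition radon :: "real measure \<Rightarrow> bool" where
  "radon \<nu> \<longleftrightarrow> (\<forall>r. emeasure \<nu> {-r..r} < \<infinity>)"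

text \<open>The test functions: nonnegative and Lipschitz with support in \<open>[-r, r]\<close>. The Lipschitz bound is
  what turns contraction into closeness of the sums along two chains.\<close>
definition bump :: "real \<Rightarrow> (real \<Rightarrow> real) \<Rightarrow> bool" where
  "bump r f \<longleftrightarrow> f \<in> borel_measurable borel \<and> (\<forall>x. 0 \<le> f x) \<and> (\<forall>x. r < \<bar>x\<bar> \<longrightarrow> f x = 0) \<and>
     (\<exists>L\<ge>0. \<forall>x y. \<bar>f x - f y\<bar> \<le> L * \<bar>x - y\<bar>)"

text \<open>The extra mass \<open>\<eta>\<close> on a large interval serves as a clock: by contraction, the sums of \<open>g - f\<close>
  along two chains differ, up to a constant, by at most \<open>\<eta>/2\<close> times the number of visits to the
  interval. The surplus of \<open>\<eta>\<close> per visit along the first chain is only half used up, and the number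
  of visits tends to infinity.\<close>
lemma sums_transfer:
  assumes s: "dual_divergent s" and rec: "infinite {n. \<bar>chain m q 0 n s\<bar> \<le> R}" and "0 \<le> R"
    and f: "bump r f" and g: "bump r g" and "0 \<le> r" and r': "r + 1 \<le> r'" "R + 1 \<le> r'" and \<eta>: "0 < \<eta>"
    and le: "\<And>n. (\<Sum>k<n. f (chain m q x k s) + \<eta> * indicator {-r'..r'} (chain m q x k s)) \<le> (\<Sum>k<n. g (chain m q x k s))"
  shows "\<exists>N. \<forall>n\<ge>N. real j \<le> (\<Sum>k<n. g (chain m q z k s) - f (chain m q z k s))"
proof -
  obtain Lf where Lf: "0 \<le> Lf" "\<And>x y. \<bar>f x - f y\<bar> \<le> Lf * \<bar>x - y\<bar>" using f unfolding bump_def by blast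
  obtain Lg where Lg: "0 \<le> Lg" "\<And>x y. \<bar>g x - g y\<bar> \<le> Lg * \<bar>x - y\<bar>" using g unfolding bump_def by blast
  define L where "L = Lf + Lg"
  define h where "h x = g x - f x" for x
  have h: "\<bar>h x - h y\<bar> \<le> L * \<bar>x - y\<bar>" for x y
  proof -
    have "\<bar>h x - h y\<bar> \<le> \<bar>f x - f y\<bar> + \<bar>g x - g y\<bar>" unfolding h_def by arith
    also have "\<dots> \<le> L * \<bar>x - y\<bar>" using Lf(2)[of x y] Lg(2)[of x y] by (simp add: L_def algebra_simps)
    finally show ?thesis .
  qed
  have h0: "h x = 0" if "r < \<bar>x\<bar>" for x using f g that by (simp add: h_def bump_def)
  have L: "0 \<le> L" using Lf Lg by (simp add: L_def)
  define \<eta>' where "\<eta>' = min 1 (\<eta> / (2 * (L + 1)))"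
  have \<eta>': "0 < \<eta>'" "\<eta>' \<le> 1" "L * \<eta>' \<le> \<eta> / 2"
  proof -
    show "0 < \<eta>'" "\<eta>' \<le> 1" using L \<eta> by (auto simp: \<eta>'_def)
    have "L * \<eta>' \<le> (L + 1) * (\<eta> / (2 * (L + 1)))" using L \<eta> by (intro mult_mono) (auto simp: \<eta>'_def)
    also have "\<dots> = \<eta> / 2" using L by (simp add: field_simps)
    finally show "L * \<eta>' \<le> \<eta> / 2" .
  qed
  let ?X = "\<lambda>k. chain m q x k s" and ?Z = "\<lambda>k. chain m q z k s"
  let ?\<psi> = "indicator {-r'..r'} :: real \<Rightarrow> real"
  obtain n1 where n1: "\<And>n. n \<ge> n1 \<Longrightarrow> \<bar>?X n\<bar> \<le> r + 1 \<Longrightarrow> \<bar>?X n - ?Z n\<bar> \<le> \<eta>'"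
    using contraction[OF s \<eta>'(1)] by blast
  obtain n2 where n2: "\<And>n. n \<ge> n2 \<Longrightarrow> \<bar>?Z n\<bar> \<le> r \<Longrightarrow> \<bar>?Z n - ?X n\<bar> \<le> \<eta>'"
    using contraction[OF s \<eta>'(1)] by blast
  define n0 where "n0 = max n1 n2"
  have near: "h (?X k) - \<eta> / 2 * ?\<psi> (?X k) \<le> h (?Z k)" if "k \<ge> n0" for k
  proof (cases "\<bar>?X k\<bar> \<le> r + 1")
    case True
    have "\<bar>h (?X k) - h (?Z k)\<bar> \<le> L * \<eta>'"
      using h[of "?X k" "?Z k"] n1[of k] True that L unfolding n0_def
      by (meson max.bounded_iff mult_left_mono order_trans)
    moreover have "?\<psi> (?X k) = 1" using True r' by (auto simp: indicator_def)
    ultimately show ?thesis using \<eta>'(3) by auto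
  next
    case False
    then have "\<not> \<bar>?Z k\<bar> \<le> r" using n2[of k] that \<eta>'(2) unfolding n0_def by auto
    then have "h (?Z k) = 0" "h (?X k) = 0" using False by (auto intro: h0)
    then show ?thesis using \<eta> by (simp add: indicator_def)
  qed
  \<comment> \<open>Accounts for the steps before the two chains have come close.\<close>
  define C where "C = (\<Sum>k<n0. \<bar>h (?X k)\<bar> + \<bar>h (?Z k)\<bar>)"
  have C: "0 \<le> C" unfolding C_def by (intro sum_nonneg) auto
  have lower: "(\<Sum>k<n. h (?X k)) - \<eta> / 2 * (\<Sum>k<n. ?\<psi> (?X k)) - C \<le> (\<Sum>k<n. h (?Z k))" for n
  proof -
    have "(\<Sum>k<n. h (?X k) - \<eta> / 2 * ?\<psi> (?X k) - (if k < n0 then \<bar>h (?X k)\<bar> + \<bar>h (?Z k)\<bar> else 0)) \<le> (\<Sum>k<n. h (?Z k))"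
    proof (rule sum_mono)
      fix k
      have "0 \<le> \<eta> / 2 * ?\<psi> (?X k)" using \<eta> by simp
      then show "h (?X k) - \<eta> / 2 * ?\<psi> (?X k) - (if k < n0 then \<bar>h (?X k)\<bar> + \<bar>h (?Z k)\<bar> else 0) \<le> h (?Z k)"
        using near[of k] by (auto split: if_splits)
    qed
    moreover have "(\<Sum>k<n. if k < n0 then \<bar>h (?X k)\<bar> + \<bar>h (?Z k)\<bar> else 0) \<le> C"
      unfolding C_def sum.If_cases[OF finite_lessThan] by (auto intro!: sum_mono2)
    ultimately show ?thesis by (simp add: sum_subtractf sum_distrib_left)
  qed
  have upper: "\<eta> * (\<Sum>k<n. ?\<psi> (?X k)) \<le> (\<Sum>k<n. h (?X k))" for n
    using le[of n] by (simp add: sum.distrib sum_distrib_left h_def sum_subtractf)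
  have "infinite {n. \<bar>?X n\<bar> \<le> R + 1}" using visits_transfer[OF s rec] .
  then have inf: "infinite {n. ?X n \<in> {-r'..r'}}" by (rule infinite_super[rotated]) (use r' in auto)
  define i where "i = nat \<lceil>(real j + C) * 2 / \<eta>\<rceil>"
  have i: "(real j + C) \<le> \<eta> / 2 * real i"
  proof -
    have "(real j + C) * 2 / \<eta> \<le> real i" unfolding i_def by (rule real_nat_ceiling_ge)
    then show ?thesis using \<eta> by (simp add: field_simps)
  qed
  obtain N where N: "\<And>n. n \<ge> N \<Longrightarrow> i \<le> card ({n. ?X n \<in> {-r'..r'}} \<inter> {..<n})"
    using card_Int_lessThan_unbounded[OF inf] by blast
  have "real j \<le> (\<Sum>k<n. h (?Z k))" if "n \<ge> N" for n
  proof -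
    have "(\<Sum>k<n. ?\<psi> (?X k)) = real (card ({n. ?X n \<in> {-r'..r'}} \<inter> {..<n}))"
      by (simp add: indicator_def sum.If_cases Int_commute)
    then have "real i \<le> (\<Sum>k<n. ?\<psi> (?X k))" using N[OF that] by simp
    then have "\<eta> / 2 * real i \<le> \<eta> / 2 * (\<Sum>k<n. ?\<psi> (?X k))" using \<eta> by (intro mult_left_mono) auto
    then show ?thesis using lower[of n] upper[of n] i by linarith
  qed
  then show ?thesis unfolding h_def by blast
qed

text \<open>As \<open>\<nu>(f + \<eta> \<psi>) < \<nu>(g)\<close> for small \<open>\<eta>\<close> and the indicator \<open>\<psi>\<close> of a large interval, Hopf's inequality
  provides a starting point \<open>x\<close> from which, with positive probability, no partial sum of
  \<open>f + \<eta> \<psi>\<close> exceeds that of \<open>g\<close>. On this event contraction gives divergence from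
  every starting point and after every shift, so the hereditary zero-one law makes it almost sure.\<close>
lemma sums_diverge:
  assumes rec: "AE s in S. infinite {n. \<bar>chain m q 0 n s\<bar> \<le> R}" and "0 \<le> R"
    and \<nu>: "invariant \<nu>" "radon \<nu>"
    and f: "bump r f" and g: "bump r g" and "0 \<le> r"
    and less: "(\<integral>\<^sup>+x. ennreal (f x) \<partial>\<nu>) < (\<integral>\<^sup>+x. ennreal (g x) \<partial>\<nu>)"
  shows "AE s in S. \<forall>j::nat. \<exists>N. \<forall>n\<ge>N. real j \<le> (\<Sum>k<n. g (chain m q y k s) - f (chain m q y k s))"
proof -
  have [measurable_cong, simp]: "sets \<nu> = sets borel" using \<nu> by (simp add: invariant_def)
  have [measurable]: "f \<in> borel_measurable borel" "g \<in> borel_measurable borel"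
    and f0: "\<And>x. 0 \<le> f x" and g0: "\<And>x. 0 \<le> g x"
    using f g by (auto simp: bump_def)
  define r' where "r' = max (r + 1) (R + 1)"
  have r': "r + 1 \<le> r'" "R + 1 \<le> r'" by (auto simp: r'_def)
  have w: "emeasure \<nu> {-r'..r'} < \<infinity>" using \<nu>(2) by (simp add: radon_def)
  obtain \<eta> where \<eta>: "0 < \<eta>"
    "(\<integral>\<^sup>+x. ennreal (f x) \<partial>\<nu>) + ennreal \<eta> * emeasure \<nu> {-r'..r'} < (\<integral>\<^sup>+x. ennreal (g x) \<partial>\<nu>)"
  proof -
    obtain a where a: "(\<integral>\<^sup>+x. ennreal (f x) \<partial>\<nu>) < a" "a < (\<integral>\<^sup>+x. ennreal (g x) \<partial>\<nu>)"
      using dense[OF less] by blast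
    obtain a' f' where "a = ennreal a'" "0 \<le> a'" "(\<integral>\<^sup>+x. ennreal (f x) \<partial>\<nu>) = ennreal f'" "0 \<le> f'"
      using a by (metis ennreal_cases less_top top.not_eq_extremum order_less_trans)
    moreover obtain w' where "emeasure \<nu> {-r'..r'} = ennreal w'" "0 \<le> w'"
      using w by (metis ennreal_cases infinity_ennreal_def less_irrefl)
    moreover define \<eta> where "\<eta> = (a' - f') / (w' + 1)"
    ultimately have "0 < \<eta>" using a by (simp add: ennreal_less_iff)
    have "\<eta> * w' \<le> \<eta> * (w' + 1)" using \<open>0 < \<eta>\<close> by simp
    also have "\<dots> = a' - f'" using \<open>0 \<le> w'\<close> by (simp add: \<eta>_def)
    finally have "f' + \<eta> * w' \<le> a'" by simp
    then have "(\<integral>\<^sup>+x. ennreal (f x) \<partial>\<nu>) + ennreal \<eta> * emeasure \<nu> {-r'..r'} \<le> a"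
      using \<open>0 < \<eta>\<close> \<open>0 \<le> w'\<close> \<open>0 \<le> f'\<close> \<open>a = ennreal a'\<close> \<open>_ = ennreal f'\<close> \<open>_ = ennreal w'\<close>
      by (simp add: ennreal_mult[symmetric] ennreal_plus[symmetric] ennreal_leI del: ennreal_plus)
    with a that \<open>0 < \<eta>\<close> show ?thesis by (meson le_less_trans)
  qed
  define f' where "f' x = f x + \<eta> * indicator {-r'..r'} x" for x
  have [measurable]: "f' \<in> borel_measurable borel" unfolding f'_def by measurable
  have f'0: "0 \<le> f' x" for x using f0[of x] \<eta> by (simp add: f'_def)
  have "(\<integral>\<^sup>+x. ennreal (f' x) \<partial>\<nu>) = (\<integral>\<^sup>+x. ennreal (f x) + ennreal \<eta> * indicator {-r'..r'} x \<partial>\<nu>)"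
    using \<eta> f0 by (intro nn_integral_cong) (auto simp: f'_def indicator_def ennreal_plus)
  also have "\<dots> = (\<integral>\<^sup>+x. ennreal (f x) \<partial>\<nu>) + ennreal \<eta> * emeasure \<nu> {-r'..r'}"
    by (subst nn_integral_add) (auto simp: nn_integral_cmult)
  finally have f'_less: "(\<integral>\<^sup>+x. ennreal (f' x) \<partial>\<nu>) < (\<integral>\<^sup>+x. ennreal (g x) \<partial>\<nu>)" using \<eta> by simp
  \<comment> \<open>The comparison is applied with the two functions interchanged and contradicts \<open>f'_less\<close>.\<close>
  have "\<not> (AE x in \<nu>. AE s in S. \<exists>n. (\<Sum>k<n. g (chain m q x k s)) < (\<Sum>k<n. f' (chain m q x k s)))"
  proof
    assume "AE x in \<nu>. AE s in S. \<exists>n. (\<Sum>k<n. g (chain m q x k s)) < (\<Sum>k<n. f' (chain m q x k s))"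
    then have "(\<integral>\<^sup>+x. ennreal (g x) \<partial>\<nu>) \<le> (\<integral>\<^sup>+x. ennreal (f' x) \<partial>\<nu>)"
      using f'_less f'0 g0 by (intro hopf_comparison[OF \<nu>(1)]) (auto simp: less_top[symmetric])
    with f'_less show False by simp
  qed
  then obtain x where x: "\<not> (AE s in S. \<exists>n. (\<Sum>k<n. g (chain m q x k s)) < (\<Sum>k<n. f' (chain m q x k s)))"
    by (metis (mono_tags, lifting) AE_I2)
  show ?thesis
  proof (rule stream_zero_one_hereditary)
    let ?A = "\<lambda>s. \<forall>n. (\<Sum>k<n. f' (chain m q x k s)) \<le> (\<Sum>k<n. g (chain m q x k s))"
    let ?D = "\<lambda>y n s. (\<Sum>k<n. g (chain m q y k s) - f (chain m q y k s))"
    show "\<not> (AE s in S. \<not> ?A s)" using x by (simp add: not_le)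
    show "AE s in S. ?A s \<longrightarrow> (\<forall>i. \<forall>j::nat. \<exists>N. \<forall>n\<ge>N. real j \<le> ?D y n (sdrop i s))"
      using AE_dual_divergent rec
    proof eventually_elim
      case (elim s)
      show ?case
      proof (intro impI allI)
        fix i j :: nat assume A: "?A s"
        \<comment> \<open>The starting point from which the chain is at \<open>y\<close> after \<open>i\<close> letters.\<close>
        define z where "z = (y - chain m q 0 i s) / prodm m i s"
        have z: "chain m q z i s = y"
          using chain_affine[of m q z i s 0] prodm_pos[of i s] by (simp add: z_def)
        have D: "?D z (i + n) s = ?D z i s + ?D y n (sdrop i s)" for n
        proof -
          have "?D z (i + n) s = ?D z i s + (\<Sum>k<n. g (chain m q z (i + k) s) - f (chain m q z (i + k) s))"
            by (induction n) simp_all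
          then show ?thesis by (simp add: chain_add z)
        qed
        define j' where "j' = nat \<lceil>real j + ?D z i s\<rceil>"
        have j': "real j + ?D z i s \<le> real j'" unfolding j'_def by (rule real_nat_ceiling_ge)
        have "\<exists>N. \<forall>n\<ge>N. real j' \<le> ?D z n s"
          by (rule sums_transfer[where x=x and R=R and r'=r' and \<eta>=\<eta> and r=r])
            (use elim A f g r' \<eta> \<open>0 \<le> R\<close> \<open>0 \<le> r\<close> in \<open>auto simp: f'_def\<close>)
        then obtain N where N: "\<And>n. n \<ge> N \<Longrightarrow> real j' \<le> ?D z n s" by blast
        have "real j \<le> ?D y n (sdrop i s)" if "n \<ge> N" for n
          using N[of "i + n"] that j' D[of n] by simp
        then show "\<exists>N. \<forall>n\<ge>N. real j \<le> ?D y n (sdrop i s)" by blast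
      qed
    qed
  qed measurable
qed

end

section \<open>Perpetuities\<close>

lemma finite_of_suminf_indicator:
  assumes "(\<Sum>n. indicator K n :: ennreal) \<noteq> \<infinity>"
  shows "finite (K :: nat set)"
  using assms nn_integral_count_space_nat[of "indicator K"]
  by (auto simp: emeasure_count_space split: if_splits)

context affine_stream
begin

lemma nn_integral_snth:
  assumes [measurable]: "f \<in> borel_measurable \<mu>"
  shows "(\<integral>\<^sup>+s. f (s !! n) \<partial>S) = (\<integral>\<^sup>+p. f p \<partial>\<mu>)"
  using nn_integral_stream_sdrop[of "\<lambda>s. f (shd s)" n] nn_integral_shd[of f] by simp

lemma nn_integral_prodm: "(\<integral>\<^sup>+s. ennreal (prodm m n s) \<partial>S) = (\<integral>\<^sup>+p. ennreal (m p) \<partial>\<mu>) ^ n"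
proof (induction n)
  case 0
  show ?case using S.emeasure_space_1 by simp
next
  case (Suc n)
  have "(\<integral>\<^sup>+s. ennreal (prodm m (Suc n) s) \<partial>S) = (\<integral>\<^sup>+p. \<integral>\<^sup>+s. ennreal (prodm m (Suc n) (p ## s)) \<partial>S \<partial>\<mu>)"
    by (rule nn_integral_stream_space) measurable
  also have "\<dots> = (\<integral>\<^sup>+p. ennreal (m p) * (\<integral>\<^sup>+s. ennreal (prodm m n s) \<partial>S) \<partial>\<mu>)"
    unfolding prodm_Suc_stl using less_imp_le[OF m_pos] less_imp_le[OF prodm_pos]
    by (simp add: ennreal_mult nn_integral_cmult)
  also have "\<dots> = (\<integral>\<^sup>+p. ennreal (m p) \<partial>\<mu>) ^ Suc n"
    unfolding Suc by (simp add: nn_integral_multc)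
  finally show ?case .
qed

text \<open>Since \<open>\<rho> = E m < 1\<close>, the products decay faster than \<open>r\<^sup>n\<close> for any \<open>r\<close> between \<open>\<rho>\<close> and 1: the
  series of \<open>E \<Pi>\<^sub>n / r\<^sup>n\<close> is geometric, so no law of large numbers is needed. Integrability of
  \<open>ln (1 + q)\<close> bounds the factors \<open>q\<close> eventually by \<open>1 / r\<^sup>n\<close>.\<close>
lemma perpetuity_summable:
  assumes less1: "AE p in \<mu>. m p < 1"
    and log: "(\<integral>\<^sup>+p. ennreal (ln (1 + q p)) \<partial>\<mu>) < \<infinity>"
  shows "AE s in S. summable (\<lambda>j. prodm m j s * q (s !! j))"
proof -
  have int: "integrable \<mu> m"
    using less1 m_pos by (intro integrable_const_bound[where B=1]) (auto elim!: eventually_mono simp: less_imp_le abs_of_pos)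
  define \<rho> where "\<rho> = expectation m"
  have "\<rho> < 1" unfolding \<rho>_def using int less1 by (rule expectation_less)
  have "0 \<le> \<rho>" unfolding \<rho>_def using m_pos by (intro integral_nonneg_AE) (auto simp: less_imp_le)
  have nn: "(\<integral>\<^sup>+p. ennreal (m p) \<partial>\<mu>) = ennreal \<rho>"
    unfolding \<rho>_def using int m_pos by (intro nn_integral_eq_integral) (auto simp: less_imp_le)
  define r where "r = (\<rho> + 1) / 2"
  have r: "0 < r" "r < 1" "\<rho> < r" using \<open>0 \<le> \<rho>\<close> \<open>\<rho> < 1\<close> by (auto simp: r_def)
  have "(\<integral>\<^sup>+s. (\<Sum>n. ennreal (prodm m n s / r ^ n)) \<partial>S) = (\<Sum>n. \<integral>\<^sup>+s. ennreal (prodm m n s / r ^ n) \<partial>S)"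
    by (rule nn_integral_suminf) measurable
  also have "\<dots> = (\<Sum>n. ennreal ((\<rho> / r) ^ n))"
  proof (rule suminf_cong)
    fix n
    have "(\<integral>\<^sup>+s. ennreal (prodm m n s / r ^ n) \<partial>S) = (\<integral>\<^sup>+s. ennreal (prodm m n s) * ennreal (1 / r ^ n) \<partial>S)"
      using less_imp_le[OF prodm_pos] r by (simp add: ennreal_mult[symmetric])
    also have "\<dots> = ennreal \<rho> ^ n * ennreal (1 / r ^ n)"
      by (simp add: nn_integral_multc nn_integral_prodm nn)
    also have "\<dots> = ennreal ((\<rho> / r) ^ n)"
      using r \<open>0 \<le> \<rho>\<close> by (simp add: ennreal_power ennreal_mult[symmetric] power_divide)
    finally show "(\<integral>\<^sup>+s. ennreal (prodm m n s / r ^ n) \<partial>S) = ennreal ((\<rho> / r) ^ n)" .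
  qed
  also have "\<dots> < \<infinity>"
    using r \<open>0 \<le> \<rho>\<close> by (subst suminf_ennreal2) (auto intro!: summable_geometric)
  finally have "AE s in S. (\<Sum>n. ennreal (prodm m n s / r ^ n)) \<noteq> \<infinity>"
    by (intro nn_integral_noteq_infinite) auto
  moreover
  define c where "c = - ln r"
  have c: "0 < c" using r by (simp add: c_def)
  \<comment> \<open>Then \<open>f p \<le> n\<close> implies \<open>1 + q p \<le> 1 / r\<^sup>n\<close>, and \<open>f\<close> is integrable, so that \<open>n < f (s !! n)\<close>
    happens only finitely often.\<close>
  define f where "f p = nat \<lceil>ln (1 + q p) / c\<rceil>" for p
  have [measurable]: "f \<in> measurable \<mu> (count_space UNIV)" unfolding f_def by measurable
  have "AE s in S. (\<Sum>n. indicator {n. n < f (s !! n)} n :: ennreal) \<noteq> \<infinity>"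
  proof (rule nn_integral_noteq_infinite)
    have eq: "indicator {n. n < f (s !! n)} = (\<lambda>n. indicator {p. n < f p} (s !! n) :: ennreal)" for s
      by (auto simp: indicator_def fun_eq_iff)
    have "(\<integral>\<^sup>+s. (\<Sum>n. indicator {n. n < f (s !! n)} n) \<partial>S) = (\<Sum>n. \<integral>\<^sup>+s. indicator {p. n < f p} (s !! n) \<partial>S)"
      unfolding eq by (rule nn_integral_suminf) measurable
    also have "\<dots> = (\<Sum>n. emeasure \<mu> {p\<in>space \<mu>. n < f p})"
      by (subst nn_integral_snth) (auto simp: space_UNIV)
    also have "\<dots> = (\<integral>\<^sup>+p. of_nat (f p) \<partial>\<mu>)"
      by (rule nn_integral_nat_function[symmetric]) measurable
    also have "\<dots> \<le> (\<integral>\<^sup>+p. ennreal (ln (1 + q p)) * ennreal (1 / c) + 1 \<partial>\<mu>)"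
    proof (rule nn_integral_mono)
      fix p
      have l: "0 \<le> ln (1 + q p)" using q_nonneg[of p] by simp
      have "0 \<le> ln (1 + q p) / c" using l c by simp
      then have "real (f p) \<le> ln (1 + q p) * (1 / c) + 1"
        unfolding f_def by simp
      then have "ennreal (real (f p)) \<le> ennreal (ln (1 + q p) * (1 / c) + 1)" by (rule ennreal_leI)
      also have "\<dots> = ennreal (ln (1 + q p)) * ennreal (1 / c) + 1"
        using l c ennreal_mult[of "ln (1 + q p)" "1 / c"] ennreal_plus[of "ln (1 + q p) * (1 / c)" 1] by simp
      finally show "of_nat (f p) \<le> ennreal (ln (1 + q p)) * ennreal (1 / c) + 1"
        by (simp add: ennreal_of_nat_eq_real_of_nat)
    qed
    also have "\<dots> = (\<integral>\<^sup>+p. ennreal (ln (1 + q p)) \<partial>\<mu>) * ennreal (1 / c) + 1"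
      using emeasure_space_1 by (simp add: nn_integral_add nn_integral_multc)
    also have "\<dots> < \<infinity>" using log by (simp add: ennreal_mult_less_top)
    finally show "(\<integral>\<^sup>+s. (\<Sum>n. indicator {n. n < f (s !! n)} n) \<partial>S) \<noteq> \<infinity>" by simp
  qed measurable
  ultimately show ?thesis
  proof eventually_elim
    case (elim s)
    have "finite {n. n < f (s !! n)}" using elim(2) by (rule finite_of_suminf_indicator)
    then obtain N where "{n. n < f (s !! n)} \<subseteq> {..<N}" unfolding finite_nat_iff_bounded ..
    then have N: "n < N" if "n < f (s !! n)" for n using that by auto
    have sum: "summable (\<lambda>n. prodm m n s / r ^ n)"
      using elim(1) less_imp_le[OF prodm_pos] r by (intro summable_suminf_not_top) (auto intro: divide_nonneg_pos)
    show ?case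
    proof (rule summable_comparison_test'[OF sum, of N])
      fix n assume "n \<ge> N"
      then have "f (s !! n) \<le> n" using N[of n] by (meson leD not_le)
      then have "ln (1 + q (s !! n)) / c \<le> real n" by (simp add: f_def nat_le_iff ceiling_le_iff)
      then have "ln (1 + q (s !! n)) \<le> real n * c" using c by (simp add: field_simps)
      then have "exp (ln (1 + q (s !! n))) \<le> exp (real n * c)" by (simp only: exp_le_cancel_iff)
      moreover have "exp (ln (1 + q (s !! n))) = 1 + q (s !! n)"
        using q_nonneg[of "s !! n"] by (intro exp_ln) linarith
      moreover have "exp c = 1 / r" using r by (simp add: c_def exp_minus inverse_eq_divide)
      then have "exp (real n * c) = 1 / r ^ n"
        unfolding exp_of_nat_mult by (simp add: power_one_over)
      ultimately have "q (s !! n) \<le> 1 / r ^ n" by simp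
      then have "prodm m n s * q (s !! n) \<le> prodm m n s * (1 / r ^ n)"
        using prodm_pos[of n s] by (intro mult_left_mono) auto
      then show "norm (prodm m n s * q (s !! n)) \<le> prodm m n s / r ^ n"
        using prodm_pos[of n s] q_nonneg[of "s !! n"] by (simp add: abs_mult)
    qed
  qed
qed

definition perpetuity :: "'b stream \<Rightarrow> real" where
  "perpetuity s = (\<Sum>j. prodm m j s * q (s !! j))"

definition stationary_law :: "real measure" where
  "stationary_law = distr S borel perpetuity"

lemma measurable_perpetuity [measurable]: "perpetuity \<in> borel_measurable S"
  unfolding perpetuity_def by measurable

lemma prob_space_stationary_law: "prob_space stationary_law"
  unfolding stationary_law_def by (rule S.prob_space_distr) measurable

lemma sets_stationary_law [measurable_cong, simp]: "sets stationary_law = sets borel"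
  by (simp add: stationary_law_def)

lemma stationary_law_nonneg:
  assumes "AE s in S. summable (\<lambda>j. prodm m j s * q (s !! j))"
  shows "AE x in stationary_law. 0 \<le> x"
  unfolding stationary_law_def
proof (subst AE_distr_iff)
  show "AE s in S. 0 \<le> perpetuity s"
    using assms
  proof eventually_elim
    case (elim s)
    then show ?case unfolding perpetuity_def
      using less_imp_le[OF prodm_pos] q_nonneg by (intro suminf_nonneg) auto
  qed
qed auto

text \<open>Splitting off the first letter of the perpetuity writes it as the affine image of an
  independent copy.\<close>
lemma stationary_law_invariant:
  assumes sum: "AE s in S. summable (\<lambda>j. prodm m j s * q (s !! j))"
    and [measurable]: "F \<in> borel_measurable borel"
  shows "(\<integral>\<^sup>+x. F x \<partial>stationary_law) = (\<integral>\<^sup>+x. \<integral>\<^sup>+p. F (m p * x + q p) \<partial>\<mu> \<partial>stationary_law)"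
proof -
  interpret P: pair_sigma_finite S \<mu> ..
  have "(\<integral>\<^sup>+x. F x \<partial>stationary_law) = (\<integral>\<^sup>+s. F (perpetuity s) \<partial>S)"
    unfolding stationary_law_def by (subst nn_integral_distr) auto
  also have "\<dots> = (\<integral>\<^sup>+s. F (m (shd s) * perpetuity (stl s) + q (shd s)) \<partial>S)"
  proof (rule nn_integral_cong_AE)
    show "AE s in S. F (perpetuity s) = F (m (shd s) * perpetuity (stl s) + q (shd s))"
      using AE_stream_sdrop[OF sum, of 1]
    proof eventually_elim
      case (elim s)
      have eq: "prodm m (Suc j) s * q (s !! Suc j) = m (shd s) * (prodm m j (stl s) * q (stl s !! j))" for j
        by (simp add: prodm_Suc_stl)
      have "summable (\<lambda>j. prodm m (Suc j) s * q (s !! Suc j))"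
        unfolding eq using elim by (intro summable_mult) simp
      then have s: "summable (\<lambda>j. prodm m j s * q (s !! j))" by (subst (asm) summable_Suc_iff)
      have "perpetuity s = (\<Sum>j. prodm m (Suc j) s * q (s !! Suc j)) + q (shd s)"
        using suminf_split_head[OF s] by (simp add: perpetuity_def)
      also have "(\<Sum>j. prodm m (Suc j) s * q (s !! Suc j)) = m (shd s) * perpetuity (stl s)"
        unfolding eq perpetuity_def using elim by (intro suminf_mult) simp
      finally show ?case by simp
    qed
  qed
  also have "\<dots> = (\<integral>\<^sup>+p. \<integral>\<^sup>+s. F (m (shd (p ## s)) * perpetuity (stl (p ## s)) + q (shd (p ## s))) \<partial>S \<partial>\<mu>)"
    by (rule nn_integral_stream_space) measurable
  also have "\<dots> = (\<integral>\<^sup>+p. \<integral>\<^sup>+s. F (m p * perpetuity s + q p) \<partial>S \<partial>\<mu>)" by simp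
  also have "\<dots> = (\<integral>\<^sup>+s. \<integral>\<^sup>+p. F (m p * perpetuity s + q p) \<partial>\<mu> \<partial>S)"
    by (rule P.Fubini') measurable
  also have "\<dots> = (\<integral>\<^sup>+x. \<integral>\<^sup>+p. F (m p * x + q p) \<partial>\<mu> \<partial>stationary_law)"
    unfolding stationary_law_def by (subst nn_integral_distr) auto
  finally show ?thesis .
qed

lemma invariant_nn_integral_chain:
  assumes \<nu>: "invariant \<nu>" and [measurable]: "F \<in> borel_measurable borel"
  shows "(\<integral>\<^sup>+x. \<integral>\<^sup>+s. F (chain m q x n s) \<partial>S \<partial>\<nu>) = (\<integral>\<^sup>+x. F x \<partial>\<nu>)"
proof (induction n)
  case 0
  show ?case using S.emeasure_space_1 by simp
next
  case (Suc n)
  show ?case unfolding chain_Suc_stl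
    by (subst invariant_shift[OF \<nu>, of "\<lambda>x s. F (chain m q x n s)"]) (auto simp: Suc)
qed

text \<open>From a nonnegative start, \<open>P (X\<^sub>n \<le> R)\<close> is at most \<open>P (B\<^sub>n \<le> R)\<close>, which tends to zero; for a finite
  measure this would force \<open>\<nu> {..R} = 0\<close> for every \<open>R\<close>.\<close>
lemma invariant_infinite:
  assumes q: "emeasure \<mu> {p. 0 < q p} \<noteq> 0"
    and unb: "AE s in S. \<forall>j::nat. \<exists>n. real j < prodm m n s"
    and \<nu>: "invariant \<nu>" and nonneg: "AE x in \<nu>. 0 \<le> x" and ne: "emeasure \<nu> UNIV \<noteq> 0"
  shows "emeasure \<nu> UNIV = \<infinity>"
proof (rule ccontr)
  assume fin: "emeasure \<nu> UNIV \<noteq> \<infinity>"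
  have [measurable_cong, simp]: "sets \<nu> = sets borel" using \<nu> by (simp add: invariant_def)
  have [simp]: "space \<nu> = UNIV" using sets_eq_imp_space_eq[of \<nu> borel] by simp
  have "emeasure \<nu> {..R} \<le> 0" for R
  proof (rule LIMSEQ_le_const)
    have "(\<lambda>n. emeasure S {s. bsum m q n s \<le> R} * emeasure \<nu> UNIV) \<longlonglongrightarrow> 0 * emeasure \<nu> UNIV"
      using fin emeasure_bsum_le_tendsto[OF q unb] by (intro tendsto_mult_ennreal tendsto_const) auto
    then show "(\<lambda>n. emeasure S {s. bsum m q n s \<le> R} * emeasure \<nu> UNIV) \<longlonglongrightarrow> 0" by simp
    have "emeasure \<nu> {..R} \<le> emeasure S {s. bsum m q n s \<le> R} * emeasure \<nu> UNIV" for n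
    proof -
      have "emeasure \<nu> {..R} = (\<integral>\<^sup>+x. indicator {..R} x \<partial>\<nu>)" by simp
      also have "\<dots> = (\<integral>\<^sup>+x. \<integral>\<^sup>+s. indicator {..R} (chain m q x n s) \<partial>S \<partial>\<nu>)"
        by (rule invariant_nn_integral_chain[OF \<nu>, symmetric]) measurable
      also have "\<dots> \<le> (\<integral>\<^sup>+x. emeasure S {s. bsum m q n s \<le> R} \<partial>\<nu>)"
      proof (rule nn_integral_mono_AE)
        show "AE x in \<nu>. (\<integral>\<^sup>+s. indicator {..R} (chain m q x n s) \<partial>S) \<le> emeasure S {s. bsum m q n s \<le> R}"
          using nonneg
        proof eventually_elim
          case (elim x)
          have "chain m q 0 n s \<le> chain m q x n s" for s
            using chain_affine[of m q x n s 0] prodm_pos[of n s] elim by simp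
          then have "(\<integral>\<^sup>+s. indicator {..R} (chain m q x n s) \<partial>S) \<le> (\<integral>\<^sup>+s. indicator {s. chain m q 0 n s \<le> R} s \<partial>S)"
            by (intro nn_integral_mono) (auto simp: indicator_def intro: order_trans)
          also have "\<dots> = emeasure S {s. bsum m q n s \<le> R}"
            using emeasure_reversal[of "\<lambda>(a, b). b \<le> R" n] by simp
          finally show ?case .
        qed
      qed
      also have "\<dots> = emeasure S {s. bsum m q n s \<le> R} * emeasure \<nu> UNIV" by simp
      finally show ?thesis .
    qed
    then show "\<exists>N. \<forall>n\<ge>N. emeasure \<nu> {..R} \<le> emeasure S {s. bsum m q n s \<le> R} * emeasure \<nu> UNIV" by blast
  qed
  then have "emeasure \<nu> (\<Union>n::nat. {..real n}) = 0"
    by (intro emeasure_UN_eq_0) auto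
  also have "(\<Union>n::nat. {..real n}) = UNIV" using real_arch_simple by auto
  finally show False using ne by simp
qed

end

section \<open>Ladder times\<close>

lemma sum_shift_telescope:
  fixes f :: "nat \<Rightarrow> 'a :: comm_monoid_add"
  shows "(\<Sum>n<k. f (Suc n)) + f 0 = (\<Sum>n<k. f n) + f k"
proof -
  have "(\<Sum>n<k. f (Suc n)) + f 0 = sum f {..<Suc k}"
    unfolding sum.lessThan_Suc_shift by (rule add.commute)
  then show ?thesis by simp
qed

definition ladder :: "('b \<Rightarrow> real) \<Rightarrow> nat \<Rightarrow> 'b stream \<Rightarrow> bool" where
  "ladder m n s \<longleftrightarrow> 0 < n \<and> prodm m n s < 1 \<and> (\<forall>k\<in>{1..<n}. 1 \<le> prodm m k s)"

text \<open>That the first ladder time is later than \<open>n\<close>. This and \<^const>\<open>ladder\<close> are stated through the first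
  \<open>n\<close> letters only, so that the remaining letters can be replaced by fresh ones.\<close>
definition alive :: "('b \<Rightarrow> real) \<Rightarrow> nat \<Rightarrow> 'b stream \<Rightarrow> bool" where
  "alive m n s \<longleftrightarrow> (\<forall>k\<in>{1..n}. 1 \<le> prodm m k s)"

text \<open>On streams without a ladder time the value is an unspecified number; these form a null set.\<close>
definition ladder_time :: "('b \<Rightarrow> real) \<Rightarrow> 'b stream \<Rightarrow> nat" where
  "ladder_time m s = (LEAST n. 0 < n \<and> prodm m n s < 1)"

lemma ladder_time:
  assumes "0 < n" "prodm m n s < 1"
  shows "ladder m (ladder_time m s) s"
    and "ladder m k s \<longleftrightarrow> k = ladder_time m s"
    and "alive m k s \<longleftrightarrow> k < ladder_time m s"
proof -
  let ?R = "\<lambda>n. 0 < n \<and> prodm m n s < 1"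
  have 1: "?R (ladder_time m s)" unfolding ladder_time_def by (rule LeastI[of ?R n]) (use assms in simp)
  have 2: "\<not> ?R k" if "k < ladder_time m s" for k using that unfolding ladder_time_def by (rule not_less_Least)
  have ge: "1 \<le> prodm m k s" if "0 < k" "k < ladder_time m s" for k using 2[OF that(2)] that(1) by simp
  show 3: "ladder m (ladder_time m s) s"
    using 1 ge unfolding ladder_def by simp
  show "ladder m k s \<longleftrightarrow> k = ladder_time m s"
  proof
    assume k: "ladder m k s"
    show "k = ladder_time m s"
    proof (rule antisym)
      show "ladder_time m s \<le> k" using k 2[of k] unfolding ladder_def by linarith
      show "k \<le> ladder_time m s"
      proof (rule ccontr)
        assume "\<not> ?thesis"
        then have "1 \<le> prodm m (ladder_time m s) s" using k 1 by (simp add: ladder_def)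
        with 1 show False by simp
      qed
    qed
  qed (use 3 in simp)
  show "alive m k s \<longleftrightarrow> k < ladder_time m s"
  proof
    assume "alive m k s"
    show "k < ladder_time m s"
    proof (rule ccontr)
      assume "\<not> ?thesis"
      then have "1 \<le> prodm m (ladder_time m s) s" using \<open>alive m k s\<close> 1 by (simp add: alive_def)
      with 1 show False by simp
    qed
  next
    assume "k < ladder_time m s"
    then show "alive m k s" using ge by (simp add: alive_def)
  qed
qed

lemma ladder_stake_shift: "ladder m n (stake n s @- t) \<longleftrightarrow> ladder m n s"
  by (auto simp: ladder_def prodm_stake_shift)

lemma alive_stake_shift: "alive m n (stake n s @- t) \<longleftrightarrow> alive m n s"
  by (auto simp: alive_def prodm_stake_shift)

context affine_stream
begin

lemma measurable_ladder_time [measurable]: "ladder_time m \<in> measurable S (count_space UNIV)"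
  unfolding ladder_time_def by measurable

lemma pred_ladder [measurable]: "Measurable.pred S (ladder m n)"
  unfolding ladder_def by measurable

lemma pred_alive [measurable]: "Measurable.pred S (alive m n)"
  unfolding alive_def by measurable

text \<open>A whole stream is used as the letter of the ladder chain: the pair \<open>(block_m, block_q)\<close>
  describes the affine map composed up to the first ladder time.\<close>
definition block_m :: "'b stream \<Rightarrow> real" where
  "block_m s = prodm m (ladder_time m s) s"

definition block_q :: "'b stream \<Rightarrow> real" where
  "block_q s = chain m q 0 (ladder_time m s) s"

lemma measurable_block_m [measurable]: "block_m \<in> borel_measurable S"
  unfolding block_m_def by (rule measurable_compose_countable[OF _ measurable_ladder_time]) measurable

lemma measurable_block_q [measurable]: "block_q \<in> borel_measurable S"
  unfolding block_q_def by (rule measurable_compose_countable[OF _ measurable_ladder_time]) measurable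

lemma affine_stream_block: "affine_stream S block_m block_q"
  by unfold_locales (auto simp: block_m_def block_q_def prodm_pos chain_nonneg)

lemma chain_ladder_time: "chain m q x (ladder_time m s) s = block_m s * x + block_q s"
  using chain_affine[of m q x _ s 0] by (simp add: block_m_def block_q_def)

text \<open>The term of \<open>X\<^sub>\<sigma>\<close> that stems from the \<open>k\<close>-th letter is at most
  \<open>a \<Pi>\<^sub>\<sigma> / \<Pi>\<^sub>k\<^sub>-\<^sub>1 + b \<Pi>\<^sub>\<sigma> / \<Pi>\<^sub>k\<close>, and no product before \<open>\<sigma>\<close> is smaller than \<open>\<Pi>\<^sub>\<sigma>\<close>; so each of the \<open>\<sigma>\<close> letters
  contributes at most \<open>a + b\<close>.\<close>
lemma block_q_le:
  assumes lad: "ladder m n s" and le: "\<And>k. q (s !! k) \<le> a * m (s !! k) + b" and ab: "0 \<le> a" "0 \<le> b"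
  shows "chain m q 0 n s \<le> (a + b) * real n"
proof -
  have *: "chain m q 0 k s \<le> prodm m k s * ((a + b) * real k)" if "k < n" for k
    using that
  proof (induction k)
    case (Suc k)
    have m: "0 < m (s !! k)" by (rule m_pos)
    have p1: "1 \<le> prodm m k s"
      using lad Suc.prems by (cases k) (auto simp: ladder_def)
    have p2: "1 \<le> prodm m (Suc k) s" using lad Suc.prems by (auto simp: ladder_def)
    have "chain m q 0 (Suc k) s \<le> m (s !! k) * (prodm m k s * ((a + b) * real k)) + (a * m (s !! k) + b)"
      using Suc m le[of k] by (simp add: add_mono)
    also have "\<dots> \<le> m (s !! k) * (prodm m k s * ((a + b) * real k)) + (a * prodm m (Suc k) s + b * prodm m (Suc k) s)"
    proof (intro add_left_mono add_mono)
      show "a * m (s !! k) \<le> a * prodm m (Suc k) s"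
        using ab m p1 by (intro mult_left_mono) (auto simp: prodm_Suc)
      show "b \<le> b * prodm m (Suc k) s" using ab p2 mult_left_mono[of 1 "prodm m (Suc k) s" b] by simp
    qed
    also have "\<dots> = prodm m (Suc k) s * ((a + b) * real (Suc k))"
      by (simp add: prodm_Suc algebra_simps)
    finally show ?case .
  qed simp
  from lad obtain k where n: "n = Suc k" by (cases n) (auto simp: ladder_def)
  have m: "0 < m (s !! k)" by (rule m_pos)
  have p1: "1 \<le> prodm m k s" using lad n by (cases k) (auto simp: ladder_def)
  have p2: "prodm m n s < 1" using lad by (simp add: ladder_def)
  have "m (s !! k) \<le> prodm m n s" using m p1 by (simp add: n prodm_Suc)
  have "chain m q 0 n s \<le> m (s !! k) * (prodm m k s * ((a + b) * real k)) + (a * m (s !! k) + b)"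
    using *[of k] m le[of k] by (simp add: n add_mono)
  also have "\<dots> = prodm m n s * ((a + b) * real k) + a * m (s !! k) + b"
    by (simp add: n prodm_Suc mult_ac)
  also have "\<dots> \<le> 1 * ((a + b) * real k) + a * 1 + b"
    using p2 ab \<open>m (s !! k) \<le> prodm m n s\<close> by (intro add_mono mult_right_mono mult_left_mono order_refl) auto
  also have "\<dots> = (a + b) * real n" by (simp add: n algebra_simps)
  finally show ?thesis .
qed

end

locale ladder_affine_stream = oscillating_affine_stream \<mu> m q
  for \<mu> :: "'b measure" and m q :: "'b \<Rightarrow> real" +
  fixes a b :: real
  assumes log_ladder: "(\<integral>\<^sup>+s. ennreal (ln (real (ladder_time m s))) \<partial>S) < \<infinity>"
    and growth: "AE p in \<mu>. q p \<le> a * m p + b"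
    and ab_nonneg: "0 \<le> a" "0 \<le> b"
begin

sublocale block: affine_stream S block_m block_q
  by (rule affine_stream_block)

text \<open>The inverse products are unbounded, so the products drop below 1 at some time.\<close>
lemma AE_ladder: "AE s in S. \<exists>n>0. prodm m n s < 1"
  using unbounded_below
proof eventually_elim
  case (elim s)
  then obtain n where n: "real 1 < prodm (\<lambda>p. 1 / m p) n s" by blast
  have "prodm (\<lambda>p. 1 / m p) n s = 1 / prodm m n s" by (simp add: prodm_def prod_dividef)
  with n have "1 < 1 / prodm m n s" by simp
  then have "prodm m n s < 1" using prodm_pos[of n s] by (simp add: field_simps)
  moreover have "0 < n" using n by (cases n) auto
  ultimately show ?case by blast
qed

lemma AE_ladder_time:
  "AE s in S. ladder m (ladder_time m s) s \<and> (\<forall>k. ladder m k s \<longleftrightarrow> k = ladder_time m s) \<and>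
    (\<forall>k. alive m k s \<longleftrightarrow> k < ladder_time m s)"
  using AE_ladder
proof eventually_elim
  case (elim s)
  then obtain n where n: "0 < n" "prodm m n s < 1" by blast
  show ?case
    by (intro conjI allI ladder_time[OF n])
qed

lemma block_summable: "AE t in block.S. summable (\<lambda>j. prodm block_m j t * block_q (t !! j))"
proof (rule block.perpetuity_summable)
  show "AE s in S. block_m s < 1"
    using AE_ladder_time by eventually_elim (auto simp: block_m_def ladder_def)
  have "AE s in S. \<forall>k. q (s !! k) \<le> a * m (s !! k) + b"
    unfolding AE_all_countable
  proof
    fix k
    have "AE s in S. stream_all (\<lambda>p. q p \<le> a * m p + b) s"
      by (rule AE_stream_all) (measurable, rule growth)
    then show "AE s in S. q (s !! k) \<le> a * m (s !! k) + b"
      by eventually_elim (auto simp: stream_all_def)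
  qed
  then have "AE s in S. ennreal (ln (1 + block_q s)) \<le> ennreal (ln (1 + a + b)) + ennreal (ln (real (ladder_time m s)))"
    using AE_ladder_time
  proof eventually_elim
    case (elim s)
    let ?t = "ladder_time m s"
    have t: "1 \<le> real ?t" using elim(2) by (auto simp: ladder_def)
    have "block_q s \<le> (a + b) * real ?t"
      unfolding block_q_def using elim ab_nonneg by (intro block_q_le) auto
    then have "1 + block_q s \<le> (1 + a + b) * real ?t" using t by (simp add: algebra_simps)
    moreover have "0 < 1 + block_q s" using block.q_nonneg[of s] by linarith
    ultimately have "ln (1 + block_q s) \<le> ln ((1 + a + b) * real ?t)" by simp
    also have "\<dots> = ln (1 + a + b) + ln (real ?t)" using t ab_nonneg by (simp add: ln_mult)
    finally have "ennreal (ln (1 + block_q s)) \<le> ennreal (ln (1 + a + b) + ln (real ?t))"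
      by (rule ennreal_leI)
    also have "\<dots> = ennreal (ln (1 + a + b)) + ennreal (ln (real ?t))"
      using t ab_nonneg by (intro ennreal_plus) auto
    finally show ?case .
  qed
  then have "(\<integral>\<^sup>+s. ennreal (ln (1 + block_q s)) \<partial>S) \<le>
      (\<integral>\<^sup>+s. ennreal (ln (1 + a + b)) + ennreal (ln (real (ladder_time m s))) \<partial>S)"
    by (rule nn_integral_mono_AE)
  also have "\<dots> = ennreal (ln (1 + a + b)) + (\<integral>\<^sup>+s. ennreal (ln (real (ladder_time m s))) \<partial>S)"
    using S.emeasure_space_1 by (subst nn_integral_add) auto
  also have "\<dots> < \<infinity>" using log_ladder by simp
  finally show "(\<integral>\<^sup>+s. ennreal (ln (1 + block_q s)) \<partial>S) < \<infinity>" .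
qed

abbreviation "\<pi> \<equiv> block.stationary_law"

sublocale \<pi>: prob_space \<pi>
  by (rule block.prob_space_stationary_law)

lemma AE_\<pi>_nonneg: "AE x in \<pi>. 0 \<le> x"
  by (rule block.stationary_law_nonneg[OF block_summable])

lemma \<pi>_invariant:
  assumes [measurable]: "F \<in> borel_measurable borel"
  shows "(\<integral>\<^sup>+x. \<integral>\<^sup>+s. F (chain m q x (ladder_time m s) s) \<partial>S \<partial>\<pi>) = (\<integral>\<^sup>+x. F x \<partial>\<pi>)"
  unfolding chain_ladder_time by (rule block.stationary_law_invariant[OF block_summable, symmetric]) measurable

section \<open>The occupation measure of a ladder excursion\<close>

definition \<nu> :: "real measure" where
  "\<nu> = distr (density (\<pi> \<Otimes>\<^sub>M (S \<Otimes>\<^sub>M count_space UNIV)) (\<lambda>(x, s, n). indicator {n. alive m n s} n)) borel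
     (\<lambda>(x, s, n). chain m q x n s)"

lemma sets_\<nu> [measurable_cong, simp]: "sets \<nu> = sets borel"
  by (simp add: \<nu>_def)

lemma nn_integral_\<nu>:
  assumes [measurable]: "F \<in> borel_measurable borel"
  shows "(\<integral>\<^sup>+x. F x \<partial>\<nu>) =
    (\<Sum>n. \<integral>\<^sup>+x. \<integral>\<^sup>+s. indicator {s. alive m n s} s * F (chain m q x n s) \<partial>S \<partial>\<pi>)"
proof -
  interpret N: sigma_finite_measure "count_space (UNIV :: nat set)" by (rule sigma_finite_measure_count_space)
  interpret SN: pair_sigma_finite S "count_space (UNIV :: nat set)" ..

  have m1 [measurable]: "(\<lambda>(x, s, n). chain m q x n s) \<in> borel_measurable (\<pi> \<Otimes>\<^sub>M (S \<Otimes>\<^sub>M count_space UNIV))"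
    unfolding split_beta' by (rule measurable_compose_countable[where g="\<lambda>z. snd (snd z)"]) measurable
  have m2 [measurable]: "(\<lambda>(x, s, n). indicator {n. alive m n s} n :: ennreal) \<in> borel_measurable (\<pi> \<Otimes>\<^sub>M (S \<Otimes>\<^sub>M count_space UNIV))"
  proof -
    have "(\<lambda>z. indicator {s. alive m n s} (fst (snd z)) :: ennreal) \<in> borel_measurable (\<pi> \<Otimes>\<^sub>M (S \<Otimes>\<^sub>M count_space UNIV))" for n
      by measurable
    then have "(\<lambda>z. indicator {s. alive m (snd (snd z)) s} (fst (snd z)) :: ennreal) \<in> borel_measurable (\<pi> \<Otimes>\<^sub>M (S \<Otimes>\<^sub>M count_space UNIV))"
      by (rule measurable_compose_countable[where g="\<lambda>z. snd (snd z)"]) measurable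
    then show ?thesis by (simp add: split_beta' indicator_def)
  qed
  define W where "W z = (case z of (x, s, n) \<Rightarrow> indicator {n. alive m n s} n) * F (case z of (x, s, n) \<Rightarrow> chain m q x n s)" for z
  have W [measurable]: "W \<in> borel_measurable (\<pi> \<Otimes>\<^sub>M (S \<Otimes>\<^sub>M count_space UNIV))"
    unfolding W_def by (rule borel_measurable_times_ennreal[OF m2 measurable_compose[OF m1 assms]])
  have "(\<integral>\<^sup>+x. F x \<partial>\<nu>) = (\<integral>\<^sup>+z. F (case z of (x, s, n) \<Rightarrow> chain m q x n s)
     \<partial>density (\<pi> \<Otimes>\<^sub>M (S \<Otimes>\<^sub>M count_space UNIV)) (\<lambda>(x, s, n). indicator {n. alive m n s} n))"
    unfolding \<nu>_def by (rule nn_integral_distr) (simp_all add: m1 assms)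
  also have "\<dots> = (\<integral>\<^sup>+z. W z \<partial>(\<pi> \<Otimes>\<^sub>M (S \<Otimes>\<^sub>M count_space UNIV)))"
    unfolding W_def by (rule nn_integral_density[OF m2 measurable_compose[OF m1 assms]])
  also have "\<dots> = (\<integral>\<^sup>+x. \<integral>\<^sup>+z. W (x, z) \<partial>(S \<Otimes>\<^sub>M count_space UNIV) \<partial>\<pi>)"
    by (rule SN.P.nn_integral_fst[OF W, symmetric])
  also have "\<dots> = (\<integral>\<^sup>+x. \<integral>\<^sup>+s. \<integral>\<^sup>+n. W (x, s, n) \<partial>count_space UNIV \<partial>S \<partial>\<pi>)"
  proof (rule nn_integral_cong)
    fix x assume x: "x \<in> space \<pi>"
    have "(\<lambda>z. W (x, z)) \<in> borel_measurable (S \<Otimes>\<^sub>M count_space UNIV)"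
      by (rule measurable_compose[OF measurable_Pair1'[OF x] W])
    then show "(\<integral>\<^sup>+z. W (x, z) \<partial>(S \<Otimes>\<^sub>M count_space UNIV)) = (\<integral>\<^sup>+s. \<integral>\<^sup>+n. W (x, s, n) \<partial>count_space UNIV \<partial>S)"
      by (rule N.nn_integral_fst[symmetric])
  qed
  also have "\<dots> = (\<integral>\<^sup>+x. \<integral>\<^sup>+s. (\<Sum>n. W (x, s, n)) \<partial>S \<partial>\<pi>)"
    by (simp only: nn_integral_count_space_nat)
  also have "\<dots> = (\<integral>\<^sup>+x. \<integral>\<^sup>+s. (\<Sum>n. indicator {s. alive m n s} s * F (chain m q x n s)) \<partial>S \<partial>\<pi>)"
    unfolding W_def by (simp add: indicator_def)
  also have "\<dots> = (\<integral>\<^sup>+x. (\<Sum>n. \<integral>\<^sup>+s. indicator {s. alive m n s} s * F (chain m q x n s) \<partial>S) \<partial>\<pi>)"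
    by (rule nn_integral_cong, rule nn_integral_suminf) measurable
  also have "\<dots> = (\<Sum>n. \<integral>\<^sup>+x. \<integral>\<^sup>+s. indicator {s. alive m n s} s * F (chain m q x n s) \<partial>S \<partial>\<pi>)"
    by (rule nn_integral_suminf) measurable
  finally show ?thesis .
qed

lemma emeasure_\<nu>:
  assumes [measurable]: "A \<in> sets borel"
  shows "emeasure \<nu> A = (\<Sum>n. \<integral>\<^sup>+x. \<integral>\<^sup>+s. indicator {s. alive m n s} s * indicator A (chain m q x n s) \<partial>S \<partial>\<pi>)"
  using nn_integral_\<nu>[of "indicator A"] by simp

text \<open>Moving each step of an excursion one step ahead replaces the visit at time \<open>0\<close> by the visit at the
  ladder time. Both have law \<open>\<pi>\<close>, whose mass is finite and can be cancelled.\<close>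
lemma invariant_\<nu>: "invariant \<nu>"
  unfolding invariant_def
proof (intro conjI ballI)
  fix A :: "real set" assume [measurable]: "A \<in> sets borel"
  let ?u = "\<lambda>x. emeasure \<mu> {p. m p * x + q p \<in> A}"
  have u: "?u x = (\<integral>\<^sup>+p. indicator A (m p * x + q p) \<partial>\<mu>)" for x
  proof -
    have "(\<integral>\<^sup>+p. indicator A (m p * x + q p) \<partial>\<mu>) = (\<integral>\<^sup>+p. indicator {p. m p * x + q p \<in> A} p \<partial>\<mu>)"
      by (simp add: indicator_def)
    then show ?thesis by simp
  qed
  have [measurable]: "?u \<in> borel_measurable borel" unfolding u by measurable
  let ?I = "\<lambda>n s. indicator {s. alive m n s} s :: ennreal"
  have markov: "(\<integral>\<^sup>+s. ?I n s * ?u (chain m q x n s) \<partial>S) = (\<integral>\<^sup>+s. ?I n s * indicator A (chain m q x (Suc n) s) \<partial>S)" for n x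
  proof -
    have "(\<integral>\<^sup>+s. ?I n s * ?u (chain m q x n s) \<partial>S) =
      (\<integral>\<^sup>+s. \<integral>\<^sup>+p. ?I n s * indicator A (m p * chain m q x n s + q p) \<partial>\<mu> \<partial>S)"
      unfolding u by (intro nn_integral_cong nn_integral_cmult[symmetric]) measurable
    also have "\<dots> = (\<integral>\<^sup>+s. \<integral>\<^sup>+t. ?I n s * indicator A (m (shd t) * chain m q x n s + q (shd t)) \<partial>S \<partial>S)"
      by (intro nn_integral_cong nn_integral_shd[symmetric]) measurable
    also have "\<dots> = (\<integral>\<^sup>+s. \<integral>\<^sup>+t. ?I n (stake n s @- t) * indicator A (chain m q x (Suc n) (stake n s @- t)) \<partial>S \<partial>S)"
      by (simp add: alive_stake_shift chain_stake_shift snth_stake_shift indicator_def)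
    also have "\<dots> = (\<integral>\<^sup>+s. ?I n s * indicator A (chain m q x (Suc n) s) \<partial>S)"
      by (rule nn_integral_stream_split[symmetric]) measurable
    finally show ?thesis .
  qed
  have telescope: "(\<Sum>n. ?I n s * indicator A (chain m q x (Suc n) s)) + indicator A x =
      (\<Sum>n. ?I n s * indicator A (chain m q x n s)) + indicator A (chain m q x (ladder_time m s) s)"
    if "\<forall>k. alive m k s \<longleftrightarrow> k < ladder_time m s" for s x
  proof -
    let ?t = "ladder_time m s"
    have trunc: "(\<Sum>n. ?I n s * f n) = (\<Sum>n<?t. f n)" for f :: "nat \<Rightarrow> ennreal"
    proof -
      have "(\<Sum>n. ?I n s * f n) = (\<Sum>n<?t. ?I n s * f n)"
        using that by (intro suminf_finite) auto
      then show ?thesis using that by simp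
    qed
    have "(\<Sum>n. ?I n s * indicator A (chain m q x (Suc n) s)) = (\<Sum>n<?t. indicator A (chain m q x (Suc n) s))"
      "(\<Sum>n. ?I n s * indicator A (chain m q x n s)) = (\<Sum>n<?t. indicator A (chain m q x n s))"
      by (rule trunc)+
    moreover have "(\<Sum>n<?t. indicator A (chain m q x (Suc n) s)) + indicator A (chain m q x 0 s) =
      (\<Sum>n<?t. indicator A (chain m q x n s)) + (indicator A (chain m q x ?t s) :: ennreal)"
      using sum_shift_telescope[of "\<lambda>n. indicator A (chain m q x n s)" ?t] by blast
    ultimately show ?thesis by simp
  qed
  have "(\<integral>\<^sup>+x. ?u x \<partial>\<nu>) + emeasure \<pi> A =
    (\<integral>\<^sup>+x. \<integral>\<^sup>+s. (\<Sum>n. ?I n s * indicator A (chain m q x (Suc n) s)) + indicator A x \<partial>S \<partial>\<pi>)"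
  proof -
    have "(\<integral>\<^sup>+x. ?u x \<partial>\<nu>) = (\<Sum>n. \<integral>\<^sup>+x. \<integral>\<^sup>+s. ?I n s * indicator A (chain m q x (Suc n) s) \<partial>S \<partial>\<pi>)"
      by (subst nn_integral_\<nu>) (simp_all add: markov del: chain.simps)
    also have "\<dots> = (\<integral>\<^sup>+x. \<integral>\<^sup>+s. (\<Sum>n. ?I n s * indicator A (chain m q x (Suc n) s)) \<partial>S \<partial>\<pi>)"
      by (subst nn_integral_suminf[symmetric], measurable, rule nn_integral_cong, rule nn_integral_suminf[symmetric]) measurable
    finally show ?thesis
      using S.emeasure_space_1 by (simp add: nn_integral_add del: chain.simps)
  qed
  also have "\<dots> = (\<integral>\<^sup>+x. \<integral>\<^sup>+s. (\<Sum>n. ?I n s * indicator A (chain m q x n s)) + indicator A (chain m q x (ladder_time m s) s) \<partial>S \<partial>\<pi>)"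
  proof (rule nn_integral_cong, rule nn_integral_cong_AE)
    fix x
    show "AE s in S. (\<Sum>n. ?I n s * indicator A (chain m q x (Suc n) s)) + indicator A x =
      (\<Sum>n. ?I n s * indicator A (chain m q x n s)) + indicator A (chain m q x (ladder_time m s) s)"
      using AE_ladder_time by eventually_elim (rule telescope, blast)
  qed
  also have "\<dots> = emeasure \<nu> A + emeasure \<pi> A"
  proof -
    have [measurable]: "(\<lambda>(x, s). indicator A (chain m q x (ladder_time m s) s) :: ennreal) \<in> borel_measurable (borel \<Otimes>\<^sub>M S)"
      unfolding chain_ladder_time by measurable
    have "emeasure \<nu> A = (\<integral>\<^sup>+x. \<integral>\<^sup>+s. (\<Sum>n. ?I n s * indicator A (chain m q x n s)) \<partial>S \<partial>\<pi>)"
      unfolding emeasure_\<nu>[OF \<open>A \<in> sets borel\<close>]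
      by (subst nn_integral_suminf[symmetric], measurable, rule nn_integral_cong, rule nn_integral_suminf[symmetric]) measurable
    moreover have "(\<integral>\<^sup>+x. \<integral>\<^sup>+s. indicator A (chain m q x (ladder_time m s) s) \<partial>S \<partial>\<pi>) = emeasure \<pi> A"
      by (subst \<pi>_invariant) auto
    ultimately show ?thesis by (simp add: nn_integral_add)
  qed
  finally have "emeasure \<pi> A + (\<integral>\<^sup>+x. ?u x \<partial>\<nu>) = emeasure \<pi> A + emeasure \<nu> A"
    by (simp add: add.commute)
  then show "emeasure \<nu> A = (\<integral>\<^sup>+x. ?u x \<partial>\<nu>)"
    by (simp add: ennreal_add_left_cancel)
qed simp

lemma AE_\<nu>_nonneg: "AE x in \<nu>. 0 \<le> x"
proof -
  have "(\<integral>\<^sup>+x. \<integral>\<^sup>+s. indicator {s. alive m n s} s * indicator {..<0} (chain m q x n s) \<partial>S \<partial>\<pi>) = 0" for n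
  proof -
    have "AE x in \<pi>. (\<integral>\<^sup>+s. indicator {s. alive m n s} s * indicator {..<0} (chain m q x n s) \<partial>S) = (0::ennreal)"
      using AE_\<pi>_nonneg
    proof eventually_elim
      case (elim x)
      have "chain m q x n s \<notin> {..<0}" for s using chain_nonneg[OF elim, of n s] by simp
      then show ?case by simp
    qed
    then show ?thesis by (subst nn_integral_0_iff_AE) auto
  qed
  then have "emeasure \<nu> {..<0} = 0" by (simp add: emeasure_\<nu>)
  then show ?thesis by (intro AE_I[of _ _ "{..<0}"]) auto
qed

text \<open>During the excursion the product is at least 1 and the chain dominates the one started at \<open>0\<close>;
  after reversal the visits to \<open>[-R, R]\<close> are among those counted by the Green function bound.\<close>
lemma radon_\<nu>: "radon \<nu>"
  unfolding radon_def
proof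
  fix R
  obtain N where "emeasure S {s. R < bsum m q N s} \<noteq> 0"
    using bsum_exceeds_with_positive_prob[OF q_nontrivial unbounded_above] by blast
  then have fin: "(\<Sum>n. emeasure S {s. bsum m q n s \<le> R \<and> 1 \<le> prodm m n s}) < \<infinity>"
    by (rule green_bound_finite)
  have "emeasure \<nu> {-R..R} \<le> (\<Sum>n. emeasure S {s. bsum m q n s \<le> R \<and> 1 \<le> prodm m n s})"
    unfolding emeasure_\<nu>[OF borel_closed[OF closed_real_atLeastAtMost]]
  proof (intro suminf_le summableI)
    fix n
    have "(\<integral>\<^sup>+x. \<integral>\<^sup>+s. indicator {s. alive m n s} s * indicator {-R..R} (chain m q x n s) \<partial>S \<partial>\<pi>) \<le>
      (\<integral>\<^sup>+x. emeasure S {s. bsum m q n s \<le> R \<and> 1 \<le> prodm m n s} \<partial>\<pi>)"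
    proof (rule nn_integral_mono_AE)
      show "AE x in \<pi>. (\<integral>\<^sup>+s. indicator {s. alive m n s} s * indicator {-R..R} (chain m q x n s) \<partial>S) \<le>
        emeasure S {s. bsum m q n s \<le> R \<and> 1 \<le> prodm m n s}"
        using AE_\<pi>_nonneg
      proof eventually_elim
        case (elim x)
        have "(\<integral>\<^sup>+s. indicator {s. alive m n s} s * indicator {-R..R} (chain m q x n s) \<partial>S) \<le>
          (\<integral>\<^sup>+s. indicator {s. chain m q 0 n s \<le> R \<and> 1 \<le> prodm m n s} s \<partial>S)"
        proof (intro nn_integral_mono)
          fix s
          have "chain m q 0 n s \<le> chain m q x n s"
            using chain_affine[of m q x n s 0] prodm_pos[of n s] elim by simp
          moreover have "1 \<le> prodm m n s" if "alive m n s"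
            using that by (cases n) (auto simp: alive_def)
          ultimately show "(indicator {s. alive m n s} s * indicator {-R..R} (chain m q x n s) :: ennreal) \<le>
            indicator {s. chain m q 0 n s \<le> R \<and> 1 \<le> prodm m n s} s"
            by (auto simp: indicator_def)
        qed
        also have "\<dots> = emeasure S {s. bsum m q n s \<le> R \<and> 1 \<le> prodm m n s}"
          using emeasure_reversal[of "\<lambda>(a, b). b \<le> R \<and> 1 \<le> a" n] by simp
        finally show ?case .
      qed
    qed
    then show "(\<integral>\<^sup>+x. \<integral>\<^sup>+s. indicator {s. alive m n s} s * indicator {-R..R} (chain m q x n s) \<partial>S \<partial>\<pi>) \<le>
      emeasure S {s. bsum m q n s \<le> R \<and> 1 \<le> prodm m n s}"
      by (simp add: \<pi>.emeasure_space_1)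
  qed
  with fin show "emeasure \<nu> {-R..R} < \<infinity>" by (rule le_less_trans[rotated])
qed

lemma \<nu>_nonzero: "emeasure \<nu> UNIV \<noteq> 0"
proof -
  have "1 = (\<integral>\<^sup>+x. \<integral>\<^sup>+s. indicator {s. alive m 0 s} s * indicator UNIV (chain m q x 0 s) \<partial>S \<partial>\<pi>)"
    using S.emeasure_space_1 \<pi>.emeasure_space_1 by (simp add: alive_def)
  also have "\<dots> \<le> (\<Sum>n. \<integral>\<^sup>+x. \<integral>\<^sup>+s. indicator {s. alive m n s} s * indicator UNIV (chain m q x n s) \<partial>S \<partial>\<pi>)"
  proof -
    have "f 0 \<le> suminf f" for f :: "nat \<Rightarrow> ennreal"
      using sum_le_suminf[of f "{0}"] by (simp add: summableI)
    then show ?thesis .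
  qed
  also have "\<dots> = emeasure \<nu> UNIV" by (rule emeasure_\<nu>[symmetric]) simp
  finally show ?thesis by auto
qed

lemma \<nu>_infinite: "emeasure \<nu> UNIV = \<infinity>"
  by (rule invariant_infinite[OF q_nontrivial unbounded_above invariant_\<nu> AE_\<nu>_nonneg \<nu>_nonzero])

section \<open>Recurrence\<close>

lemma measurable_visit_prob:
  "(\<lambda>y. emeasure S {t. \<exists>n\<ge>i. \<bar>chain m q y n t\<bar> \<le> R}) \<in> borel_measurable borel"
proof -
  let ?Q = "{z\<in>space (borel \<Otimes>\<^sub>M S). \<exists>n\<ge>i. \<bar>chain m q (fst z) n (snd z)\<bar> \<le> R}"
  have "?Q \<in> sets (borel \<Otimes>\<^sub>M S)" by measurable
  then have "(\<lambda>y. emeasure S (Pair y -` ?Q)) \<in> borel_measurable borel"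
    by (rule S.measurable_emeasure_Pair)
  moreover have "Pair y -` ?Q = {t. \<exists>n\<ge>i. \<bar>chain m q y n t\<bar> \<le> R}" for y
    by (auto simp: space_pair_measure)
  ultimately show ?thesis by simp
qed

text \<open>The strong Markov property at the first ladder time, which is at least 1.\<close>
lemma visits_from_ladder:
  "(\<integral>\<^sup>+s. emeasure S {t. \<exists>n\<ge>i. \<bar>chain m q (chain m q x (ladder_time m s) s) n t\<bar> \<le> R} \<partial>S) \<le>
    emeasure S {s. \<exists>n\<ge>Suc i. \<bar>chain m q x n s\<bar> \<le> R}"
proof -
  let ?V = "\<lambda>y. {t. \<exists>n\<ge>i. \<bar>chain m q y n t\<bar> \<le> R}"
  let ?L = "\<lambda>j s. indicator {s. ladder m j s} s :: ennreal"
  have [measurable]: "(\<lambda>y. emeasure S (?V y)) \<in> borel_measurable borel"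
    by (rule measurable_visit_prob)
  have "(\<integral>\<^sup>+s. emeasure S (?V (chain m q x (ladder_time m s) s)) \<partial>S) =
    (\<integral>\<^sup>+s. (\<Sum>j. ?L j s * emeasure S (?V (chain m q x j s))) \<partial>S)"
  proof (rule nn_integral_cong_AE)
    show "AE s in S. emeasure S (?V (chain m q x (ladder_time m s) s)) = (\<Sum>j. ?L j s * emeasure S (?V (chain m q x j s)))"
      using AE_ladder_time
    proof eventually_elim
      case (elim s)
      have "(\<Sum>j. ?L j s * emeasure S (?V (chain m q x j s))) = (\<Sum>j\<in>{ladder_time m s}. ?L j s * emeasure S (?V (chain m q x j s)))"
        using elim by (intro suminf_finite) (auto simp: indicator_def)
      then show ?case using elim by simp
    qed
  qed
  also have "\<dots> = (\<Sum>j. \<integral>\<^sup>+s. ?L j s * emeasure S (?V (chain m q x j s)) \<partial>S)"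
    by (rule nn_integral_suminf) measurable
  also have "\<dots> = (\<Sum>j. \<integral>\<^sup>+s. ?L j s * indicator {s. \<exists>n\<ge>i. \<bar>chain m q x (j + n) s\<bar> \<le> R} s \<partial>S)"
  proof (rule suminf_cong)
    fix j
    have "(\<integral>\<^sup>+s. ?L j s * emeasure S (?V (chain m q x j s)) \<partial>S) =
      (\<integral>\<^sup>+s. \<integral>\<^sup>+t. ?L j s * indicator (?V (chain m q x j s)) t \<partial>S \<partial>S)"
      by (rule nn_integral_cong, subst nn_integral_cmult) simp_all
    also have "\<dots> = (\<integral>\<^sup>+s. \<integral>\<^sup>+t. ?L j (stake j s @- t) * indicator {s. \<exists>n\<ge>i. \<bar>chain m q x (j + n) s\<bar> \<le> R} (stake j s @- t) \<partial>S \<partial>S)"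
      by (simp add: indicator_def ladder_stake_shift chain_add chain_stake_shift)
    also have "\<dots> = (\<integral>\<^sup>+s. ?L j s * indicator {s. \<exists>n\<ge>i. \<bar>chain m q x (j + n) s\<bar> \<le> R} s \<partial>S)"
      by (rule nn_integral_stream_split[symmetric]) measurable
    finally show "(\<integral>\<^sup>+s. ?L j s * emeasure S (?V (chain m q x j s)) \<partial>S) =
      (\<integral>\<^sup>+s. ?L j s * indicator {s. \<exists>n\<ge>i. \<bar>chain m q x (j + n) s\<bar> \<le> R} s \<partial>S)" .
  qed
  also have "\<dots> = (\<integral>\<^sup>+s. (\<Sum>j. ?L j s * indicator {s. \<exists>n\<ge>i. \<bar>chain m q x (j + n) s\<bar> \<le> R} s) \<partial>S)"
    by (rule nn_integral_suminf[symmetric]) measurable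
  also have "\<dots> \<le> (\<integral>\<^sup>+s. indicator {s. \<exists>n\<ge>Suc i. \<bar>chain m q x n s\<bar> \<le> R} s \<partial>S)"
  proof (rule nn_integral_mono_AE)
    show "AE s in S. (\<Sum>j. ?L j s * indicator {s. \<exists>n\<ge>i. \<bar>chain m q x (j + n) s\<bar> \<le> R} s) \<le>
        indicator {s. \<exists>n\<ge>Suc i. \<bar>chain m q x n s\<bar> \<le> R} s"
      using AE_ladder_time
    proof eventually_elim
      case (elim s)
      let ?t = "ladder_time m s"
      have "(\<Sum>j. ?L j s * indicator {s. \<exists>n\<ge>i. \<bar>chain m q x (j + n) s\<bar> \<le> R} s) =
        (\<Sum>j\<in>{?t}. ?L j s * indicator {s. \<exists>n\<ge>i. \<bar>chain m q x (j + n) s\<bar> \<le> R} s)"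
        using elim by (intro suminf_finite) (auto simp: indicator_def)
      also have "\<dots> = indicator {s. \<exists>n\<ge>i. \<bar>chain m q x (?t + n) s\<bar> \<le> R} s"
        using elim by simp
      also have "\<dots> \<le> indicator {s. \<exists>n\<ge>Suc i. \<bar>chain m q x n s\<bar> \<le> R} s"
      proof -
        have "\<exists>n\<ge>Suc i. \<bar>chain m q x n s\<bar> \<le> R" if "n \<ge> i" "\<bar>chain m q x (?t + n) s\<bar> \<le> R" for n
          using that elim by (intro exI[of _ "?t + n"]) (auto simp: ladder_def)
        then show ?thesis by (auto simp: indicator_def)
      qed
      finally show ?case .
    qed
  qed
  also have "\<dots> = emeasure S {s. \<exists>n\<ge>Suc i. \<bar>chain m q x n s\<bar> \<le> R}" by simp
  finally show ?thesis .
qed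

text \<open>Under \<open>\<pi>\<close> the chain is at the \<open>i\<close>-th ladder time in \<open>[-R, R]\<close> with the same probability for each \<open>i\<close>,
  and the \<open>i\<close>-th ladder time is at least \<open>i\<close>. So the probability of a visit after time \<open>i\<close> does
  not tend to zero, and some starting point has infinitely many visits with positive probability.\<close>
lemma recurrent_bounded: "\<exists>R\<ge>0. AE s in S. infinite {n. \<bar>chain m q 0 n s\<bar> \<le> R}"
proof -
  have "\<exists>R::nat. emeasure \<pi> {-real R..real R} \<noteq> 0"
  proof (rule ccontr)
    assume "\<not> ?thesis"
    then have "emeasure \<pi> (\<Union>R::nat. {-real R..real R}) = 0" by (intro emeasure_UN_eq_0) auto
    moreover have "(\<Union>R::nat. {-real R..real R}) = UNIV"
    proof -
      have "\<exists>R::nat. - real R \<le> x \<and> x \<le> real R" for x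
        using real_arch_simple[of "\<bar>x\<bar>"] by (auto simp: abs_le_iff minus_le_iff)
      then show ?thesis by auto
    qed
    moreover have "space \<pi> = UNIV" using sets_eq_imp_space_eq[of \<pi> borel] by simp
    ultimately show False using \<pi>.emeasure_space_1 by simp
  qed
  then obtain R :: nat where R: "emeasure \<pi> {-real R..real R} \<noteq> 0" by blast
  define u where "u i x = emeasure S {s. \<exists>n\<ge>i. \<bar>chain m q x n s\<bar> \<le> real R}" for i :: nat and x
  have [measurable]: "u i \<in> borel_measurable borel" for i
    unfolding u_def by (rule measurable_visit_prob)
  have lower: "emeasure \<pi> {-real R..real R} \<le> (\<integral>\<^sup>+x. u i x \<partial>\<pi>)" for i
  proof (induction i)
    case 0
    have "emeasure \<pi> {-real R..real R} = (\<integral>\<^sup>+x. indicator {-real R..real R} x \<partial>\<pi>)" by simp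
    also have "\<dots> \<le> (\<integral>\<^sup>+x. u 0 x \<partial>\<pi>)"
    proof (rule nn_integral_mono)
      fix x
      show "indicator {-real R..real R} x \<le> u 0 x"
      proof (cases "x \<in> {-real R..real R}")
        case True
        then have "{s. \<exists>n\<ge>0. \<bar>chain m q x n s\<bar> \<le> real R} = UNIV" by (auto intro!: exI[of _ 0])
        then show ?thesis using S.emeasure_space_1 by (simp add: u_def indicator_def)
      qed simp
    qed
    finally show ?case .
  next
    case (Suc i)
    note Suc
    also have "(\<integral>\<^sup>+x. u i x \<partial>\<pi>) = (\<integral>\<^sup>+x. \<integral>\<^sup>+s. u i (chain m q x (ladder_time m s) s) \<partial>S \<partial>\<pi>)"
      by (rule \<pi>_invariant[symmetric]) measurable
    also have "\<dots> \<le> (\<integral>\<^sup>+x. u (Suc i) x \<partial>\<pi>)"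
      unfolding u_def by (intro nn_integral_mono visits_from_ladder)
    finally show ?case .
  qed
  have "\<exists>x. \<not> (AE s in S. \<not> infinite {n. \<bar>chain m q x n s\<bar> \<le> real R})"
  proof (rule ccontr)
    assume "\<not> ?thesis"
    then have fin: "AE s in S. finite {n. \<bar>chain m q x n s\<bar> \<le> real R}" for x by simp
    have "(\<lambda>i. u i x) \<longlonglongrightarrow> 0" for x
    proof -
      have "(\<lambda>i. u i x) \<longlonglongrightarrow> emeasure S (\<Inter>i. {s. \<exists>n\<ge>i. \<bar>chain m q x n s\<bar> \<le> real R})"
        unfolding u_def
      proof (rule Lim_emeasure_decseq)
        show "decseq (\<lambda>i. {s. \<exists>n\<ge>i. \<bar>chain m q x n s\<bar> \<le> real R})"
          unfolding decseq_def by (auto intro: order_trans)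
      qed auto
      also have "emeasure S (\<Inter>i. {s. \<exists>n\<ge>i. \<bar>chain m q x n s\<bar> \<le> real R}) = 0"
      proof -
        have "AE s in S. \<not> (\<forall>i. \<exists>n\<ge>i. \<bar>chain m q x n s\<bar> \<le> real R)"
          using fin[of x]
        proof eventually_elim
          case (elim s)
          then show ?case
            using infinite_nat_iff_unbounded_le[of "{n. \<bar>chain m q x n s\<bar> \<le> real R}"] by simp
        qed
        then have "emeasure S {s. \<forall>i. \<exists>n\<ge>i. \<bar>chain m q x n s\<bar> \<le> real R} = 0"
          by (subst (asm) AE_iff_measurable[OF _ refl]) auto
        also have "{s. \<forall>i. \<exists>n\<ge>i. \<bar>chain m q x n s\<bar> \<le> real R} = (\<Inter>i. {s. \<exists>n\<ge>i. \<bar>chain m q x n s\<bar> \<le> real R})" by auto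
        finally show ?thesis .
      qed
      finally show ?thesis .
    qed
    then have "(\<lambda>i. \<integral>\<^sup>+x. u i x \<partial>\<pi>) \<longlonglongrightarrow> (\<integral>\<^sup>+x. 0 \<partial>\<pi>)"
      using S.emeasure_le_1 \<pi>.emeasure_space_1
      by (intro nn_integral_dominated_convergence[where w="\<lambda>_. 1"]) (auto simp: u_def)
    then have "emeasure \<pi> {-real R..real R} \<le> 0"
      by (intro LIMSEQ_le_const) (auto intro: lower)
    with R show False by simp
  qed
  then obtain x where "\<not> (AE s in S. \<not> infinite {n. \<bar>chain m q x n s\<bar> \<le> real R})" by blast
  from AE_visits_from_zero[OF this] show ?thesis by (intro exI[of _ "real R + 1"]) simp
qed

end

section \<open>Uniqueness and support\<close>

text \<open>A sequence of test functions that increases to the indicator of an open interval.\<close>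
definition trapezoid :: "nat \<Rightarrow> real \<Rightarrow> real \<Rightarrow> real \<Rightarrow> real" where
  "trapezoid k a b x = max 0 (min 1 (real k * min (x - a) (b - x)))"

lemma trapezoid_SUP: "(SUP k. ennreal (trapezoid k a b x)) = indicator {a<..<b} x"
proof (cases "x \<in> {a<..<b}")
  case True
  define d where "d = min (x - a) (b - x)"
  have d: "0 < d" using True by (auto simp: d_def)
  obtain k :: nat where k: "1 < real k * d" using ex_less_of_nat_mult[OF d] by blast
  have "ennreal (trapezoid k a b x) = 1" using k by (simp add: trapezoid_def d_def)
  moreover have "ennreal (trapezoid i a b x) \<le> 1" for i by (simp add: trapezoid_def)
  ultimately show ?thesis using True by (intro antisym SUP_least) (auto intro: SUP_upper2[of k])
next
  case False
  have "trapezoid k a b x = 0" for k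
  proof -
    have "real k * min (x - a) (b - x) \<le> 0" using False by (intro mult_nonneg_nonpos) auto
    then show ?thesis by (simp add: trapezoid_def)
  qed
  then show ?thesis using False by simp
qed

lemma trapezoid_incseq: "incseq (\<lambda>k x. ennreal (trapezoid k a b x))"
proof (intro incseq_SucI le_funI ennreal_leI)
  fix k x
  show "trapezoid k a b x \<le> trapezoid (Suc k) a b x"
  proof (cases "0 \<le> min (x - a) (b - x)")
    case True
    then have "real k * min (x - a) (b - x) \<le> real (Suc k) * min (x - a) (b - x)" by (intro mult_right_mono) auto
    then show ?thesis unfolding trapezoid_def by (intro max.mono min.mono order_refl)
  next
    case False
    then have "real k * min (x - a) (b - x) \<le> 0" by (intro mult_nonneg_nonpos) auto
    then show ?thesis by (simp add: trapezoid_def)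
  qed
qed

context oscillating_affine_stream
begin

lemma bump_mono: "bump r f \<Longrightarrow> r \<le> r' \<Longrightarrow> bump r' f"
  unfolding bump_def by (auto dest: le_less_trans)

lemma bump_zero: "bump r (\<lambda>_. 0)"
  unfolding bump_def by auto

lemma bump_cmult: "bump r f \<Longrightarrow> 0 \<le> c \<Longrightarrow> bump r (\<lambda>x. c * f x)"
proof -
  assume f: "bump r f" and c: "0 \<le> c"
  then obtain L where L: "0 \<le> L" "\<And>x y. \<bar>f x - f y\<bar> \<le> L * \<bar>x - y\<bar>" unfolding bump_def by blast
  have "\<bar>c * f x - c * f y\<bar> \<le> (c * L) * \<bar>x - y\<bar>" for x y
  proof -
    have "\<bar>c * f x - c * f y\<bar> = c * \<bar>f x - f y\<bar>" using c by (simp add: abs_mult flip: right_diff_distrib)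
    also have "\<dots> \<le> c * (L * \<bar>x - y\<bar>)" using c L by (intro mult_left_mono)
    finally show ?thesis by (simp add: mult.assoc)
  qed
  then show "bump r (\<lambda>x. c * f x)" using f c L unfolding bump_def
    by (auto intro!: exI[of _ "c * L"])
qed

lemma bump_trapezoid: "bump (max \<bar>a\<bar> \<bar>b\<bar>) (trapezoid k a b)"
  unfolding bump_def
proof (intro conjI allI impI)
  show "trapezoid k a b \<in> borel_measurable borel" unfolding trapezoid_def[abs_def] by measurable
  show "0 \<le> trapezoid k a b x" for x by (simp add: trapezoid_def)
  fix x assume "max \<bar>a\<bar> \<bar>b\<bar> < \<bar>x\<bar>"
  then have "min (x - a) (b - x) \<le> 0" by auto
  then have "real k * min (x - a) (b - x) \<le> 0" by (intro mult_nonneg_nonpos) auto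
  then show "trapezoid k a b x = 0" by (simp add: trapezoid_def)
next
  have "\<bar>trapezoid k a b x - trapezoid k a b y\<bar> \<le> real k * \<bar>x - y\<bar>" for x y
  proof -
    have "\<bar>trapezoid k a b x - trapezoid k a b y\<bar> \<le> \<bar>real k * min (x - a) (b - x) - real k * min (y - a) (b - y)\<bar>"
      unfolding trapezoid_def by (auto simp: max_def min_def)
    also have "\<dots> = real k * \<bar>min (x - a) (b - x) - min (y - a) (b - y)\<bar>"
      by (simp add: abs_mult flip: right_diff_distrib)
    also have "\<dots> \<le> real k * \<bar>x - y\<bar>" by (intro mult_left_mono) auto
    finally show ?thesis .
  qed
  then show "\<exists>L\<ge>0. \<forall>x y. \<bar>trapezoid k a b x - trapezoid k a b y\<bar> \<le> L * \<bar>x - y\<bar>"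
    by (intro exI[of _ "real k"]) auto
qed

lemma bump_integral_finite:
  assumes "radon \<nu>" "sets \<nu> = sets borel" "bump r f"
  shows "(\<integral>\<^sup>+x. ennreal (f x) \<partial>\<nu>) < \<infinity>"
proof -
  have [measurable_cong]: "sets \<nu> = sets borel" by fact
  obtain L where L: "0 \<le> L" "\<And>x y. \<bar>f x - f y\<bar> \<le> L * \<bar>x - y\<bar>" using assms(3) unfolding bump_def by blast
  define r' where "r' = max r 0"
  define B where "B = f 0 + L * r'"
  have "(\<integral>\<^sup>+x. ennreal (f x) \<partial>\<nu>) \<le> (\<integral>\<^sup>+x. ennreal B * indicator {-r'..r'} x \<partial>\<nu>)"
  proof (rule nn_integral_mono)
    fix x
    show "ennreal (f x) \<le> ennreal B * indicator {-r'..r'} x"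
    proof (cases "\<bar>x\<bar> \<le> r'")
      case True
      have "f x \<le> f 0 + L * \<bar>x\<bar>" using L(2)[of x 0] by simp
      also have "\<dots> \<le> B" using True L(1) by (simp add: B_def mult_left_mono)
      finally show ?thesis using True by (auto simp: indicator_def intro: ennreal_leI)
    next
      case False
      then have "f x = 0" using assms(3) unfolding bump_def r'_def by auto
      then show ?thesis by simp
    qed
  qed
  also have "\<dots> = ennreal B * emeasure \<nu> {-r'..r'}" by (simp add: nn_integral_cmult)
  also have "\<dots> < \<infinity>" using assms(1) by (simp add: radon_def ennreal_mult_less_top)
  finally show ?thesis .
qed

context
  fixes R :: real
  assumes rec: "AE s in S. infinite {n. \<bar>chain m q 0 n s\<bar> \<le> R}" and R: "0 \<le> R"
begin

text \<open>The comparison of \<open>0\<close> with a test function supported in the interval: the sum of its values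
  along the chain diverges, which takes infinitely many visits.\<close>
lemma visits_of_positive_measure:
  assumes \<nu>: "invariant \<nu>" "radon \<nu>" and e: "0 < e" and pos: "emeasure \<nu> {z-e<..<z+e} \<noteq> 0"
  shows "AE s in S. infinite {n. chain m q y n s \<in> {z-e<..<z+e}}"
proof -
  have [measurable_cong, simp]: "sets \<nu> = sets borel" using \<nu> by (simp add: invariant_def)
  define g where "g = trapezoid 1 (z - e) (z + e)"
  define r where "r = max \<bar>z - e\<bar> \<bar>z + e\<bar>"
  have g: "bump r g" unfolding r_def g_def by (rule bump_trapezoid)
  then have [measurable]: "g \<in> borel_measurable borel" by (simp add: bump_def)
  have gpos: "g x \<noteq> 0 \<longleftrightarrow> x \<in> {z-e<..<z+e}" for x by (auto simp: g_def trapezoid_def max_def min_def)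
  have "(\<integral>\<^sup>+x. ennreal (g x) \<partial>\<nu>) \<noteq> 0"
  proof
    assume "(\<integral>\<^sup>+x. ennreal (g x) \<partial>\<nu>) = 0"
    then have "AE x in \<nu>. ennreal (g x) = 0" by (subst (asm) nn_integral_0_iff_AE) auto
    then have "AE x in \<nu>. x \<notin> {z-e<..<z+e}"
    proof eventually_elim
      case (elim x)
      then have "g x = 0" using g by (simp add: bump_def antisym)
      then show ?case using gpos by blast
    qed
    then have "emeasure \<nu> {z-e<..<z+e} = 0"
      by (subst (asm) AE_iff_measurable[of "{z-e<..<z+e}"]) (auto simp: sets_eq_imp_space_eq[of \<nu> borel])
    with pos show False by simp
  qed
  then have "AE s in S. \<forall>j::nat. \<exists>N. \<forall>n\<ge>N. real j \<le> (\<Sum>k<n. g (chain m q y k s) - 0)"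
    by (intro sums_diverge[OF rec R \<nu> bump_zero g]) (auto simp: r_def zero_less_iff_neq_zero)
  then show ?thesis
  proof eventually_elim
    case (elim s)
    show ?case
    proof
      assume fin: "finite {n. chain m q y n s \<in> {z-e<..<z+e}}"
      define C where "C = (\<Sum>k\<in>{n. chain m q y n s \<in> {z-e<..<z+e}}. g (chain m q y k s))"
      have "(\<Sum>k<n. g (chain m q y k s)) \<le> C" for n
      proof -
        have "(\<Sum>k<n. g (chain m q y k s)) = (\<Sum>k\<in>{..<n} \<inter> {n. chain m q y n s \<in> {z-e<..<z+e}}. g (chain m q y k s))"
          using gpos by (intro sum.mono_neutral_right) auto
        also have "\<dots> \<le> C" unfolding C_def using g fin by (intro sum_mono2) (auto simp: bump_def)
        finally show ?thesis .
      qed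
      then have le: "(\<Sum>k<n. g (chain m q y k s) - 0) \<le> C" for n by simp
      obtain j :: nat where j: "C < real j" using reals_Archimedean2 by blast
      obtain N where "real j \<le> (\<Sum>k<N. g (chain m q y k s) - 0)" using elim by blast
      with le[of N] j show False by linarith
    qed
  qed
qed

text \<open>Otherwise the sums of \<open>g - f\<close> and of \<open>f - g\<close> along one chain would both tend to infinity.\<close>
lemma bump_comparison:
  assumes \<nu>1: "invariant \<nu>1" "radon \<nu>1" and \<nu>2: "invariant \<nu>2" "radon \<nu>2"
    and f: "bump r f" and g: "bump r g" and r: "0 \<le> r"
    and less: "(\<integral>\<^sup>+x. ennreal (f x) \<partial>\<nu>1) < (\<integral>\<^sup>+x. ennreal (g x) \<partial>\<nu>1)"
  shows "(\<integral>\<^sup>+x. ennreal (f x) \<partial>\<nu>2) \<le> (\<integral>\<^sup>+x. ennreal (g x) \<partial>\<nu>2)"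
proof (rule ccontr)
  assume "\<not> ?thesis"
  then have "AE s in S. \<forall>j::nat. \<exists>N. \<forall>n\<ge>N. real j \<le> (\<Sum>k<n. f (chain m q 0 k s) - g (chain m q 0 k s))"
    by (intro sums_diverge[OF rec R \<nu>2 g f r]) simp
  moreover have "AE s in S. \<forall>j::nat. \<exists>N. \<forall>n\<ge>N. real j \<le> (\<Sum>k<n. g (chain m q 0 k s) - f (chain m q 0 k s))"
    by (rule sums_diverge[OF rec R \<nu>1 f g r less])
  ultimately have "AE s in S. False"
  proof eventually_elim
    case (elim s)
    obtain N1 where N1: "\<And>n. n \<ge> N1 \<Longrightarrow> real 1 \<le> (\<Sum>k<n. f (chain m q 0 k s) - g (chain m q 0 k s))"
      using elim(1) by blast
    obtain N2 where N2: "\<And>n. n \<ge> N2 \<Longrightarrow> real 1 \<le> (\<Sum>k<n. g (chain m q 0 k s) - f (chain m q 0 k s))"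
      using elim(2) by blast
    have "(\<Sum>k<max N1 N2. f (chain m q 0 k s) - g (chain m q 0 k s)) + (\<Sum>k<max N1 N2. g (chain m q 0 k s) - f (chain m q 0 k s)) = 0"
      by (simp add: sum.distrib[symmetric])
    with N1[of "max N1 N2"] N2[of "max N1 N2"] show False by simp
  qed
  then show False by simp
qed

text \<open>If the ratios \<open>\<nu>1 f / \<nu>1 g\<close> and \<open>\<nu>2 f / \<nu>2 g\<close> differed, a number \<open>t\<close> strictly between them would make
  \<open>f\<close> and \<open>t g\<close> violate the comparison.\<close>
lemma bump_ratio:
  assumes \<nu>1: "invariant \<nu>1" "radon \<nu>1" and \<nu>2: "invariant \<nu>2" "radon \<nu>2"
    and f: "bump r f" and g: "bump r g" and r: "0 \<le> r"
    and g1: "(\<integral>\<^sup>+x. ennreal (g x) \<partial>\<nu>1) = ennreal c1" "0 < c1"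
    and g2: "(\<integral>\<^sup>+x. ennreal (g x) \<partial>\<nu>2) = ennreal c2" "0 < c2"
  shows "(\<integral>\<^sup>+x. ennreal (f x) \<partial>\<nu>2) = ennreal (c2 / c1) * (\<integral>\<^sup>+x. ennreal (f x) \<partial>\<nu>1)"
proof -
  have [measurable_cong, simp]: "sets \<nu>1 = sets borel" "sets \<nu>2 = sets borel"
    using \<nu>1 \<nu>2 by (simp_all add: invariant_def)
  have [measurable]: "g \<in> borel_measurable borel" using g by (simp add: bump_def)
  have g0: "0 \<le> g x" for x using g by (simp add: bump_def)
  obtain f1 where f1: "(\<integral>\<^sup>+x. ennreal (f x) \<partial>\<nu>1) = ennreal f1" "0 \<le> f1"
    using bump_integral_finite[OF \<nu>1(2) _ f] by (cases "\<integral>\<^sup>+x. ennreal (f x) \<partial>\<nu>1") auto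
  obtain f2 where f2: "(\<integral>\<^sup>+x. ennreal (f x) \<partial>\<nu>2) = ennreal f2" "0 \<le> f2"
    using bump_integral_finite[OF \<nu>2(2) _ f] by (cases "\<integral>\<^sup>+x. ennreal (f x) \<partial>\<nu>2") auto
  have tg: "(\<integral>\<^sup>+x. ennreal (t * g x) \<partial>\<nu>1) = ennreal (t * c1)" "(\<integral>\<^sup>+x. ennreal (t * g x) \<partial>\<nu>2) = ennreal (t * c2)"
    if "0 \<le> t" for t
    using that g0 g1 g2 by (simp_all add: ennreal_mult nn_integral_cmult)
  have "f2 / c2 = f1 / c1"
  proof (rule ccontr)
    assume "f2 / c2 \<noteq> f1 / c1"
    then consider "f2 / c2 < f1 / c1" | "f1 / c1 < f2 / c2" by linarith
    then show False
    proof cases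
      case 1
      then obtain t where t: "f2 / c2 < t" "t < f1 / c1" using dense by blast
      have t0: "0 \<le> t" using t f2(2) g2(2) by (meson divide_nonneg_pos le_less_trans less_imp_le)
      have "t * c1 < f1" "f2 < t * c2" using t g1(2) g2(2) by (simp_all add: field_simps)
      then have "(\<integral>\<^sup>+x. ennreal (t * g x) \<partial>\<nu>1) < (\<integral>\<^sup>+x. ennreal (f x) \<partial>\<nu>1)"
        "\<not> (\<integral>\<^sup>+x. ennreal (t * g x) \<partial>\<nu>2) \<le> (\<integral>\<^sup>+x. ennreal (f x) \<partial>\<nu>2)"
        using tg[OF t0] f1 f2 t0 g1(2) by (simp_all add: ennreal_less_iff not_le)
      then show False using bump_comparison[OF \<nu>1 \<nu>2 bump_cmult[OF g t0] f r] by blast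
    next
      case 2
      then obtain t where t: "f1 / c1 < t" "t < f2 / c2" using dense by blast
      have t0: "0 \<le> t" using t f1(2) g1(2) by (meson divide_nonneg_pos le_less_trans less_imp_le)
      have "f1 < t * c1" "t * c2 < f2" using t g1(2) g2(2) by (simp_all add: field_simps)
      then have "(\<integral>\<^sup>+x. ennreal (f x) \<partial>\<nu>1) < (\<integral>\<^sup>+x. ennreal (t * g x) \<partial>\<nu>1)"
        "\<not> (\<integral>\<^sup>+x. ennreal (f x) \<partial>\<nu>2) \<le> (\<integral>\<^sup>+x. ennreal (t * g x) \<partial>\<nu>2)"
        using tg[OF t0] f1 f2 t0 g2(2) by (simp_all add: ennreal_less_iff not_le)
      then show False using bump_comparison[OF \<nu>1 \<nu>2 f bump_cmult[OF g t0] r] by blast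
    qed
  qed
  then have "f2 = c2 / c1 * f1" using g1(2) g2(2) by (simp add: field_simps)
  then show ?thesis using f1 f2 g1(2) g2(2) ennreal_mult[of "c2 / c1" f1] by simp
qed

lemma invariant_unique:
  assumes \<nu>1: "invariant \<nu>1" "radon \<nu>1" "emeasure \<nu>1 UNIV \<noteq> 0"
    and \<nu>2: "invariant \<nu>2" "radon \<nu>2" "emeasure \<nu>2 UNIV \<noteq> 0"
  shows "\<exists>c::real. c > 0 \<and> \<nu>2 = scale_measure (ennreal c) \<nu>1"
proof -
  have sets [measurable_cong, simp]: "sets \<nu>1 = sets borel" "sets \<nu>2 = sets borel"
    using \<nu>1 \<nu>2 by (simp_all add: invariant_def)
  have ex: "\<exists>k::nat. emeasure \<nu> {-real k<..<real k} \<noteq> 0" if "sets \<nu> = sets borel" "emeasure \<nu> UNIV \<noteq> 0" for \<nu> :: "real measure"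
  proof (rule ccontr)
    assume "\<not> ?thesis"
    then have "emeasure \<nu> (\<Union>k::nat. {-real k<..<real k}) = 0" using that by (intro emeasure_UN_eq_0) auto
    moreover have "(\<Union>k::nat. {-real k<..<real k}) = UNIV"
    proof -
      have "\<exists>k::nat. x \<in> {-real k<..<real k}" for x
        using reals_Archimedean2[of "\<bar>x\<bar>"] by (auto simp: abs_less_iff minus_less_iff)
      then show ?thesis by blast
    qed
    ultimately show False using that by simp
  qed
  obtain k1 k2 :: nat where k: "emeasure \<nu>1 {-real k1<..<real k1} \<noteq> 0" "emeasure \<nu>2 {-real k2<..<real k2} \<noteq> 0"
    using ex[OF sets(1) \<nu>1(3)] ex[OF sets(2) \<nu>2(3)] by blast
  \<comment> \<open>One reference function \<open>g\<close>, equal to 1 on an interval that both measures charge, fixes the ratio.\<close>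
  define r where "r = real (max k1 k2) + 1"
  define g where "g = trapezoid 1 (-r) r"
  have "max \<bar>-r\<bar> \<bar>r\<bar> = r" by (simp add: r_def)
  then have g: "bump r g" unfolding g_def using bump_trapezoid[of "-r" r 1] by metis
  have [measurable]: "g \<in> borel_measurable borel" using g by (simp add: bump_def)
  have ge: "emeasure \<nu> {-real i<..<real i} \<le> (\<integral>\<^sup>+x. ennreal (g x) \<partial>\<nu>)"
    if [measurable_cong]: "sets \<nu> = sets borel" and "i \<le> max k1 k2" for \<nu> i
  proof -
    have "emeasure \<nu> {-real i<..<real i} = (\<integral>\<^sup>+x. indicator {-real i<..<real i} x \<partial>\<nu>)" using that by simp
    also have "\<dots> \<le> (\<integral>\<^sup>+x. ennreal (g x) \<partial>\<nu>)"
    proof (rule nn_integral_mono)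
      fix x
      have "g x = 1" if "x \<in> {-real i<..<real i}"
        using that \<open>i \<le> max k1 k2\<close> by (auto simp: g_def trapezoid_def r_def min_def max_def)
      then show "indicator {-real i<..<real i} x \<le> ennreal (g x)" by (auto simp: indicator_def)
    qed
    finally show ?thesis .
  qed
  obtain c1 where c1: "(\<integral>\<^sup>+x. ennreal (g x) \<partial>\<nu>1) = ennreal c1" "0 < c1"
  proof (cases "\<integral>\<^sup>+x. ennreal (g x) \<partial>\<nu>1")
    case (real c)
    moreover have "(\<integral>\<^sup>+x. ennreal (g x) \<partial>\<nu>1) \<noteq> 0" using ge[OF sets(1), of k1] k by auto
    ultimately show ?thesis using that by (auto simp: less_le)
  next
    case top
    then show ?thesis using bump_integral_finite[OF \<nu>1(2) sets(1) g] by simp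
  qed
  obtain c2 where c2: "(\<integral>\<^sup>+x. ennreal (g x) \<partial>\<nu>2) = ennreal c2" "0 < c2"
  proof (cases "\<integral>\<^sup>+x. ennreal (g x) \<partial>\<nu>2")
    case (real c)
    moreover have "(\<integral>\<^sup>+x. ennreal (g x) \<partial>\<nu>2) \<noteq> 0" using ge[OF sets(2), of k2] k by auto
    ultimately show ?thesis using that by (auto simp: less_le)
  next
    case top
    then show ?thesis using bump_integral_finite[OF \<nu>2(2) sets(2) g] by simp
  qed
  define c where "c = c2 / c1"
  have c: "0 < c" using c1 c2 by (simp add: c_def)
  have SUP: "emeasure \<nu> {a<..<b} = (SUP k. \<integral>\<^sup>+x. ennreal (trapezoid k a b x) \<partial>\<nu>)"
    if [measurable_cong]: "sets \<nu> = sets borel" for \<nu> a b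
  proof -
    have [measurable]: "trapezoid k a b \<in> borel_measurable borel" for k unfolding trapezoid_def[abs_def] by measurable
    have "emeasure \<nu> {a<..<b} = (\<integral>\<^sup>+x. indicator {a<..<b} x \<partial>\<nu>)" using that by simp
    also have "\<dots> = (\<integral>\<^sup>+x. (SUP k. ennreal (trapezoid k a b x)) \<partial>\<nu>)" by (simp add: trapezoid_SUP)
    also have "\<dots> = (SUP k. \<integral>\<^sup>+x. ennreal (trapezoid k a b x) \<partial>\<nu>)"
      by (rule nn_integral_monotone_convergence_SUP[OF trapezoid_incseq]) measurable
    finally show ?thesis .
  qed
  have interval: "emeasure \<nu>2 {a<..<b} = ennreal c * emeasure \<nu>1 {a<..<b}" for a b
  proof -
    let ?r = "max r (max \<bar>a\<bar> \<bar>b\<bar>)"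
    have "(\<integral>\<^sup>+x. ennreal (trapezoid k a b x) \<partial>\<nu>2) = ennreal c * (\<integral>\<^sup>+x. ennreal (trapezoid k a b x) \<partial>\<nu>1)" for k
    proof -
      have "bump ?r (trapezoid k a b)" by (rule bump_mono[OF bump_trapezoid]) simp
      moreover have "bump ?r g" by (rule bump_mono[OF g]) simp
      moreover have "0 \<le> ?r" by (simp add: r_def le_max_iff_disj)
      ultimately show ?thesis unfolding c_def by (rule bump_ratio[OF \<nu>1(1,2) \<nu>2(1,2) _ _ _ c1 c2])
    qed
    then show ?thesis unfolding SUP[OF sets(1)] SUP[OF sets(2)] by (simp add: SUP_mult_left_ennreal)
  qed
  have "\<nu>2 = scale_measure (ennreal c) \<nu>1"
  proof (rule measure_eqI_generator_eq[where E="range (\<lambda>(a, b). {a<..<b})" and \<Omega>=UNIV and A="\<lambda>n::nat. {-real n<..<real n}"])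
    show "Int_stable (range (\<lambda>(a, b). {a<..<b::real}))"
    proof (rule Int_stableI_image)
      fix I J :: "real \<times> real"
      have "(case I of (a, b) \<Rightarrow> {a<..<b}) \<inter> (case J of (a, b) \<Rightarrow> {a<..<b}) =
          (case (max (fst I) (fst J), min (snd I) (snd J)) of (a, b) \<Rightarrow> {a<..<b})"
        by (auto split: prod.splits)
      then show "\<exists>K\<in>UNIV. (case I of (a, b) \<Rightarrow> {a<..<b}) \<inter> (case J of (a, b) \<Rightarrow> {a<..<b}) = (case K of (a, b) \<Rightarrow> {a<..<b})"
        by blast
    qed
    show "sets \<nu>2 = sigma_sets UNIV (range (\<lambda>(a, b). {a<..<b}))"
      "sets (scale_measure (ennreal c) \<nu>1) = sigma_sets UNIV (range (\<lambda>(a, b). {a<..<b}))"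
    proof -
      have "sets (borel :: real measure) = sigma_sets UNIV (range (\<lambda>(a, b). box a b))"
        by (subst borel_eq_box) simp
      also have "range (\<lambda>(a, b). box a b) = range (\<lambda>(a, b). {a<..<b::real})"
        by (simp add: box_real)
      finally show "sets \<nu>2 = sigma_sets UNIV (range (\<lambda>(a, b). {a<..<b}))"
        "sets (scale_measure (ennreal c) \<nu>1) = sigma_sets UNIV (range (\<lambda>(a, b). {a<..<b}))"
        by simp_all
    qed
    show "(\<Union>n::nat. {-real n<..<real n}) = UNIV"
    proof -
      have "\<exists>k::nat. x \<in> {-real k<..<real k}" for x
        using reals_Archimedean2[of "\<bar>x\<bar>"] by (auto simp: abs_less_iff minus_less_iff)
      then show ?thesis by blast
    qed
    show "emeasure \<nu>2 {-real i<..<real i} \<noteq> \<infinity>" for i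
    proof -
      have "emeasure \<nu>2 {-real i<..<real i} \<le> emeasure \<nu>2 {-real i..real i}" by (rule emeasure_mono) auto
      also have "\<dots> < \<infinity>" using \<nu>2(2) by (simp add: radon_def)
      finally show ?thesis by simp
    qed
    show "range (\<lambda>n::nat. {-real n<..<real n}) \<subseteq> range (\<lambda>(a, b). {a<..<b})"
    proof
      fix X assume "X \<in> range (\<lambda>n::nat. {-real n<..<real n})"
      then obtain n :: nat where "X = (case (-real n, real n) of (a, b) \<Rightarrow> {a<..<b})" by auto
      then show "X \<in> range (\<lambda>(a, b). {a<..<b})" by (rule range_eqI)
    qed
    show "emeasure \<nu>2 X = emeasure (scale_measure (ennreal c) \<nu>1) X" if "X \<in> range (\<lambda>(a, b). {a<..<b})" for X
    proof -
      from that obtain a b where "X = {a<..<b}" by auto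
      then show ?thesis using interval by simp
    qed
  qed simp
  with c show ?thesis by blast
qed

end

end

section \<open>Transfer to the given random vectors\<close>

lemma (in prob_space) distr_to_stream_Suc:
  fixes Y :: "nat \<Rightarrow> 'a \<Rightarrow> 'b"
  assumes indep: "indep_vars (\<lambda>_. N) Y {1..}"
    and law: "\<And>n. n \<ge> 1 \<Longrightarrow> distr M N (Y n) = \<mu>"
  shows "(\<lambda>\<omega>. to_stream (\<lambda>n. Y (Suc n) \<omega>)) \<in> measurable M (stream_space N)"
    and "distr M (stream_space N) (\<lambda>\<omega>. to_stream (\<lambda>n. Y (Suc n) \<omega>)) = stream_space \<mu>"
proof -
  have Y [measurable]: "Y (Suc n) \<in> measurable M N" for n
    using indep unfolding indep_vars_def by auto
  have Y': "Y n \<in> measurable M N" if "n \<in> {1..}" for n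
    using indep that unfolding indep_vars_def by auto
  show meas [measurable]: "(\<lambda>\<omega>. to_stream (\<lambda>n. Y (Suc n) \<omega>)) \<in> measurable M (stream_space N)"
    by (rule measurable_stream_space2) (simp add: to_stream_def)
  have [measurable_cong]: "sets \<mu> = sets N" using law[of 1, symmetric] by simp
  have \<mu>: "prob_space \<mu>" unfolding law[of 1, simplified, symmetric] by (rule prob_space_distr) (rule Y)
  have D: "distr M (\<Pi>\<^sub>M i\<in>{1::nat..}. N) (\<lambda>x. \<lambda>i\<in>{1..}. Y i x) = (\<Pi>\<^sub>M i\<in>{1..}. \<mu>)"
  proof -
    have "distr M (\<Pi>\<^sub>M i\<in>{1::nat..}. N) (\<lambda>x. \<lambda>i\<in>{1..}. Y i x) = (\<Pi>\<^sub>M i\<in>{1..}. distr M N (Y i))"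
      using indep Y' by (subst indep_vars_iff_distr_eq_PiM'[symmetric]) auto
    also have "\<dots> = (\<Pi>\<^sub>M i\<in>{1..}. \<mu>)" by (rule PiM_cong) (simp_all add: law)
    finally show ?thesis .
  qed
  have R: "distr (\<Pi>\<^sub>M i\<in>{1::nat..}. \<mu>) (\<Pi>\<^sub>M i\<in>UNIV. \<mu>) (\<lambda>w. \<lambda>n\<in>UNIV. w (Suc n)) = (\<Pi>\<^sub>M i\<in>UNIV. \<mu>)"
    using \<mu> by (intro distr_PiM_reindex[where f=Suc]) auto
  have m1: "(\<lambda>x. \<lambda>i\<in>{1..}. Y i x) \<in> measurable M (\<Pi>\<^sub>M i\<in>{1::nat..}. N)"
    by (rule measurable_restrict) (rule Y')
  have m2: "(\<lambda>w. \<lambda>n\<in>UNIV. w (Suc n)) \<in> measurable (\<Pi>\<^sub>M i\<in>{1::nat..}. N) (\<Pi>\<^sub>M i\<in>UNIV. \<mu>)"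
    by (rule measurable_restrict) measurable
  have "stream_space \<mu> = distr (\<Pi>\<^sub>M i\<in>UNIV. \<mu>) (stream_space \<mu>) to_stream"
    by (rule stream_space_eq_distr)
  also have "\<dots> = distr (distr (distr M (\<Pi>\<^sub>M i\<in>{1::nat..}. N) (\<lambda>x. \<lambda>i\<in>{1..}. Y i x))
      (\<Pi>\<^sub>M i\<in>UNIV. \<mu>) (\<lambda>w. \<lambda>n\<in>UNIV. w (Suc n))) (stream_space \<mu>) to_stream"
    unfolding D R ..
  also have "\<dots> = distr M (stream_space \<mu>) (to_stream \<circ> ((\<lambda>w. \<lambda>n\<in>UNIV. w (Suc n)) \<circ> (\<lambda>x. \<lambda>i\<in>{1..}. Y i x)))"
    using m1 m2 by (simp add: distr_distr measurable_comp[OF m1 m2])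
  also have "\<dots> = distr M (stream_space N) (\<lambda>\<omega>. to_stream (\<lambda>n. Y (Suc n) \<omega>))"
    by (rule distr_cong) (auto intro!: sets_stream_space_cong \<open>sets \<mu> = sets N\<close> simp: restrict_def)
  finally show "distr M (stream_space N) (\<lambda>\<omega>. to_stream (\<lambda>n. Y (Suc n) \<omega>)) = stream_space \<mu>" ..
qed

text \<open>By the Lindelof property countably many of the null intervals cover the complement.\<close>
lemma emeasure_compl_eq_0_of_null_intervals:
  fixes \<nu> :: "real measure"
  assumes sets: "sets \<nu> = sets borel" and "closed L"
    and null: "\<And>z. z \<notin> L \<Longrightarrow> \<exists>e>0. emeasure \<nu> {z-e<..<z+e} = 0"
  shows "emeasure \<nu> (- L) = 0"
proof -
  define \<F> where "\<F> = {{z-e<..<z+e} |z e. z \<notin> L \<and> 0 < e \<and> emeasure \<nu> {z-e<..<z+e} = (0::ennreal)}"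
  have "\<And>S. S \<in> \<F> \<Longrightarrow> open S" by (auto simp: \<F>_def)
  then obtain \<F>' where \<F>': "\<F>' \<subseteq> \<F>" "countable \<F>'" "\<Union>\<F>' = \<Union>\<F>" by (rule Lindelof)
  have "\<Union>\<F>' \<in> null_sets \<nu>"
    using \<F>' sets by (intro null_sets_UN'[of \<F>' id, simplified]) (auto simp: \<F>_def null_sets_def)
  moreover have "- L \<subseteq> \<Union>\<F>"
  proof
    fix z assume "z \<in> - L"
    then obtain e where "0 < e" "emeasure \<nu> {z-e<..<z+e} = 0" using null by auto
    then have "{z-e<..<z+e} \<in> \<F>" "z \<in> {z-e<..<z+e}" using \<open>z \<in> - L\<close> by (auto simp: \<F>_def)
    then show "z \<in> \<Union>\<F>" by blast
  qed
  ultimately show ?thesis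
    using \<F>'(3) emeasure_mono[of "- L" "\<Union>\<F>'" \<nu>] null_setsD1[of "\<Union>\<F>'" \<nu>] null_setsD2[of "\<Union>\<F>'" \<nu>] by simp
qed

theorem theorem1p5:
  fixes P :: "'a measure"
    and M Q :: "'a \<Rightarrow> real"
    and Ms Qs :: "nat \<Rightarrow> 'a \<Rightarrow> real"
    and a b :: real
  assumes "prob_space P"
    and "M \<in> borel_measurable P" and "Q \<in> borel_measurable P"
    and "\<And>\<omega>. \<omega> \<in> space P \<Longrightarrow> M \<omega> \<ge> 0 \<and> Q \<omega> \<ge> 0"
    and "\<And>n \<omega>. n \<ge> 1 \<Longrightarrow> \<omega> \<in> space P \<Longrightarrow> Ms n \<omega> \<ge> 0 \<and> Qs n \<omega> \<ge> 0"
    and "prob_space.indep_vars P (\<lambda>_. borel :: (real \<times> real) measure)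
           (\<lambda>n \<omega>. (Ms n \<omega>, Qs n \<omega>)) {1..}"
    and "\<And>n. n \<ge> 1 \<Longrightarrow>
           distr P (borel :: (real \<times> real) measure) (\<lambda>\<omega>. (Ms n \<omega>, Qs n \<omega>)) =
           distr P borel (\<lambda>\<omega>. (M \<omega>, Q \<omega>))"
    and "measure P {\<omega> \<in> space P. M \<omega> = 0} = 0"
    and "measure P {\<omega> \<in> space P. Q \<omega> = 0} < 1"
    and "AE \<omega> in P. liminf (\<lambda>n. ereal (Pi_rde Ms n \<omega>)) = 0"
    and "AE \<omega> in P. limsup (\<lambda>n. ereal (Pi_rde Ms n \<omega>)) = \<infinity>"
    and "(\<integral>\<^sup>+ \<omega>. ln_enat (sigma_rde Ms \<omega>) \<partial>P) < \<infinity>"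
    and "a > 0" and "b > 0"
    and "AE \<omega> in P. Q \<omega> \<le> a * M \<omega> + b"
  shows "null_recurrent P M Q (\<lambda>x. rde_chain Ms Qs (\<lambda>_. x)) \<and>
    (\<exists>\<nu>. invariant_radon P M Q \<nu> \<and>
      (\<forall>\<nu>'. invariant_radon P M Q \<nu>' \<longrightarrow> (\<exists>c::real. c > 0 \<and> \<nu>' = scale_measure (ennreal c) \<nu>)))"
proof -
  note [measurable] = assms(2,3)
  interpret P: prob_space P by fact
  define \<mu> where "\<mu> = distr P (borel :: (real \<times> real) measure) (\<lambda>\<omega>. (M \<omega>, Q \<omega>))"
  have MQ [measurable]: "(\<lambda>\<omega>. (M \<omega>, Q \<omega>)) \<in> measurable P (borel :: (real \<times> real) measure)" by measurable
  have sets_\<mu> [measurable_cong, simp]: "sets \<mu> = sets borel" by (simp add: \<mu>_def)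
  have [simp]: "space \<mu> = UNIV" by (simp add: \<mu>_def)
  \<comment> \<open>The coordinates, modified on a null set so that positivity holds for every letter.\<close>
  define m q :: "real \<times> real \<Rightarrow> real"
    where "m p = (if 0 < fst p then fst p else 1)" and "q p = max 0 (snd p)" for p
  have [measurable]: "fst \<in> borel_measurable (borel :: (real \<times> real) measure)"
    "snd \<in> borel_measurable (borel :: (real \<times> real) measure)"
    by (simp_all add: borel_prod[symmetric])
  have meas: "m \<in> borel_measurable borel" "q \<in> borel_measurable borel"
    unfolding m_def[abs_def] q_def[abs_def] by measurable
  have [measurable]: "m \<in> borel_measurable \<mu>" "q \<in> borel_measurable \<mu>" using meas by simp_all
  interpret A: affine_stream \<mu> m q
  proof (intro affine_stream.intro affine_stream_axioms.intro)
    show "prob_space \<mu>" unfolding \<mu>_def by (rule P.prob_space_distr) measurable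
    show "0 < m p" "0 \<le> q p" for p by (simp_all add: m_def q_def)
  qed simp_all
  define \<Phi> where "\<Phi> \<omega> = to_stream (\<lambda>n. (Ms (Suc n) \<omega>, Qs (Suc n) \<omega>))" for \<omega>
  have \<Phi>_meas: "\<Phi> \<in> measurable P (stream_space borel)" and \<Phi>_law: "distr P (stream_space borel) \<Phi> = stream_space \<mu>"
    unfolding \<Phi>_def[abs_def]
    using P.distr_to_stream_Suc[OF assms(6), of \<mu>] assms(7) unfolding \<mu>_def by blast+
  have \<Phi> [measurable]: "\<Phi> \<in> measurable P (stream_space \<mu>)"
    using \<Phi>_meas sets_stream_space_cong[OF sets_\<mu>] by (simp cong: measurable_cong_sets)
  have \<Phi>_snth: "\<Phi> \<omega> !! n = (Ms (Suc n) \<omega>, Qs (Suc n) \<omega>)" for \<omega> n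
    by (simp add: \<Phi>_def to_stream_def)
  have law: "stream_space \<mu> = distr P (stream_space \<mu>) \<Phi>"
    unfolding \<Phi>_law[symmetric] by (rule distr_cong) (simp_all add: \<Phi>_law sets_stream_space_cong[OF sets_\<mu>])
  have AE_pull: "AE \<omega> in P. R (\<Phi> \<omega>)" if "AE s in stream_space \<mu>. R s" for R
    using that by (subst (asm) law) (rule AE_distrD[OF \<Phi>])
  have AE_push: "AE s in stream_space \<mu>. R s" if "AE \<omega> in P. R (\<Phi> \<omega>)" "Measurable.pred (stream_space \<mu>) R" for R
    using that by (subst law, subst AE_distr_iff) (auto simp: pred_def)
  have M_pos: "AE \<omega> in P. 0 < M \<omega>"
  proof -
    have "AE \<omega> in P. M \<omega> \<noteq> 0"
      using assms(8) by (subst AE_iff_measurable[OF _ refl]) (auto simp: P.emeasure_eq_measure)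
    moreover have "AE \<omega> in P. 0 \<le> M \<omega>" using assms(4) by auto
    ultimately show ?thesis by eventually_elim simp
  qed
  have m_M: "AE \<omega> in P. m (M \<omega>, Q \<omega>) = M \<omega> \<and> q (M \<omega>, Q \<omega>) = Q \<omega>"
    using M_pos AE_space by eventually_elim (use assms(4) in \<open>simp add: m_def q_def\<close>)
  have "AE \<omega> in P. \<forall>n. 0 < Ms (Suc n) \<omega>"
    unfolding AE_all_countable
  proof
    fix n
    have law_n: "distr P borel (\<lambda>\<omega>. (Ms (Suc n) \<omega>, Qs (Suc n) \<omega>)) = \<mu>"
      unfolding \<mu>_def by (rule assms(7)) simp
    have "AE p in \<mu>. 0 < fst p" unfolding \<mu>_def using M_pos by (subst AE_distr_iff) auto
    then have pos: "AE p in distr P (borel :: (real \<times> real) measure) (\<lambda>\<omega>. (Ms (Suc n) \<omega>, Qs (Suc n) \<omega>)). 0 < fst p"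
      by (simp only: law_n)
    have "(\<lambda>\<omega>. (Ms (Suc n) \<omega>, Qs (Suc n) \<omega>)) \<in> measurable P (borel :: (real \<times> real) measure)"
      using assms(6) unfolding P.indep_vars_def by auto
    from AE_distrD[OF this pos] show "AE \<omega> in P. 0 < Ms (Suc n) \<omega>" by simp
  qed
  then have coords: "AE \<omega> in P. (\<forall>n. m (\<Phi> \<omega> !! n) = Ms (Suc n) \<omega> \<and> q (\<Phi> \<omega> !! n) = Qs (Suc n) \<omega>) \<and> (\<forall>n. 0 < Ms (Suc n) \<omega>)"
    using AE_space
    by eventually_elim (use assms(5) in \<open>simp add: \<Phi>_snth m_def q_def\<close>)
  have prodm_eq: "prodm m n (\<Phi> \<omega>) = Pi_rde Ms n \<omega>"
    if "\<forall>n. m (\<Phi> \<omega> !! n) = Ms (Suc n) \<omega> \<and> q (\<Phi> \<omega> !! n) = Qs (Suc n) \<omega>" for n \<omega>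
    using that by (simp add: prodm_def Pi_rde_def prod.atLeast1_atMost_eq)
  have chain_eq: "chain m q x n (\<Phi> \<omega>) = rde_chain Ms Qs (\<lambda>_. x) n \<omega>"
    if "\<forall>n. m (\<Phi> \<omega> !! n) = Ms (Suc n) \<omega> \<and> q (\<Phi> \<omega> !! n) = Qs (Suc n) \<omega>" for x n \<omega>
    using that by (induction n) simp_all
  interpret L: ladder_affine_stream \<mu> m q a b
  proof (intro ladder_affine_stream.intro oscillating_affine_stream.intro A.affine_stream_axioms
      oscillating_affine_stream_axioms.intro ladder_affine_stream_axioms.intro)
    show "emeasure \<mu> {p. 0 < q p} \<noteq> 0"
    proof
      assume "emeasure \<mu> {p. 0 < q p} = 0"
      then have "AE p in \<mu>. \<not> 0 < q p" by (subst AE_iff_measurable[OF _ refl]) auto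
      then have "AE \<omega> in P. \<not> 0 < q (M \<omega>, Q \<omega>)" unfolding \<mu>_def by (rule AE_distrD[rotated]) measurable
      then have "AE \<omega> in P. Q \<omega> = 0" using AE_space
        by eventually_elim (use assms(4) in \<open>fastforce simp: q_def\<close>)
      then have "measure P {\<omega> \<in> space P. Q \<omega> = 0} = 1" by (simp add: P.prob_Collect_eq_1)
      with assms(9) show False by simp
    qed
    show "AE s in stream_space \<mu>. \<forall>j::nat. \<exists>n. real j < prodm m n s"
    proof (rule AE_push)
      show "AE \<omega> in P. \<forall>j::nat. \<exists>n. real j < prodm m n (\<Phi> \<omega>)"
        using assms(11) coords
      proof eventually_elim
        case (elim \<omega>)
        show ?case
        proof (rule ccontr)
          assume "\<not> ?case"
          then obtain j :: nat where "\<And>n. Pi_rde Ms n \<omega> \<le> real j"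
            using prodm_eq[OF elim(2)[THEN conjunct1]] by (auto simp: not_less)
          then have "limsup (\<lambda>n. ereal (Pi_rde Ms n \<omega>)) \<le> ereal (real j)"
            by (intro Limsup_bounded) simp
          with elim(1) show False by simp
        qed
      qed
    qed measurable
    show "AE s in stream_space \<mu>. \<forall>j::nat. \<exists>n. real j < prodm (\<lambda>p. 1 / m p) n s"
    proof (rule AE_push)
      show "AE \<omega> in P. \<forall>j::nat. \<exists>n. real j < prodm (\<lambda>p. 1 / m p) n (\<Phi> \<omega>)"
        using assms(10) coords
      proof eventually_elim
        case (elim \<omega>)
        show ?case
        proof (rule ccontr)
          assume "\<not> ?case"
          then obtain j :: nat where j: "\<And>n. prodm (\<lambda>p. 1 / m p) n (\<Phi> \<omega>) \<le> real j"
            by (auto simp: not_less)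
          have le: "1 / real (Suc j) \<le> Pi_rde Ms n \<omega>" for n
          proof -
            have pos: "0 < prodm m n (\<Phi> \<omega>)" by (rule A.prodm_pos)
            have "prodm (\<lambda>p. 1 / m p) n (\<Phi> \<omega>) = 1 / prodm m n (\<Phi> \<omega>)" by (simp add: prodm_def prod_dividef)
            then have "1 / prodm m n (\<Phi> \<omega>) \<le> real (Suc j)" using j[of n] by simp
            then have "1 / real (Suc j) \<le> prodm m n (\<Phi> \<omega>)" using pos by (simp add: field_simps)
            then show ?thesis using prodm_eq[OF elim(2)[THEN conjunct1]] by simp
          qed
          have "ereal (1 / real (Suc j)) \<le> liminf (\<lambda>n. ereal (Pi_rde Ms n \<omega>))"
            by (rule Liminf_bounded) (rule always_eventually, use le in simp)
          moreover have "0 < 1 / real (Suc j)" by simp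
          ultimately show False using elim(1) by (metis ereal_less_eq(3) linorder_not_less zero_ereal_def)
        qed
      qed
      have "(\<lambda>p. 1 / m p) \<in> borel_measurable \<mu>" by measurable
      then have [measurable]: "prodm (\<lambda>p. 1 / m p) n \<in> borel_measurable (stream_space \<mu>)" for n
        unfolding prodm_def[abs_def] by measurable
      show "Measurable.pred (stream_space \<mu>) (\<lambda>s. \<forall>j::nat. \<exists>n. real j < prodm (\<lambda>p. 1 / m p) n s)"
        by measurable
    qed
    have "(\<integral>\<^sup>+s. ennreal (ln (real (ladder_time m s))) \<partial>stream_space \<mu>) =
        (\<integral>\<^sup>+\<omega>. ennreal (ln (real (ladder_time m (\<Phi> \<omega>)))) \<partial>P)"
      by (subst law, subst nn_integral_distr) measurable
    also have "\<dots> \<le> (\<integral>\<^sup>+ \<omega>. ln_enat (sigma_rde Ms \<omega>) \<partial>P)"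
    proof (rule nn_integral_mono_AE)
      show "AE \<omega> in P. ennreal (ln (real (ladder_time m (\<Phi> \<omega>)))) \<le> ln_enat (sigma_rde Ms \<omega>)"
        using coords
      proof eventually_elim
        case (elim \<omega>)
        have "S_rde Ms n \<omega> = ln (prodm m n (\<Phi> \<omega>))" for n
        proof -
          have "ln (prodm m n (\<Phi> \<omega>)) = (\<Sum>k<n. ln (m (\<Phi> \<omega> !! k)))"
            unfolding prodm_def by (intro ln_prod) (simp_all add: A.m_pos less_imp_neq[OF A.m_pos, symmetric])
          then show ?thesis using elim by (simp add: S_rde_def sum.atLeast1_atMost_eq)
        qed
        then have S: "S_rde Ms n \<omega> < 0 \<longleftrightarrow> prodm m n (\<Phi> \<omega>) < 1" for n
          using A.prodm_pos[of n "\<Phi> \<omega>"] by simp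
        show ?case
        proof (cases "\<exists>n>0. prodm m n (\<Phi> \<omega>) < 1")
          case True
          then obtain n where n: "0 < n" "prodm m n (\<Phi> \<omega>) < 1" by blast
          let ?t = "ladder_time m (\<Phi> \<omega>)"
          have "sigma_rde Ms \<omega> = enat ?t"
            unfolding sigma_rde_def S
          proof (rule antisym)
            show "Inf (enat ` {k. 1 \<le> k \<and> prodm m k (\<Phi> \<omega>) < 1}) \<le> enat ?t"
              using ladder_time(1)[OF n] by (intro Inf_lower) (auto simp: ladder_def)
            show "enat ?t \<le> Inf (enat ` {k. 1 \<le> k \<and> prodm m k (\<Phi> \<omega>) < 1})"
              by (rule Inf_greatest) (auto simp: ladder_time_def intro!: Least_le)
          qed
          then show ?thesis by (simp add: ln_enat_def)
        next
          case False
          then have none: "{k. 1 \<le> k \<and> prodm m k (\<Phi> \<omega>) < 1} = {}" by (auto simp: Suc_le_eq)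
          have "sigma_rde Ms \<omega> = \<infinity>"
            unfolding sigma_rde_def S none by (simp add: Inf_enat_def)
          then show ?thesis by (simp add: ln_enat_def)
        qed
      qed
    qed
    also have "\<dots> < \<infinity>" by (rule assms(12))
    finally show "(\<integral>\<^sup>+s. ennreal (ln (real (ladder_time m s))) \<partial>stream_space \<mu>) < \<infinity>" .
    have "AE \<omega> in P. q (M \<omega>, Q \<omega>) \<le> a * m (M \<omega>, Q \<omega>) + b"
      using m_M assms(15) by eventually_elim simp
    then show "AE p in \<mu>. q p \<le> a * m p + b"
      unfolding \<mu>_def using meas by (subst AE_distr_iff) auto
    show "0 \<le> a" "0 \<le> b" using assms(13,14) by simp_all
  qed
  let ?X = "\<lambda>x. rde_chain Ms Qs (\<lambda>_. x)"
  obtain R where R: "0 \<le> R" and rec: "AE s in stream_space \<mu>. infinite {n. \<bar>chain m q 0 n s\<bar> \<le> R}"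
    using L.recurrent_bounded by blast
  have inv_iff: "invariant_radon P M Q \<nu> \<longleftrightarrow> A.invariant \<nu> \<and> L.radon \<nu> \<and> emeasure \<nu> UNIV \<noteq> 0" for \<nu>
  proof -
    have kernel: "emeasure \<mu> {p. m p * x + q p \<in> A} = emeasure P {\<omega> \<in> space P. M \<omega> * x + Q \<omega> \<in> A}"
      if [measurable]: "A \<in> sets borel" for x A
    proof -
      have "{p. m p * x + q p \<in> A} \<in> sets \<mu>" by measurable
      then have "emeasure \<mu> {p. m p * x + q p \<in> A} = emeasure P {\<omega> \<in> space P. m (M \<omega>, Q \<omega>) * x + q (M \<omega>, Q \<omega>) \<in> A}"
        unfolding \<mu>_def by (subst emeasure_distr) (auto intro!: arg_cong[where f="emeasure P"])
      also have "\<dots> = emeasure P {\<omega> \<in> space P. M \<omega> * x + Q \<omega> \<in> A}"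
      proof (rule emeasure_eq_AE)
        show "AE \<omega> in P. \<omega> \<in> {\<omega> \<in> space P. m (M \<omega>, Q \<omega>) * x + q (M \<omega>, Q \<omega>) \<in> A} \<longleftrightarrow>
            \<omega> \<in> {\<omega> \<in> space P. M \<omega> * x + Q \<omega> \<in> A}"
          using m_M by eventually_elim simp
        have [measurable]: "(\<lambda>\<omega>. m (M \<omega>, Q \<omega>)) \<in> borel_measurable P" "(\<lambda>\<omega>. q (M \<omega>, Q \<omega>)) \<in> borel_measurable P"
          using measurable_compose[OF MQ meas(1)] measurable_compose[OF MQ meas(2)] by simp_all
        show "{\<omega> \<in> space P. m (M \<omega>, Q \<omega>) * x + q (M \<omega>, Q \<omega>) \<in> A} \<in> sets P" by measurable
      qed measurable
      finally show ?thesis .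
    qed
    have "(\<forall>K. compact K \<longrightarrow> emeasure \<nu> K < \<infinity>) \<longleftrightarrow> L.radon \<nu>" if "sets \<nu> = sets borel"
    proof
      assume "\<forall>K. compact K \<longrightarrow> emeasure \<nu> K < \<infinity>"
      then show "L.radon \<nu>" unfolding L.radon_def by (auto intro: compact_Icc)
    next
      assume rad: "L.radon \<nu>"
      show "\<forall>K. compact K \<longrightarrow> emeasure \<nu> K < \<infinity>"
      proof (intro allI impI)
        fix K :: "real set" assume "compact K"
        then have "bounded K" by (rule compact_imp_bounded)
        then obtain r where "\<And>x. x \<in> K \<Longrightarrow> \<bar>x\<bar> \<le> r" unfolding bounded_iff by auto
        then have "K \<subseteq> {-r..r}" by (auto simp: abs_le_iff minus_le_iff)
        then have "emeasure \<nu> K \<le> emeasure \<nu> {-r..r}" using that by (intro emeasure_mono) auto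
        also have "\<dots> < \<infinity>" using rad by (simp add: L.radon_def)
        finally show "emeasure \<nu> K < \<infinity>" .
      qed
    qed
    then show ?thesis
      unfolding invariant_radon_def A.invariant_def using kernel by auto
  qed
  have \<nu>: "invariant_radon P M Q L.\<nu>"
    unfolding inv_iff using L.invariant_\<nu> L.radon_\<nu> L.\<nu>_nonzero by blast
  have unique: "\<exists>c::real. c > 0 \<and> \<nu>' = scale_measure (ennreal c) L.\<nu>" if "invariant_radon P M Q \<nu>'" for \<nu>'
    using that \<nu> unfolding inv_iff by (intro L.invariant_unique[OF rec R]) auto
  have contractive: "locally_contractive P ?X"
    unfolding locally_contractive_def
  proof (intro allI impI)
    fix K :: "real set" and x y :: real assume "compact K"
    then have "bounded K" by (rule compact_imp_bounded)
    then obtain r where r: "\<And>x. x \<in> K \<Longrightarrow> \<bar>x\<bar> \<le> r" unfolding bounded_iff by auto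
    show "AE \<omega> in P. (\<lambda>n. \<bar>?X x n \<omega> - ?X y n \<omega>\<bar> * indicator K (?X x n \<omega>)) \<longlonglongrightarrow> 0"
      using AE_pull[OF L.AE_dual_divergent] coords
    proof eventually_elim
      case (elim \<omega>)
      note X = chain_eq[OF elim(2)[THEN conjunct1], symmetric]
      show ?case
      proof (rule LIMSEQ_I)
        fix e :: real assume "0 < e"
        then obtain n0 where n0: "\<And>n. n \<ge> n0 \<Longrightarrow> \<bar>?X x n \<omega>\<bar> \<le> r \<Longrightarrow> \<bar>?X x n \<omega> - ?X y n \<omega>\<bar> \<le> e / 2"
          using L.contraction[OF elim(1), of "e / 2" x r y] unfolding X by auto
        have "norm (\<bar>?X x n \<omega> - ?X y n \<omega>\<bar> * indicator K (?X x n \<omega>) - 0) < e" if "n \<ge> n0" for n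
          using n0[OF that] r[of "?X x n \<omega>"] \<open>0 < e\<close> by (auto simp: indicator_def)
        then show "\<exists>no. \<forall>n\<ge>no. norm (\<bar>?X x n \<omega> - ?X y n \<omega>\<bar> * indicator K (?X x n \<omega>) - 0) < e" by blast
      qed
    qed
  qed
  have support: "recurrence_set P ?X {z}" if pos: "\<And>e. 0 < e \<Longrightarrow> emeasure L.\<nu> {z-e<..<z+e} \<noteq> 0" for z
    unfolding recurrence_set_def
  proof (intro conjI ballI allI impI)
    fix x U assume "x \<in> {z}" and U: "open U \<and> U \<inter> {z} \<noteq> {}"
    then have x: "x = z" and "z \<in> U" by auto
    then obtain e where e: "0 < e" "\<And>y. dist y z < e \<Longrightarrow> y \<in> U" using U open_dist by blast
    have "AE s in stream_space \<mu>. infinite {n. chain m q z n s \<in> {z-e<..<z+e}}"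
      by (rule L.visits_of_positive_measure[OF rec R L.invariant_\<nu> L.radon_\<nu> e(1) pos[OF e(1)]])
    from AE_pull[OF this] coords show "AE \<omega> in P. infinite {n. ?X x n \<omega> \<in> U}"
    proof eventually_elim
      case (elim \<omega>)
      have "{n. chain m q z n (\<Phi> \<omega>) \<in> {z-e<..<z+e}} \<subseteq> {n. ?X x n \<omega> \<in> U}"
        unfolding chain_eq[OF elim(2)[THEN conjunct1]] x by (auto intro!: e(2) simp: dist_real_def)
      then show ?case using elim(1) by (rule infinite_super)
    qed
  qed auto
  let ?L = "limit_set P ?X"
  have null: "emeasure L.\<nu> (- ?L) = 0"
  proof (rule emeasure_compl_eq_0_of_null_intervals)
    show "closed ?L" by (simp add: limit_set_def)
    fix z assume "z \<notin> ?L"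
    then have "\<not> recurrence_set P ?X {z}" using recurrence_set_subset_limit_set by blast
    then show "\<exists>e>0. emeasure L.\<nu> {z-e<..<z+e} = 0" using support by blast
  qed simp
  have mass: "emeasure L.\<nu> ?L = \<infinity>"
  proof -
    have "?L \<in> sets L.\<nu>" by (simp add: limit_set_def borel_closed)
    then have "emeasure L.\<nu> UNIV = emeasure L.\<nu> ?L + emeasure L.\<nu> (- ?L)"
      by (subst plus_emeasure) auto
    then show ?thesis using null L.\<nu>_infinite by simp
  qed
  have "recurrent P ?X"
  proof (rule ccontr)
    assume "\<not> recurrent P ?X"
    then have "?L = {}" unfolding recurrent_def limit_set_def by simp
    with mass show False by simp
  qed
  then have "null_recurrent P M Q ?X"
    unfolding null_recurrent_def using contractive \<nu> mass by blast
  with \<nu> unique show ?thesis by blast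
qed

end
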